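(* Let $1<q<\infty$, and let $1<p<t<r<\infty$ or $1<p\le t<r=\infty$. Then for $f\in M_{p,q}^{t,r}(\mathbb R^n)$ and $g\in\mathcal H_{p',q'}^{t',r'}(\mathbb R^n)$, $$\left|\int_{\mathbb R^n}f(x)g(x)\,dx\right|\lesssim\int_{\mathbb R^n}\mathcal M^\sharp f(x)\,\mathcal M_{\mathcal D}g(x)\,dx\lesssim\int_{\mathbb R^n}\mathcal M^\sharp f(x)\,\mathcal Mg(x)\,dx.$$ Furthermore, for $f\in M_{p,q}^{t,r}(\mathbb R^n)$, $$\|f\|_{M_{p,q}^{t,r}(\mathbb R^n)}\lesssim\|\mathcal M^\sharp f\|_{M_{p,q}^{t,r}(\mathbb R^n)}.$$ The implicit constants are independent of $f$ and $g$.
   Context: $A\lesssim B$ means $A\le cB$ for a constant $c>0$. Primes denote conjugate exponents. Functions are complex-valued and measurable on $\mathbb R^n$. Maximal functions: $\mathcal Mf(x)=\sup_{B\ni x}\frac1{|B|}\int_B|f|$ over balls $B$ containing $x$; $\mathcal M_{\mathcal D}f(x)=\sup_{Q\in\mathcal D,\,Q\ni x}\frac1{|Q|}\int_Q|f|$ over dyadic cubes; the sharp maximal function is $\mathcal M^\sharp f(x)=\sup_{Q\ni x}\frac1{|Q|}\int_Q|f(y)-f_Q|\,dy$, $f_Q=\frac1{|Q|}\int_Qf$, supremum over all cubes $Q$ containing $x$. Lorentz norm: with $d_f(s)=|\{x:|f(x)|>s\}|$ and $f^*(u)=\inf\{s>0:d_f(s)\le u\}$, $\|f\|_{L^{p,q}}=\left(\int_0^\infty(u^{1/p}f^*(u))^q\frac{du}{u}\right)^{1/q}$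 for $q<\infty$. For a cube $Q$, $\|f\|_{L^{p,q}(Q)}=\|f\chi_Q\|_{L^{p,q}}$. Dyadic cubes: $Q_{j,m}=\prod_{i=1}^n[2^{-j}m_i,2^{-j}(m_i+1))$, $j\in\mathbb Z$, $m\in\mathbb Z^n$; $\mathcal D$ is the set of all of them. Bourgain-Morrey-Lorentz space: $M_{p,q}^{t,r}(\mathbb R^n)$ is the set of measurable $f$ with $\|f\|_{M_{p,q}^{t,r}(\mathbb R^n)}=\left(\sum_{Q\in\mathcal D}|Q|^{r/t-r/p}\|f\|_{L^{p,q}(Q)}^r\right)^{1/r}<\infty$ (supremum over $Q\in\mathcal D$ of $|Q|^{1/t-1/p}\|f\|_{L^{p,q}(Q)}$ if $r=\infty$). Block space: a function $b$ is a $(p',q',t')$-block supported on a cube $Q$ if $b$ is supported on $Q$ and $\|b\|_{L^{p',q'}}\le|Q|^{1/p'-1/t'}$. $\mathcal H_{p',q'}^{t',r'}(\mathbb R^n)$ is the set of measurable $f$ that can be written as $f=\sum_{(j,k)\in\mathbb Z^{1+n}}\lambda_{j,k}b_{j,k}$ (convergence in $L^1_{\mathrm{loc}}$) with $\lambda\in\ell^{r'}(\mathbb Z^{1+n})$ and each $b_{j,k}$ a $(p',q',t')$-block supported on $Q_{j,k}$; its norm is $\inf\|\lambda\|_{\ell^{r'}}$ over all such representations. *)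

theory Defs
  imports "HOL-Analysis.Analysis"
begin

text \<open>
  Norms and maximal functions take values in \<^typ>\<open>ennreal\<close>, since they may be infinite. Those
  norms only depend on the modulus of their argument, so they are defined on
  \<^typ>\<open>ennreal\<close>-valued functions \<open>F\<close>: a complex-valued \<open>f\<close> enters as \<open>modulus f\<close>, and an extended
  nonnegative function such as \<open>sharp_maximal f\<close> enters directly.
\<close>

definition modulus :: "('a \<Rightarrow> complex) \<Rightarrow> 'a \<Rightarrow> ennreal" where
  "modulus f x = ennreal (cmod (f x))"

text \<open>Only used with an exponent \<open>a > 0\<close>, where \<open>\<infinity>\<close> to the power \<open>a\<close> is \<open>\<infinity>\<close>.\<close>
definition ennpowr :: "ennreal \<Rightarrow> real \<Rightarrow> ennreal" where
  "ennpowr x a = (if x = \<infinity> then \<infinity> else ennreal (enn2real x powr a))"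

definition conj_exp :: "ereal \<Rightarrow> real" where
  "conj_exp s = (if s = \<infinity> then 1 else real_of_ereal s / (real_of_ereal s - 1))"

subsection \<open>Cubes and maximal functions\<close>

definition cube :: "real^'n \<Rightarrow> real \<Rightarrow> (real^'n) set" where
  "cube a l = cbox a (\<chi> i. a $ i + l)"

text \<open>The cubes containing \<open>x\<close>. They are taken closed; for locally integrable functions the
  supremum in the sharp maximal function is the same for open or half-open cubes.\<close>
definition cubes_at :: "real^'n \<Rightarrow> (real^'n) set set" where
  "cubes_at x = {Q. x \<in> Q \<and> (\<exists>a l. 0 < l \<and> Q = cube a l)}"

definition balls_at :: "real^'n \<Rightarrow> (real^'n) set set" where
  "balls_at x = {B. x \<in> B \<and> (\<exists>y \<rho>. 0 < \<rho> \<and> B = ball y \<rho>)}"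

definition dyadic_cube :: "int \<times> (int^'n) \<Rightarrow> (real^'n) set" where
  "dyadic_cube = (\<lambda>(j, m). {x. \<forall>i. 2 powi (- j) * of_int (m $ i) \<le> x $ i \<and>
                                     x $ i < 2 powi (- j) * (of_int (m $ i) + 1)})"

definition dyadic_cubes :: "(real^'n) set set" where
  "dyadic_cubes = range dyadic_cube"

definition mean_abs :: "(real^'n \<Rightarrow> complex) \<Rightarrow> (real^'n) set \<Rightarrow> ennreal" where
  "mean_abs f S = (\<integral>\<^sup>+y\<in>S. ennreal (cmod (f y)) \<partial>lebesgue) / emeasure lebesgue S"

definition average :: "(real^'n \<Rightarrow> complex) \<Rightarrow> (real^'n) set \<Rightarrow> complex" where
  "average f Q = set_lebesgue_integral lebesgue Q f /\<^sub>R measure lebesgue Q"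

definition maximal :: "(real^'n \<Rightarrow> complex) \<Rightarrow> real^'n \<Rightarrow> ennreal" where
  "maximal f x = (SUP B\<in>balls_at x. mean_abs f B)"

definition dyadic_maximal :: "(real^'n \<Rightarrow> complex) \<Rightarrow> real^'n \<Rightarrow> ennreal" where
  "dyadic_maximal f x = (SUP Q\<in>{Q \<in> dyadic_cubes. x \<in> Q}. mean_abs f Q)"

definition sharp_maximal :: "(real^'n \<Rightarrow> complex) \<Rightarrow> real^'n \<Rightarrow> ennreal" where
  "sharp_maximal f x = (SUP Q\<in>cubes_at x. mean_abs (\<lambda>y. f y - average f Q) Q)"

subsection \<open>Lorentz norm\<close>

definition distr_fun :: "(real^'n \<Rightarrow> ennreal) \<Rightarrow> real \<Rightarrow> ennreal" where
  "distr_fun F s = emeasure lebesgue {x. F x > ennreal s}"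

text \<open>The infimum of the empty set is \<open>\<infinity>\<close>.\<close>
definition rearrangement :: "(real^'n \<Rightarrow> ennreal) \<Rightarrow> real \<Rightarrow> ennreal" where
  "rearrangement F u = (INF s\<in>{s. 0 < s \<and> distr_fun F s \<le> ennreal u}. ennreal s)"

definition lorentz_norm :: "real \<Rightarrow> real \<Rightarrow> (real^'n \<Rightarrow> ennreal) \<Rightarrow> ennreal" where
  "lorentz_norm p q F =
     ennpowr (\<integral>\<^sup>+u\<in>{0<..}. ennpowr (ennreal (u powr (1 / p)) * rearrangement F u) q
                               * ennreal (1 / u) \<partial>lborel) (1 / q)"

definition lorentz_norm_on ::
    "real \<Rightarrow> real \<Rightarrow> (real^'n) set \<Rightarrow> (real^'n \<Rightarrow> ennreal) \<Rightarrow> ennreal" where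
  "lorentz_norm_on p q Q F = lorentz_norm p q (\<lambda>x. F x * indicator Q x)"

subsection \<open>Bourgain-Morrey-Lorentz spaces\<close>

definition bml_norm ::
    "real \<Rightarrow> real \<Rightarrow> real \<Rightarrow> ereal \<Rightarrow> (real^'n \<Rightarrow> ennreal) \<Rightarrow> ennreal" where
  "bml_norm p q t r F =
     (if r = \<infinity> then
        (SUP Q\<in>dyadic_cubes. ennreal (measure lebesgue Q powr (1 / t - 1 / p))
                               * lorentz_norm_on p q Q F)
      else let \<rho> = real_of_ereal r in
        ennpowr (\<Sum>\<^sub>\<infinity>Q\<in>dyadic_cubes. ennreal (measure lebesgue Q powr (\<rho> / t - \<rho> / p))
                               * ennpowr (lorentz_norm_on p q Q F) \<rho>) (1 / \<rho>))"

definition bml_space ::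
    "real \<Rightarrow> real \<Rightarrow> real \<Rightarrow> ereal \<Rightarrow> (real^'n \<Rightarrow> complex) set" where
  "bml_space p q t r =
     {f. f \<in> borel_measurable lebesgue \<and> bml_norm p q t r (modulus f) < \<infinity>}"

subsection \<open>Block spaces\<close>

text \<open>In this section \<open>p\<close>, \<open>q\<close>, \<open>t\<close>, \<open>r\<close> play the role of the conjugate exponents, all of which
  are finite in the application.\<close>

definition is_block ::
    "real \<Rightarrow> real \<Rightarrow> real \<Rightarrow> (real^'n) set \<Rightarrow> (real^'n \<Rightarrow> complex) \<Rightarrow> bool" where
  "is_block p q t Q b \<longleftrightarrow>
     b \<in> borel_measurable lebesgue \<and> (\<forall>x. x \<notin> Q \<longrightarrow> b x = 0) \<and>
     lorentz_norm p q (modulus b) \<le> ennreal (measure lebesgue Q powr (1 / p - 1 / t))"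

definition sums_in_L1loc ::
    "('i \<Rightarrow> real^'n \<Rightarrow> complex) \<Rightarrow> (real^'n \<Rightarrow> complex) \<Rightarrow> bool" where
  "sums_in_L1loc u f \<longleftrightarrow>
     (\<forall>K. compact K \<longrightarrow>
        ((\<lambda>I. \<integral>\<^sup>+x\<in>K. ennreal (cmod (f x - (\<Sum>i\<in>I. u i x))) \<partial>lebesgue) \<longlongrightarrow> 0)
          (finite_subsets_at_top UNIV))"

definition block_space ::
    "real \<Rightarrow> real \<Rightarrow> real \<Rightarrow> real \<Rightarrow> (real^'n \<Rightarrow> complex) set" where
  "block_space p q t r =
     {f. f \<in> borel_measurable lebesgue \<and>
         (\<exists>(c :: int \<times> (int^'n) \<Rightarrow> complex) b.
            (\<lambda>i. cmod (c i) powr r) summable_on UNIV \<and>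
            (\<forall>i. is_block p q t (dyadic_cube i) (b i)) \<and>
            sums_in_L1loc (\<lambda>i x. c i * b i x) f)}"

end

theory Submission
  imports Defs
begin

text \<open>
  Write \<open>osc Q\<close> for the mean of \<open>|f - f\<^sub>Q|\<close> over \<open>Q\<close> and \<open>W\<close> for the product of the sharp maximal
  function of \<open>f\<close> and the dyadic maximal function of \<open>g\<close>.

  Pairing. A Calderon-Zygmund decomposition of \<open>|f - f\<^sub>Q|\<close> at height \<open>2 osc Q\<close> selects subcubes that
  fill at most half of \<open>Q\<close>, so \<open>osc Q\<close> times the integral of \<open>|g|\<close> over \<open>Q\<close> is at most twice the integral
  of \<open>W\<close> over the unselected part. Iterating inside the selected cubes charges disjoint sets and
  bounds the integral of \<open>|f - f\<^sub>Q| |g|\<close> over \<open>Q\<close> by that of \<open>W\<close>. The average \<open>f\<^sub>Q\<close> is telescoped along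
  the dyadic ancestors of \<open>Q\<close>, whose averages tend to 0; each step is charged to the shell between
  consecutive ancestors. Hence even the integral of \<open>|f g|\<close> is controlled by \<open>W\<close>.

  Norm inequality. Decomposing instead the indicator of \<open>{|f - f\<^sub>Q| > s}\<close> yields, for the decreasing
  rearrangements of \<open>h = |f - f\<^sub>Q|\<close> and of the sharp maximal function \<open>S\<close> on \<open>Q\<close>, the inequality
  \<open>h*(u) \<le> h*(2u) + C S*(u/2)\<close>; iterating it needs no a priori finiteness because \<open>h*\<close> vanishes
  beyond \<open>|Q|\<close>. The averages are again telescoped along ancestors. A cube is the \<open>k\<close>-th ancestor of
  \<open>2\<close> to the \<open>nk\<close> cubes, and this multiplicity is absorbed because \<open>t < r\<close>.
\<close>

text \<open>These rules would rewrite \<open>lebesgue\<close> measures to \<open>lborel\<close> measures of main parts, and split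
  the indices \<open>(j, m)\<close> of dyadic cubes.\<close>
declare emeasure_completion [simp del] nn_integral_completion [simp del]
declare split_paired_All [simp del] split_paired_Ex [simp del]

subsection \<open>Dyadic cubes\<close>

text \<open>The pairing bound rests on one exchange: on a cube Q the product of \<open>osc Q\<close>
  and the mean of |g| is at most \<open>W\<close> at every point, so it can be paid by any subset of
  half the measure. The obstacle is the last generation of cubes: f g is not known to be integrable
  when the domination is proved. A set of measure at most 2^-m |Q| is therefore left out and m tends
  to infinity. The block structure of g makes f g integrable, by Hoelder for Lorentz norms on each
  cube and Hoelder for the coefficients; this gives the left-hand integral its meaning. In the norm
  inequality the iteration produces dilations by 2^k of the rearrangement of \<open>S\<close>. Each
  costs a factor 2^(-k/p) in Lorentz norm, so the series converges. For the k-th ancestor, the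
  normalising power of |Q| yields 2^(-nk/t) and the multiplicity 2^(nk/r), and t < r makes the
  product decay. Powers of infinite sums are controlled by geometric weights, on which half of the
  available decay is spent.\<close>

definition dyadic_index :: "int \<Rightarrow> real^'n \<Rightarrow> int \<times> (int^'n)" where
  "dyadic_index j x = (j, \<chi> l. \<lfloor>2 powi j * x $ l\<rfloor>)"

text \<open>Levels drop as cubes grow, since the side is \<open>2 powi (- j)\<close>. Integer
  division rounds towards minus infinity, so the same formula serves negative coordinates.\<close>

definition ancestor :: "nat \<Rightarrow> int \<times> (int^'n) \<Rightarrow> int \<times> (int^'n)" where
  "ancestor k i = (fst i - int k, \<chi> l. snd i $ l div 2 ^ k)"

lemma fst_dyadic_index [simp]: "fst (dyadic_index j x) = j"
  by (simp add: dyadic_index_def)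

lemma fst_ancestor [simp]: "fst (ancestor k i) = fst i - int k"
  by (simp add: ancestor_def)

lemma ancestor_0 [simp]: "ancestor 0 i = i"
  by (simp add: ancestor_def prod_eq_iff)

text \<open>A point and a level determine a dyadic cube, so membership is an equation between
  indices. Nesting and uniqueness then reduce to floors and integer division.\<close>

lemma mem_dyadic_cube_iff: "x \<in> dyadic_cube i \<longleftrightarrow> i = dyadic_index (fst i) x"
proof -
  obtain j m where i: "i = (j, m)" by (cases i)
  have "(2 powi (- j) * of_int (m $ l) \<le> x $ l \<and> x $ l < 2 powi (- j) * (of_int (m $ l) + 1))
          \<longleftrightarrow> m $ l = \<lfloor>2 powi j * x $ l\<rfloor>" for l
    using zero_less_power_int[of "2::real" j]
    by (auto simp: eq_commute[of "m $ l"] floor_eq_iff power_int_minus field_simps)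
  then show ?thesis
    by (auto simp: i dyadic_cube_def dyadic_index_def vec_eq_iff)
qed

lemma dyadic_index_mem [simp]: "x \<in> dyadic_cube (dyadic_index j x)"
  by (simp add: mem_dyadic_cube_iff)

lemma ancestor_dyadic_index: "ancestor k (dyadic_index j x) = dyadic_index (j - int k) x"
proof -
  have "\<lfloor>2 powi j * x $ l\<rfloor> div 2 ^ k = \<lfloor>2 powi (j - int k) * x $ l\<rfloor>" for l
  proof -
    have "\<lfloor>2 powi (j - int k) * x $ l\<rfloor> = \<lfloor>(2 powi j * x $ l) / real_of_int (2 ^ k)\<rfloor>"
      by (simp add: power_int_diff)
    also have "\<dots> = \<lfloor>2 powi j * x $ l\<rfloor> div 2 ^ k"
      by (intro floor_divide_real_eq_div) auto
    finally show ?thesis by simp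
  qed
  then show ?thesis
    by (simp add: ancestor_def dyadic_index_def)
qed

lemma dyadic_cube_subset_ancestor: "dyadic_cube i \<subseteq> dyadic_cube (ancestor k i)"
proof
  fix x assume "x \<in> dyadic_cube i"
  then show "x \<in> dyadic_cube (ancestor k i)"
    by (metis ancestor_dyadic_index dyadic_index_mem mem_dyadic_cube_iff)
qed

lemma ancestor_add: "ancestor k (ancestor l i) = ancestor (k + l) i"
  by (auto simp: ancestor_def vec_eq_iff power_add mult.commute simp flip: zdiv_zmult2_eq)

lemma ancestor_if_mem:
  assumes "x \<in> dyadic_cube i" "x \<in> dyadic_cube i'" "fst i' \<le> fst i"
  shows "i' = ancestor (nat (fst i - fst i')) i"
proof -
  have "ancestor (nat (fst i - fst i')) (dyadic_index (fst i) x) = dyadic_index (fst i') x"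
    using assms(3) by (simp add: ancestor_dyadic_index)
  then have "ancestor (nat (fst i - fst i')) i = dyadic_index (fst i') x"
    using assms(1) by (simp add: mem_dyadic_cube_iff)
  then show ?thesis
    using assms(2) by (simp add: mem_dyadic_cube_iff)
qed

lemma dyadic_cube_nested:
  assumes "x \<in> dyadic_cube i" "x \<in> dyadic_cube i'" "fst i' \<le> fst i"
  shows "dyadic_cube i \<subseteq> dyadic_cube i'"
  using ancestor_if_mem[OF assms] dyadic_cube_subset_ancestor by metis

text \<open>The sharp maximal function uses closed cubes, the norms half-open dyadic ones. They
  differ by part of the boundary, a null set, so volumes, averages and oscillations agree.\<close>

lemma dyadic_cube_eq_cube:
  fixes i :: "int \<times> (int^'n)"
  obtains a where "dyadic_cube i \<subseteq> cube a (2 powi (- fst i))"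
    "negligible (cube a (2 powi (- fst i)) - dyadic_cube i)" "a \<in> dyadic_cube i"
proof -
  obtain j m where i: "i = (j, m)" by (cases i)
  define a :: "real^'n" where "a = (\<chi> l. 2 powi (- j) * of_int (m $ l))"
  have sub: "dyadic_cube i \<subseteq> cube a (2 powi (- fst i))"
    by (force simp: i dyadic_cube_def cube_def mem_box_cart a_def algebra_simps intro: less_imp_le)
  have "box a (\<chi> l. a $ l + 2 powi (- j)) \<subseteq> dyadic_cube i"
    by (force simp: i dyadic_cube_def mem_box_cart a_def algebra_simps intro: less_imp_le)
  then have "cube a (2 powi (- fst i)) - dyadic_cube i
      \<subseteq> cbox a (\<chi> l. a $ l + 2 powi (- j)) - box a (\<chi> l. a $ l + 2 powi (- j))"
    by (auto simp: cube_def i)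
  then have "negligible (cube a (2 powi (- fst i)) - dyadic_cube i)"
    using negligible_frontier_interval negligible_subset by blast
  moreover have "a \<in> dyadic_cube i"
    using zero_less_power_int[of "2::real" "-j"] by (simp add: i dyadic_cube_def a_def)
  ultimately show ?thesis using that sub by blast
qed

lemma dyadic_cube_nonempty: "dyadic_cube i \<noteq> {}"
  by (rule dyadic_cube_eq_cube[of i]) auto

lemma sets_cube [measurable, simp]: "cube a l \<in> sets lebesgue"
  by (simp add: cube_def)

lemma sets_dyadic_cube [measurable, simp]: "dyadic_cube i \<in> sets lebesgue"
proof (rule dyadic_cube_eq_cube[of i])
  fix a assume *: "dyadic_cube i \<subseteq> cube a (2 powi (- fst i))"
    "negligible (cube a (2 powi (- fst i)) - dyadic_cube i)"
  have "dyadic_cube i = cube a (2 powi (- fst i)) - (cube a (2 powi (- fst i)) - dyadic_cube i)"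
    using * by blast
  also have "\<dots> \<in> sets lebesgue"
    using * by (intro sets.Diff sets_cube negligible_imp_sets)
  finally show ?thesis .
qed

lemma measure_cube: "0 \<le> l \<Longrightarrow> measure lebesgue (cube (a::real^'n) l) = l ^ CARD('n)"
  by (simp add: cube_def content_cbox_cart interval_ne_empty_cart)

lemma emeasure_cube: "0 \<le> l \<Longrightarrow> emeasure lebesgue (cube (a::real^'n) l) = ennreal (l ^ CARD('n))"
  using emeasure_eq_measure2[of "cube a l"] measure_cube[of l a] by (simp add: cube_def fmeasurable_cbox)

lemma emeasure_dyadic_cube:
  "emeasure lebesgue (dyadic_cube (i :: int \<times> (int^'n))) = ennreal ((2 powi (- fst i)) ^ CARD('n))"
proof (rule dyadic_cube_eq_cube[of i])
  fix a assume *: "dyadic_cube i \<subseteq> cube a (2 powi (- fst i))"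
    "negligible (cube a (2 powi (- fst i)) - dyadic_cube i)"
  have "emeasure lebesgue (dyadic_cube i)
      = emeasure lebesgue (cube a (2 powi (- fst i)) - (cube a (2 powi (- fst i)) - dyadic_cube i))"
    using * by (metis double_diff order_refl)
  also have "\<dots> = emeasure lebesgue (cube a (2 powi (- fst i)))"
    using * by (intro emeasure_Diff_null_set) (auto simp: negligible_iff_null_sets)
  finally show ?thesis
    by (metis emeasure_cube zero_le_power_int zero_le_numeral)
qed

lemma measure_dyadic_cube:
  "measure lebesgue (dyadic_cube (i :: int \<times> (int^'n))) = (2 powi (- fst i)) ^ CARD('n)"
  unfolding measure_def emeasure_dyadic_cube by (simp add: zero_le_power_int)

lemma emeasure_dyadic_cube_ancestor:
  "emeasure lebesgue (dyadic_cube (ancestor k (i :: int \<times> (int^'n))))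
     = ennreal (2 ^ (k * CARD('n))) * emeasure lebesgue (dyadic_cube i)"
proof -
  have "((2::real) powi (- fst (ancestor k i))) ^ CARD('n) = 2 ^ (k * CARD('n)) * (2 powi (- fst i)) ^ CARD('n)"
    by (simp add: power_int_diff power_int_minus power_mult power_mult_distrib power_divide field_simps)
  then show ?thesis
    by (simp only: emeasure_dyadic_cube ennreal_mult[symmetric] zero_le_power zero_le_power_int zero_le_numeral)
qed

text \<open>The volume determines the level, and a common point then determines the index. This
  turns sums over the set of dyadic cubes into sums over indices.\<close>

lemma inj_dyadic_cube: "inj (dyadic_cube :: int \<times> (int^'n) \<Rightarrow> _)"
proof
  fix i i' :: "int \<times> (int^'n)" assume *: "dyadic_cube i = dyadic_cube i'"
  have "((2::real) powi (- fst i)) ^ CARD('n) = (2 powi (- fst i')) ^ CARD('n)"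
    using measure_dyadic_cube[of i] measure_dyadic_cube[of i'] * by simp
  then have "(2::real) powi (- fst i) = 2 powi (- fst i')"
    by (rule power_eq_imp_eq_base) auto
  then have "fst i = fst i'"
    using power_int_strict_increasing[of "- fst i" "- fst i'" "2::real"]
      power_int_strict_increasing[of "- fst i'" "- fst i" "2::real"] by (cases "fst i" "fst i'" rule: linorder_cases) auto
  moreover obtain x where "x \<in> dyadic_cube i"
    using dyadic_cube_nonempty[of i] by blast
  ultimately show "i = i'"
    using * by (metis mem_dyadic_cube_iff)
qed

lemma dist_dyadic_cube:
  assumes "x \<in> dyadic_cube (i :: int \<times> (int^'n))" "y \<in> dyadic_cube i"
  shows "dist x y < real CARD('n) * 2 powi (- fst i)"
proof -
  have "\<bar>(x - y) $ l\<bar> < 2 powi (- fst i)" for l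
    using assms by (cases i) (auto simp: dyadic_cube_def abs_less_iff algebra_simps dest!: spec[of _ l])
  then have "(\<Sum>l\<in>UNIV. \<bar>(x - y) $ l\<bar>) < (\<Sum>l\<in>(UNIV::'n set). 2 powi (- fst i))"
    by (intro sum_strict_mono) auto
  then show ?thesis
    using norm_le_l1_cart[of "x - y"] by (simp add: dist_norm)
qed

text \<open>The lower bound \<open>j0\<close> on the level lets the small cube be placed inside a
  prescribed dyadic cube around the point.\<close>

lemma dyadic_cube_in_open:
  assumes "open U" "x \<in> U"
  obtains j where "j0 \<le> j" "dyadic_cube (dyadic_index j (x::real^'n)) \<subseteq> U"
proof -
  obtain e where e: "0 < e" "ball x e \<subseteq> U"
    using assms open_contains_ball by blast
  obtain k where "(1/2) ^ k < e / real CARD('n)"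
    using real_arch_pow_inv[of "e / real CARD('n)" "1/2"] e by auto
  moreover define k' where "k' = max k (nat j0)"
  moreover have "(1/2::real) ^ k' \<le> (1/2) ^ k"
    by (intro power_decreasing) (auto simp: k'_def)
  ultimately have k': "(1/2) ^ k' < e / real CARD('n)" "j0 \<le> int k'"
    by (linarith, simp add: k'_def)
  have "dyadic_cube (dyadic_index (int k') x) \<subseteq> ball x e"
  proof
    fix y assume "y \<in> dyadic_cube (dyadic_index (int k') x)"
    then have "dist x y < real CARD('n) * 2 powi (- int k')"
      using dist_dyadic_cube[of x "dyadic_index (int k') x" y] by simp
    also have "\<dots> < e" using k'(1) by (simp add: power_int_minus power_one_over field_simps)
    finally show "y \<in> ball x e" by simp
  qed
  then show ?thesis using that k'(2) e by blast
qed

subsection \<open>Calderon-Zygmund decomposition\<close>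

lemma dyadic_cube_subset_level:
  assumes "dyadic_cube (i :: int \<times> (int^'n)) \<subseteq> dyadic_cube i'"
  shows "fst i' \<le> fst i"
proof (rule ccontr)
  assume "\<not> fst i' \<le> fst i"
  then have "(2::real) powi (- fst i') < 2 powi (- fst i)"
    by (intro power_int_strict_increasing) auto
  then have "((2::real) powi (- fst i')) ^ CARD('n) < (2 powi (- fst i)) ^ CARD('n)"
    by (intro power_strict_mono) auto
  moreover have "emeasure lebesgue (dyadic_cube i) \<le> emeasure lebesgue (dyadic_cube i')"
    using assms by (intro emeasure_mono) auto
  ultimately show False
    unfolding emeasure_dyadic_cube by (subst (asm) ennreal_le_iff) auto
qed

definition maximal_dyadic ::
    "int \<times> (int^'n) \<Rightarrow> (int \<times> (int^'n) \<Rightarrow> bool) \<Rightarrow> (int \<times> (int^'n)) set" where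
  "maximal_dyadic i0 P = {i. dyadic_cube i \<subseteq> dyadic_cube i0 \<and> P i \<and>
     (\<forall>i'. dyadic_cube i' \<subseteq> dyadic_cube i0 \<and> P i' \<and> dyadic_cube i \<subseteq> dyadic_cube i' \<longrightarrow> i' = i)}"

text \<open>Subcubes of \<open>i0\<close> have level at least \<open>fst i0\<close>, so among the
  candidates containing the given cube one has least level. A candidate containing it has the same
  level and shares a point, hence is equal to it.\<close>

lemma maximal_dyadicE:
  assumes "P i" "dyadic_cube i \<subseteq> dyadic_cube i0"
  obtains i' where "i' \<in> maximal_dyadic i0 P" "dyadic_cube i \<subseteq> dyadic_cube i'"
proof -
  let ?R = "\<lambda>i'. P i' \<and> dyadic_cube i \<subseteq> dyadic_cube i' \<and> dyadic_cube i' \<subseteq> dyadic_cube i0"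
  obtain i' where i': "?R i'"
    and least: "\<And>i''. ?R i'' \<Longrightarrow> nat (fst i' - fst i0) \<le> nat (fst i'' - fst i0)"
    using ex_has_least_nat[of ?R i "\<lambda>i'. nat (fst i' - fst i0)"] assms by blast
  have "i'' = i'" if "dyadic_cube i'' \<subseteq> dyadic_cube i0" "P i''" "dyadic_cube i' \<subseteq> dyadic_cube i''" for i''
  proof -
    have "fst i'' \<le> fst i'" "fst i0 \<le> fst i''" "fst i0 \<le> fst i'"
      using that i' dyadic_cube_subset_level by blast+
    moreover have "nat (fst i' - fst i0) \<le> nat (fst i'' - fst i0)"
      using that i' by (intro least) auto
    ultimately have "fst i'' = fst i'" by linarith
    moreover obtain x where "x \<in> dyadic_cube i'" using dyadic_cube_nonempty by blast
    ultimately show ?thesis using that(3) by (metis mem_dyadic_cube_iff subsetD)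
  qed
  with i' have "i' \<in> maximal_dyadic i0 P" by (auto simp: maximal_dyadic_def)
  with i' that show ?thesis by blast
qed

lemma disjoint_maximal_dyadic: "disjoint_family_on dyadic_cube (maximal_dyadic i0 P)"
  unfolding disjoint_family_on_def
proof (intro ballI impI, rule ccontr)
  fix i i' assume *: "i \<in> maximal_dyadic i0 P" "i' \<in> maximal_dyadic i0 P" "i \<noteq> i'"
    "dyadic_cube i \<inter> dyadic_cube i' \<noteq> {}"
  then obtain x where "x \<in> dyadic_cube i" "x \<in> dyadic_cube i'" by blast
  then have "dyadic_cube i \<subseteq> dyadic_cube i' \<or> dyadic_cube i' \<subseteq> dyadic_cube i"
    using dyadic_cube_nested linear by metis
  then show False using *(1-3) unfolding maximal_dyadic_def by blast
qed

section \<open>Integration over countable families of disjoint cubes\<close>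

lemma nn_set_integral_UN_countable:
  assumes [measurable]: "h \<in> borel_measurable M" "\<And>i. i \<in> I \<Longrightarrow> X i \<in> sets M"
    and "countable I" "disjoint_family_on X I"
  shows "(\<integral>\<^sup>+x\<in>(\<Union>i\<in>I. X i). h x \<partial>M) = (\<integral>\<^sup>+i. (\<integral>\<^sup>+x\<in>X i. h x \<partial>M) \<partial>count_space I)"
proof -
  have "(\<integral>\<^sup>+x\<in>(\<Union>i\<in>I. X i). h x \<partial>M) = emeasure (density M h) (\<Union>i\<in>I. X i)"
    using assms by (intro emeasure_density[symmetric] sets.countable_UN') auto
  also have "\<dots> = (\<integral>\<^sup>+i. emeasure (density M h) (X i) \<partial>count_space I)"
    using assms by (intro emeasure_UN_countable) auto
  also have "\<dots> = (\<integral>\<^sup>+i. (\<integral>\<^sup>+x\<in>X i. h x \<partial>M) \<partial>count_space I)"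
    by (intro nn_integral_cong emeasure_density) auto
  finally show ?thesis .
qed

lemma countable_indices [simp]: "countable (A :: (int \<times> (int^'n)) set)"
  by simp

lemma emeasure_UN_dyadic:
  fixes I :: "(int \<times> (int^'n)) set"
  assumes "disjoint_family_on dyadic_cube I"
  shows "emeasure lebesgue (\<Union>i\<in>I. dyadic_cube i) = (\<integral>\<^sup>+i. emeasure lebesgue (dyadic_cube i) \<partial>count_space I)"
  using assms by (intro emeasure_UN_countable) auto

lemma sets_UN_dyadic [measurable, simp]:
  "(\<Union>i\<in>I. dyadic_cube (i :: int \<times> (int^'n))) \<in> sets lebesgue"
  by (intro sets.countable_UN') auto

text \<open>One-sided Lebesgue differentiation for an arbitrary measurable \<open>h\<close>, by a
  covering argument. If h > \<Lambda> + \<epsilon> on a set N that no cube of large mean meets, N is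
  covered by disjoint cubes inside an open set of measure at most |N| + e. Their means are at most
  \<Lambda>, so (\<Lambda> + \<epsilon>) |N| \<le> \<Lambda> (|N| + e), which forces |N| =
  0.\<close>

lemma dyadic_differentiation:
  fixes h :: "real^'n \<Rightarrow> ennreal" and \<Lambda> :: real
  assumes [measurable]: "h \<in> borel_measurable lebesgue" and "0 \<le> \<Lambda>"
  shows "AE x in lebesgue. x \<in> dyadic_cube i0 \<longrightarrow>
    (\<forall>i. x \<in> dyadic_cube i \<and> dyadic_cube i \<subseteq> dyadic_cube i0 \<longrightarrow>
         (\<integral>\<^sup>+y\<in>dyadic_cube i. h y \<partial>lebesgue) \<le> ennreal \<Lambda> * emeasure lebesgue (dyadic_cube i))
    \<longrightarrow> h x \<le> ennreal \<Lambda>"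
proof -
  define B where "B = {i. dyadic_cube i \<subseteq> dyadic_cube i0 \<and>
    ennreal \<Lambda> * emeasure lebesgue (dyadic_cube i) < (\<integral>\<^sup>+y\<in>dyadic_cube i. h y \<partial>lebesgue)}"
  define N where "N k = {x \<in> dyadic_cube i0. ennreal (\<Lambda> + 1 / Suc k) < h x} - (\<Union>i\<in>B. dyadic_cube i)" for k :: nat
  have [measurable]: "N k \<in> sets lebesgue" for k
    unfolding N_def by (intro sets.Diff sets_UN_dyadic) measurable
  have null: "N k \<in> null_sets lebesgue" for k
  proof -
    define \<epsilon> where "\<epsilon> = 1 / real (Suc k)"
    have \<epsilon>: "0 < \<epsilon>" by (simp add: \<epsilon>_def)
    have "emeasure lebesgue (N k) \<le> emeasure lebesgue (dyadic_cube i0)"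
      by (intro emeasure_mono) (auto simp: N_def)
    also have "\<dots> < \<infinity>" unfolding emeasure_dyadic_cube by simp
    finally have fin: "emeasure lebesgue (N k) < \<infinity>" .
    have bound: "ennreal (\<Lambda> + \<epsilon>) * emeasure lebesgue (N k) \<le> ennreal \<Lambda> * (emeasure lebesgue (N k) + ennreal e)"
      if e: "0 < e" for e
    proof -
      obtain U where U: "open U" "N k \<subseteq> U" "U - N k \<in> lmeasurable" "emeasure lebesgue (U - N k) < ennreal e"
        using sets_lebesgue_outer_open[of "N k" e] e by auto
      have [measurable]: "U \<in> sets lebesgue" using U(1) by (simp add: borel_open)
      \<comment> \<open>The maximal dyadic cubes inside \<open>U\<close> are disjoint and cover
        \<open>N k\<close>, since every point of the open set \<open>U\<close> has a small dyadic
        cube inside \<open>U\<close>.\<close>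
      define G where "G = maximal_dyadic i0 (\<lambda>i. dyadic_cube i \<subseteq> U)"
      have G: "dyadic_cube i \<subseteq> U" if "i \<in> G" for i using that by (auto simp: G_def maximal_dyadic_def)
      have disj: "disjoint_family_on dyadic_cube G" by (simp add: G_def disjoint_maximal_dyadic)
      have cover: "N k \<subseteq> (\<Union>i\<in>G. dyadic_cube i)"
      proof
        fix x assume x: "x \<in> N k"
        then have x0: "x \<in> U" "x \<in> dyadic_cube i0" using U by (auto simp: N_def)
        obtain j where j: "fst i0 \<le> j" "dyadic_cube (dyadic_index j x) \<subseteq> U"
          using dyadic_cube_in_open[OF U(1) x0(1)] by blast
        have "dyadic_cube (dyadic_index j x) \<subseteq> dyadic_cube i0"
          using dyadic_cube_nested[of x "dyadic_index j x" i0] x0 j by simp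
        then obtain i' where "i' \<in> G" "dyadic_cube (dyadic_index j x) \<subseteq> dyadic_cube i'"
          using maximal_dyadicE[of "\<lambda>i. dyadic_cube i \<subseteq> U" "dyadic_index j x" i0] j G_def by blast
        then show "x \<in> (\<Union>i\<in>G. dyadic_cube i)" using dyadic_index_mem by blast
      qed
      have "ennreal (\<Lambda> + \<epsilon>) * emeasure lebesgue (N k) = (\<integral>\<^sup>+x. ennreal (\<Lambda> + \<epsilon>) * indicator (N k) x \<partial>lebesgue)"
        by (simp add: nn_integral_cmult_indicator)
      also have "\<dots> \<le> (\<integral>\<^sup>+x\<in>(\<Union>i\<in>G. dyadic_cube i). h x * indicator (N k) x \<partial>lebesgue)"
        using cover by (intro nn_integral_mono) (auto simp: N_def \<epsilon>_def indicator_def less_imp_le)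
      also have "\<dots> = (\<integral>\<^sup>+i. (\<integral>\<^sup>+x\<in>dyadic_cube i. h x * indicator (N k) x \<partial>lebesgue) \<partial>count_space G)"
        using disj by (intro nn_set_integral_UN_countable) auto
      also have "\<dots> \<le> (\<integral>\<^sup>+i. ennreal \<Lambda> * emeasure lebesgue (dyadic_cube i) \<partial>count_space G)"
      proof (rule nn_integral_mono)
        fix i assume "i \<in> space (count_space G)"
        then have i: "i \<in> G" by simp
        show "(\<integral>\<^sup>+x\<in>dyadic_cube i. h x * indicator (N k) x \<partial>lebesgue) \<le> ennreal \<Lambda> * emeasure lebesgue (dyadic_cube i)"
        proof (cases "i \<in> B")
          \<comment> \<open>A cube of too large a mean is removed from \<open>N k\<close> by
            definition, so it contributes nothing.\<close>
          case True
          then have 0: "h x * indicator (N k) x * indicator (dyadic_cube i) x = 0" for x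
            by (auto simp: N_def indicator_def)
          show ?thesis unfolding 0 by simp
        next
          case False
          have "(\<integral>\<^sup>+x\<in>dyadic_cube i. h x * indicator (N k) x \<partial>lebesgue) \<le> (\<integral>\<^sup>+x\<in>dyadic_cube i. h x \<partial>lebesgue)"
            by (intro nn_integral_mono) (auto simp: indicator_def)
          also have "\<dots> \<le> ennreal \<Lambda> * emeasure lebesgue (dyadic_cube i)"
            using False i by (auto simp: B_def G_def maximal_dyadic_def not_less)
          finally show ?thesis .
        qed
      qed
      also have "\<dots> = ennreal \<Lambda> * emeasure lebesgue (\<Union>i\<in>G. dyadic_cube i)"
        by (simp add: nn_integral_cmult emeasure_UN_dyadic[OF disj])
      also have "\<dots> \<le> ennreal \<Lambda> * emeasure lebesgue U"
        using G by (intro mult_left_mono emeasure_mono) auto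
      also have "emeasure lebesgue U = emeasure lebesgue (N k) + emeasure lebesgue (U - N k)"
        using U by (subst plus_emeasure) (auto simp: Un_absorb1)
      also have "ennreal \<Lambda> * (emeasure lebesgue (N k) + emeasure lebesgue (U - N k)) \<le> ennreal \<Lambda> * (emeasure lebesgue (N k) + ennreal e)"
        using U by (intro mult_left_mono add_left_mono) auto
      finally show ?thesis .
    qed
    define v where "v = measure lebesgue (N k)"
    have v: "emeasure lebesgue (N k) = ennreal v" "0 \<le> v"
      using fin unfolding v_def by (auto intro: emeasure_eq_ennreal_measure)
    have "(\<Lambda> + \<epsilon>) * v \<le> \<Lambda> * (v + e)" if "0 < e" for e
    proof -
      have "ennreal ((\<Lambda> + \<epsilon>) * v) \<le> ennreal (\<Lambda> * (v + e))"
        using bound[OF that] v(2) \<open>0 \<le> \<Lambda>\<close> \<epsilon> that unfolding v(1)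
        by (simp add: ennreal_mult ennreal_plus)
      then show ?thesis
        using v(2) \<open>0 \<le> \<Lambda>\<close> that by (subst (asm) ennreal_le_iff) auto
    qed
    then have *: "\<epsilon> * v \<le> \<Lambda> * e" if "0 < e" for e
      using that by (fastforce simp: algebra_simps)
    have "\<epsilon> * v \<le> 0"
    proof (rule field_le_epsilon)
      fix e :: real assume e: "0 < e"
      \<comment> \<open>Dividing by \<Lambda> + 1 covers the case \<Lambda> = 0 as well.\<close>
      have "\<epsilon> * v \<le> \<Lambda> * (e / (\<Lambda> + 1))"
        using e \<open>0 \<le> \<Lambda>\<close> by (intro *) auto
      also have "\<dots> \<le> e" using e \<open>0 \<le> \<Lambda>\<close> by (simp add: field_simps)
      finally show "\<epsilon> * v \<le> 0 + e" by simp
    qed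
    then have "v = 0" using v(2) \<epsilon> by (simp add: mult_le_0_iff)
    with v show ?thesis by (auto simp: null_sets_def)
  qed
  have "(\<Union>k. N k) \<in> null_sets lebesgue"
    using null by (intro null_sets_UN) auto
  from AE_not_in[OF this] show ?thesis
  proof eventually_elim
    case (elim x)
    show ?case
    proof (intro impI, rule ccontr)
      assume x: "x \<in> dyadic_cube i0" "\<not> h x \<le> ennreal \<Lambda>"
        "\<forall>i. x \<in> dyadic_cube i \<and> dyadic_cube i \<subseteq> dyadic_cube i0 \<longrightarrow>
         (\<integral>\<^sup>+y\<in>dyadic_cube i. h y \<partial>lebesgue) \<le> ennreal \<Lambda> * emeasure lebesgue (dyadic_cube i)"
      then have "\<not> x \<in> (\<Union>i\<in>B. dyadic_cube i)" by (auto simp: B_def not_less)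
      moreover obtain y where y: "ennreal \<Lambda> < y" "y < h x"
        using x(2) dense[of "ennreal \<Lambda>" "h x"] by (auto simp: not_le)
      moreover obtain c where "y = ennreal c" using y(2) by (cases y) auto
      ultimately have c: "ennreal \<Lambda> < ennreal c" "ennreal c < h x" and
        nB: "x \<notin> (\<Union>i\<in>B. dyadic_cube i)" by blast+
      then have "\<Lambda> < c" using \<open>0 \<le> \<Lambda>\<close> by (simp add: ennreal_less_iff)
      then obtain k where "1 / real (Suc k) < c - \<Lambda>" 
        using nat_approx_posE[of "c - \<Lambda>"] by auto
      then have "ennreal (\<Lambda> + 1 / Suc k) \<le> ennreal c" by (intro ennreal_leI) simp
      then have "ennreal (\<Lambda> + 1 / Suc k) < h x" using c(2) by (rule le_less_trans)
      then show False using x(1) nB elim by (auto simp: N_def)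
    qed
  qed
qed

text \<open>The selected cubes are the maximal subcubes of mean above \<Lambda>. The parent of a
  selected cube is rejected and has 2^n times its volume, whence the upper bound. A point outside
  all selected cubes lies only in cubes of mean at most \<Lambda>, so differentiation applies
  there.\<close>

lemma calderon_zygmund:
  fixes h :: "real^'n \<Rightarrow> ennreal" and \<Lambda> :: real
  assumes [measurable]: "h \<in> borel_measurable lebesgue" and "0 \<le> \<Lambda>"
    and le: "(\<integral>\<^sup>+x\<in>dyadic_cube i0. h x \<partial>lebesgue) \<le> ennreal \<Lambda> * emeasure lebesgue (dyadic_cube i0)"
  obtains F where "disjoint_family_on dyadic_cube F"
    "\<And>i. i \<in> F \<Longrightarrow> dyadic_cube i \<subseteq> dyadic_cube i0"
    "\<And>i. i \<in> F \<Longrightarrow> ennreal \<Lambda> * emeasure lebesgue (dyadic_cube i) < (\<integral>\<^sup>+x\<in>dyadic_cube i. h x \<partial>lebesgue)"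
    "\<And>i. i \<in> F \<Longrightarrow> (\<integral>\<^sup>+x\<in>dyadic_cube i. h x \<partial>lebesgue)
        \<le> ennreal (2 ^ CARD('n) * \<Lambda>) * emeasure lebesgue (dyadic_cube i)"
    "AE x in lebesgue. x \<in> dyadic_cube i0 - (\<Union>i\<in>F. dyadic_cube i) \<longrightarrow> h x \<le> ennreal \<Lambda>"
proof -
  define P where "P i \<longleftrightarrow> ennreal \<Lambda> * emeasure lebesgue (dyadic_cube i) < (\<integral>\<^sup>+x\<in>dyadic_cube i. h x \<partial>lebesgue)" for i
  define F where "F = maximal_dyadic i0 P"
  have sub: "dyadic_cube i \<subseteq> dyadic_cube i0" and P: "P i" if "i \<in> F" for i
    using that by (auto simp: F_def maximal_dyadic_def)
  have upper: "(\<integral>\<^sup>+x\<in>dyadic_cube i. h x \<partial>lebesgue)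
        \<le> ennreal (2 ^ CARD('n) * \<Lambda>) * emeasure lebesgue (dyadic_cube i)" if i: "i \<in> F" for i
  proof -
    \<comment> \<open>The hypothesis on \<open>i0\<close> excludes the top cube from the selection,
      so the parent of a selected cube still lies in \<open>i0\<close>.\<close>
    have ne: "i \<noteq> i0" using P[OF i] le by (auto simp: P_def)
    obtain x where x: "x \<in> dyadic_cube i" using dyadic_cube_nonempty by blast
    then have x0: "x \<in> dyadic_cube i0" using sub[OF i] by blast
    have "fst i0 \<noteq> fst i" using ne x x0 by (metis mem_dyadic_cube_iff)
    then have lev: "fst i0 < fst i" using dyadic_cube_subset_level[OF sub[OF i]] by simp
    let ?a = "ancestor 1 i"
    have xa: "x \<in> dyadic_cube ?a" using x dyadic_cube_subset_ancestor by blast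
    have suba: "dyadic_cube ?a \<subseteq> dyadic_cube i0"
      using dyadic_cube_nested[OF xa x0] lev by simp
    have "\<not> P ?a"
    proof
      assume "P ?a"
      then have "?a = i" using i suba dyadic_cube_subset_ancestor[of i 1]
        unfolding F_def maximal_dyadic_def by blast
      then show False using fst_ancestor[of 1 i] by simp
    qed
    then have "(\<integral>\<^sup>+x\<in>dyadic_cube ?a. h x \<partial>lebesgue) \<le> ennreal \<Lambda> * emeasure lebesgue (dyadic_cube ?a)"
      by (simp add: P_def not_less)
    moreover have "(\<integral>\<^sup>+x\<in>dyadic_cube i. h x \<partial>lebesgue) \<le> (\<integral>\<^sup>+x\<in>dyadic_cube ?a. h x \<partial>lebesgue)"
      using dyadic_cube_subset_ancestor[of i 1]
      by (intro nn_integral_mono) (auto simp: indicator_def)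
    ultimately show ?thesis
      using \<open>0 \<le> \<Lambda>\<close> unfolding emeasure_dyadic_cube_ancestor
      by (simp add: ennreal_mult mult.assoc mult.left_commute)
  qed
  have "AE x in lebesgue. x \<in> dyadic_cube i0 - (\<Union>i\<in>F. dyadic_cube i) \<longrightarrow> h x \<le> ennreal \<Lambda>"
    using dyadic_differentiation[OF assms(1,2), of i0]
  proof eventually_elim
    case (elim x)
    show ?case
    proof
      assume x: "x \<in> dyadic_cube i0 - (\<Union>i\<in>F. dyadic_cube i)"
      have "\<not> P i" if i: "x \<in> dyadic_cube i" "dyadic_cube i \<subseteq> dyadic_cube i0" for i
      proof
        assume "P i"
        then obtain i' where "i' \<in> F" "dyadic_cube i \<subseteq> dyadic_cube i'"
          using maximal_dyadicE[of P i i0] i F_def by blast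
        with x i show False by blast
      qed
      then show "h x \<le> ennreal \<Lambda>" using elim x by (auto simp: P_def not_less)
    qed
  qed
  then show ?thesis
    using that[of F] sub P upper disjoint_maximal_dyadic[of i0 P] by (auto simp: F_def P_def)
qed

subsection \<open>Mean oscillation and the sharp maximal function\<close>

definition mean_osc :: "(real^'n \<Rightarrow> complex) \<Rightarrow> (real^'n) set \<Rightarrow> ennreal" where
  "mean_osc f Q = mean_abs (\<lambda>y. f y - average f Q) Q"

text \<open>Stated on closed cubes with arbitrary corner and side, the family over which the sharp
  maximal function is taken.\<close>

definition locally_integrable :: "(real^'n \<Rightarrow> complex) \<Rightarrow> bool" where
  "locally_integrable f \<longleftrightarrow> (\<forall>a l. set_integrable lebesgue (cube a l) f)"

lemma emeasure_dyadic_cube_pos: "0 < emeasure lebesgue (dyadic_cube (i :: int \<times> (int^'n)))"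
  unfolding emeasure_dyadic_cube by simp

lemma emeasure_dyadic_cube_finite: "emeasure lebesgue (dyadic_cube (i :: int \<times> (int^'n))) < \<infinity>"
  unfolding emeasure_dyadic_cube by simp

lemma emeasure_dyadic_cube': "emeasure lebesgue (dyadic_cube i) = ennreal (measure lebesgue (dyadic_cube i))"
  by (simp add: emeasure_dyadic_cube measure_dyadic_cube)

lemma measure_dyadic_cube_pos: "0 < measure lebesgue (dyadic_cube i)"
  by (simp add: measure_dyadic_cube)

lemma mean_abs_times:
  assumes "0 < emeasure lebesgue S" "emeasure lebesgue S < \<infinity>"
  shows "mean_abs f S * emeasure lebesgue S = (\<integral>\<^sup>+y\<in>S. ennreal (cmod (f y)) \<partial>lebesgue)"
  unfolding mean_abs_def using assms by (subst ennreal_divide_times) simp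

lemmas mean_abs_dyadic_times = mean_abs_times[OF emeasure_dyadic_cube_pos emeasure_dyadic_cube_finite]

lemma mean_abs_eq_null_diff:
  assumes "Q \<subseteq> Q'" "negligible (Q' - Q)" "Q \<in> sets lebesgue" "Q' \<in> sets lebesgue"
  shows "mean_abs f Q = mean_abs f Q'"
proof -
  have null: "Q' - Q \<in> null_sets lebesgue" using assms(2) by (simp add: negligible_iff_null_sets)
  have "emeasure lebesgue Q = emeasure lebesgue (Q' - (Q' - Q))"
    using assms(1) by (simp add: double_diff)
  also have "\<dots> = emeasure lebesgue Q'"
    using assms null by (intro emeasure_Diff_null_set) auto
  finally have "emeasure lebesgue Q = emeasure lebesgue Q'" .
  moreover have "(\<integral>\<^sup>+y\<in>Q. ennreal (cmod (f y)) \<partial>lebesgue) = (\<integral>\<^sup>+y\<in>Q'. ennreal (cmod (f y)) \<partial>lebesgue)"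
    using AE_not_in[OF null] by (intro nn_integral_cong_AE) (auto elim!: eventually_mono simp: indicator_def assms(1)[THEN subsetD])
  ultimately show ?thesis by (simp add: mean_abs_def)
qed

lemma average_eq_null_diff:
  assumes "Q \<subseteq> Q'" "negligible (Q' - Q)" and [measurable]: "Q \<in> sets lebesgue" "Q' \<in> sets lebesgue"
    "f \<in> borel_measurable lebesgue"
  shows "average f Q = average f Q'"
proof -
  have null: "Q' - Q \<in> null_sets lebesgue" using assms(2) by (simp add: negligible_iff_null_sets)
  have "emeasure lebesgue Q = emeasure lebesgue (Q' - (Q' - Q))"
    using assms(1) by (simp add: double_diff)
  also have "\<dots> = emeasure lebesgue Q'"
    using assms null by (intro emeasure_Diff_null_set) auto
  finally have "measure lebesgue Q = measure lebesgue Q'" by (simp add: measure_def)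
  moreover have "set_lebesgue_integral lebesgue Q f = set_lebesgue_integral lebesgue Q' f"
    unfolding set_lebesgue_integral_def
    using AE_not_in[OF null] by (intro integral_cong_AE) (auto elim!: eventually_mono simp: indicator_def assms(1)[THEN subsetD])
  ultimately show ?thesis by (simp add: average_def)
qed

lemma mean_osc_le_sharp_maximal:
  assumes "f \<in> borel_measurable lebesgue" "x \<in> dyadic_cube (i :: int \<times> (int^'n))"
  shows "mean_osc f (dyadic_cube i) \<le> sharp_maximal f x"
proof (rule dyadic_cube_eq_cube[of i])
  fix a assume a: "dyadic_cube i \<subseteq> cube a (2 powi (- fst i))" "negligible (cube a (2 powi (- fst i)) - dyadic_cube i)"
  have "mean_osc f (dyadic_cube i) = mean_osc f (cube a (2 powi (- fst i)))"
    using a assms average_eq_null_diff[of "dyadic_cube i" "cube a (2 powi (- fst i))" f]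
    unfolding mean_osc_def by (subst mean_abs_eq_null_diff[OF a]) auto
  also have "\<dots> \<le> sharp_maximal f x"
    unfolding sharp_maximal_def mean_osc_def
    using a(1) assms(2) by (intro SUP_upper) (auto simp: cubes_at_def intro!: exI[of _ a] exI[of _ "2 powi (- fst i)"])
  finally show ?thesis .
qed

text \<open>Triangle inequality for the integral of f - c, multiplied through by the measure of
  \<open>Q\<close> so that no extended division occurs.\<close>

lemma average_diff_le:
  assumes "set_integrable lebesgue Q f" "Q \<in> sets lebesgue"
    "0 < emeasure lebesgue Q" "emeasure lebesgue Q < \<infinity>"
  shows "ennreal (cmod (average f Q - c)) * emeasure lebesgue Q \<le> (\<integral>\<^sup>+x\<in>Q. ennreal (cmod (f x - c)) \<partial>lebesgue)"
proof -
  have m: "emeasure lebesgue Q = ennreal (measure lebesgue Q)"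
    using assms by (intro emeasure_eq_ennreal_measure) auto
  have m0: "0 < measure lebesgue Q" using assms m by (metis ennreal_0 less_irrefl not_gr_zero measure_nonneg order_less_le)
  have c: "set_integrable lebesgue Q (\<lambda>_. c)"
    using assms unfolding set_integrable_def by (intro integrable_scaleR_left) (auto simp: integrable_real_indicator)
  have int: "set_integrable lebesgue Q (\<lambda>x. f x - c)"
    by (intro set_integral_diff assms c)
  have "set_lebesgue_integral lebesgue Q (\<lambda>x. f x - c) = set_lebesgue_integral lebesgue Q f - measure lebesgue Q *\<^sub>R c"
    using assms c by (subst set_integral_diff) (auto simp: set_integral_const less_top)
  then have "measure lebesgue Q *\<^sub>R (average f Q - c) = set_lebesgue_integral lebesgue Q (\<lambda>x. f x - c)"
    using m0 by (simp add: average_def scaleR_diff_right)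
  then have "ennreal (cmod (average f Q - c)) * emeasure lebesgue Q
      = ennreal (cmod (set_lebesgue_integral lebesgue Q (\<lambda>x. f x - c)))"
    using m0 by (metis m ennreal_mult mult.commute norm_ge_zero norm_scaleR abs_of_pos measure_nonneg)
  also have "\<dots> \<le> (\<integral>\<^sup>+x. norm (indicator Q x *\<^sub>R (f x - c)) \<partial>lebesgue)"
    unfolding set_lebesgue_integral_def using int unfolding set_integrable_def by (rule integral_norm_bound_ennreal)
  also have "\<dots> = (\<integral>\<^sup>+x\<in>Q. ennreal (cmod (f x - c)) \<partial>lebesgue)"
    by (intro nn_integral_cong) (auto simp: indicator_def)
  finally show ?thesis .
qed

lemma locally_integrable_dyadic:
  assumes "locally_integrable f"
  shows "set_integrable lebesgue (dyadic_cube i) f"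
  using assms set_integrable_subset[OF _ sets_dyadic_cube] unfolding locally_integrable_def
  by (metis dyadic_cube_eq_cube)

text \<open>The child lies in the parent and has 2^-n of its volume, so passing to the mean over the
  parent costs 2^n.\<close>

lemma average_ancestor_diff_le:
  fixes i :: "int \<times> (int^'n)"
  assumes "locally_integrable f"
  shows "ennreal (cmod (average f (dyadic_cube i) - average f (dyadic_cube (ancestor 1 i))))
    \<le> ennreal (2 ^ CARD('n)) * mean_osc f (dyadic_cube (ancestor 1 i))"
proof -
  let ?Q = "dyadic_cube i" and ?Q' = "dyadic_cube (ancestor 1 i)"
  have "emeasure lebesgue ?Q * ennreal (cmod (average f ?Q - average f ?Q'))
    \<le> (\<integral>\<^sup>+x\<in>?Q. ennreal (cmod (f x - average f ?Q')) \<partial>lebesgue)"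
    by (subst mult.commute, intro average_diff_le locally_integrable_dyadic assms sets_dyadic_cube
        emeasure_dyadic_cube_pos emeasure_dyadic_cube_finite)
  also have "\<dots> \<le> (\<integral>\<^sup>+x\<in>?Q'. ennreal (cmod (f x - average f ?Q')) \<partial>lebesgue)"
    using dyadic_cube_subset_ancestor[of i 1] by (intro nn_integral_mono) (auto simp: indicator_def)
  also have "\<dots> = emeasure lebesgue ?Q * (ennreal (2 ^ CARD('n)) * mean_osc f ?Q')"
    unfolding mean_osc_def mean_abs_dyadic_times[symmetric] emeasure_dyadic_cube_ancestor by (simp add: ac_simps)
  finally show ?thesis
    using emeasure_dyadic_cube_pos[of i] emeasure_dyadic_cube_finite[of i]
    by (subst (asm) ennreal_mult_le_mult_iff) auto
qed

text \<open>Lower semicontinuity yields measurability of a supremum over uncountably many cubes. The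
  cubes are closed, so the point may lie on the boundary of a good one; slightly larger concentric
  cubes still have large oscillation and contain a neighbourhood of the point.\<close>

lemma sharp_maximal_open:
  fixes f :: "real^'n \<Rightarrow> complex"
  assumes loc: "locally_integrable f"
  shows "open {x. s < sharp_maximal f x}"
proof (subst open_subopen, clarify)
  fix x assume "s < sharp_maximal f x"
  then obtain a l where al: "0 < l" "x \<in> cube a l" "s < mean_osc f (cube a l)"
    unfolding sharp_maximal_def mean_osc_def less_SUP_iff by (auto simp: cubes_at_def)
  define \<delta> where "\<delta> k = 1 / real (Suc k)" for k
  have \<delta>: "0 < \<delta> k" for k by (simp add: \<delta>_def)
  define L where "L k = l + 2 * \<delta> k" for k
  define C where "C k = cube (\<chi> i. a $ i - \<delta> k) (L k)" for k
  let ?C = "cube a l"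
  have memC: "y \<in> C k \<longleftrightarrow> (\<forall>i. a $ i - \<delta> k \<le> y $ i \<and> y $ i \<le> a $ i + l + \<delta> k)" for y k
    by (simp add: C_def cube_def mem_box_cart L_def algebra_simps)
  have mem: "y \<in> ?C \<longleftrightarrow> (\<forall>i. a $ i \<le> y $ i \<and> y $ i \<le> a $ i + l)" for y
    by (simp add: cube_def mem_box_cart)
  have sub: "?C \<subseteq> C k" for k 
    using \<delta>[of k] unfolding subset_iff memC mem by (smt (verit))
  have [measurable, simp]: "C k \<in> sets lebesgue" for k by (simp add: C_def)
  have dec: "decseq C"
  proof (rule antimonoI)
    fix m n :: nat assume "m \<le> n"
    then have "\<delta> n \<le> \<delta> m" by (simp add: \<delta>_def field_simps)
    then show "C n \<subseteq> C m" unfolding subset_iff memC by (smt (verit))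
  qed
  have "\<delta> \<longlonglongrightarrow> 0" unfolding \<delta>_def by (rule LIMSEQ_Suc[OF lim_1_over_n])
  have INT: "(\<Inter>k. C k) = ?C"
  proof
    show "(\<Inter>k. C k) \<subseteq> ?C"
    proof
      fix y assume y: "y \<in> (\<Inter>k. C k)"
      have "a $ i \<le> y $ i" for i
      proof (rule LIMSEQ_le_const2)
        show "(\<lambda>k. a $ i - \<delta> k) \<longlonglongrightarrow> a $ i" using tendsto_diff[OF tendsto_const \<open>\<delta> \<longlonglongrightarrow> 0\<close>, of "a $ i"] by simp
        show "\<exists>N. \<forall>n\<ge>N. a $ i - \<delta> n \<le> y $ i" using y memC by auto
      qed
      moreover have "y $ i \<le> a $ i + l" for i
      proof (rule LIMSEQ_le_const)
        show "(\<lambda>k. a $ i + l + \<delta> k) \<longlonglongrightarrow> a $ i + l" using tendsto_add[OF tendsto_const \<open>\<delta> \<longlonglongrightarrow> 0\<close>, of "a $ i + l"] by simp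
        show "\<exists>N. \<forall>n\<ge>N. y $ i \<le> a $ i + l + \<delta> n" using y memC by auto
      qed
      ultimately show "y \<in> ?C" by (simp add: mem)
    qed
  qed (use sub in auto)
  have int: "set_integrable lebesgue (C k) f" for k
    using loc unfolding locally_integrable_def C_def by blast
  have intC: "set_integrable lebesgue ?C f"
    using loc unfolding locally_integrable_def by blast
  have "(\<lambda>k. set_lebesgue_integral lebesgue (C k) f) \<longlonglongrightarrow> set_lebesgue_integral lebesgue ?C f"
    using set_integral_cont_down[OF _ dec int[of 0]] by (simp add: INT)
  moreover have limD: "(\<lambda>k. L k ^ CARD('n)) \<longlonglongrightarrow> l ^ CARD('n)"
    using tendsto_power[OF tendsto_add[OF tendsto_const tendsto_mult[OF tendsto_const \<open>\<delta> \<longlonglongrightarrow> 0\<close>, of 2], of l], of "CARD('n)"]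
    by (simp add: L_def)
  moreover have meas: "measure lebesgue (C k) = L k ^ CARD('n)" "emeasure lebesgue (C k) = ennreal (L k ^ CARD('n))" for k
    using al(1) \<delta>[of k] unfolding C_def by (intro measure_cube emeasure_cube; simp add: L_def)+
  ultimately have "(\<lambda>k. average f (C k)) \<longlonglongrightarrow> average f ?C"
    using al(1) unfolding average_def measure_cube[OF less_imp_le[OF al(1)]] meas by (intro tendsto_scaleR tendsto_inverse) auto
  then have "(\<lambda>k. cmod (average f ?C - average f (C k))) \<longlonglongrightarrow> cmod (average f ?C - average f ?C)"
    by (intro tendsto_intros)
  then have limA: "(\<lambda>k. cmod (average f ?C - average f (C k))) \<longlonglongrightarrow> 0" by simp
  \<comment> \<open>Using the average over the larger cube costs the difference of the two averages,
    which tends to 0 as the cubes shrink.\<close>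
  have key: "mean_osc f ?C * ennreal (l ^ CARD('n))
      \<le> mean_osc f (C k) * ennreal (L k ^ CARD('n)) + ennreal (cmod (average f ?C - average f (C k))) * ennreal (l ^ CARD('n))" for k
  proof -
    have [measurable]: "(\<lambda>x. indicator ?C x *\<^sub>R f x) \<in> borel_measurable lebesgue"
        "(\<lambda>x. indicator (C k) x *\<^sub>R f x) \<in> borel_measurable lebesgue"
      using int[of k] intC by (auto simp: set_integrable_def)
    \<comment> \<open>Local integrability gives measurability of \<open>f\<close> on cubes, hence
      the passage through the truncated function.\<close>
    have mm: "(\<lambda>x. ennreal (cmod (f x - c)) * indicator ?C x) \<in> borel_measurable lebesgue" for c
    proof -
      have "(\<lambda>x. ennreal (cmod (f x - c)) * indicator ?C x) = (\<lambda>x. ennreal (cmod (indicator ?C x *\<^sub>R f x - c)) * indicator ?C x)"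
        by (auto simp: indicator_def)
      also have "\<dots> \<in> borel_measurable lebesgue" by measurable
      finally show ?thesis .
    qed
    have "mean_osc f ?C * ennreal (l ^ CARD('n)) = (\<integral>\<^sup>+y\<in>?C. ennreal (cmod (f y - average f ?C)) \<partial>lebesgue)"
      using al(1) mean_abs_times[of ?C "\<lambda>y. f y - average f ?C"] by (simp add: mean_osc_def emeasure_cube)
    also have "\<dots> \<le> (\<integral>\<^sup>+y. ennreal (cmod (f y - average f (C k))) * indicator ?C y
          + ennreal (cmod (average f ?C - average f (C k))) * indicator ?C y \<partial>lebesgue)"
      using norm_triangle_ineq4[of "f _ - average f (C k)" "average f ?C - average f (C k)"]
      by (intro nn_integral_mono) (auto simp: indicator_def simp flip: ennreal_plus intro!: ennreal_leI)
    also have "\<dots> = (\<integral>\<^sup>+y\<in>?C. ennreal (cmod (f y - average f (C k))) \<partial>lebesgue)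
        + ennreal (cmod (average f ?C - average f (C k))) * emeasure lebesgue ?C"
      using mm by (subst nn_integral_add) (auto simp: nn_integral_cmult_indicator)
    also have "(\<integral>\<^sup>+y\<in>?C. ennreal (cmod (f y - average f (C k))) \<partial>lebesgue) \<le> (\<integral>\<^sup>+y\<in>C k. ennreal (cmod (f y - average f (C k))) \<partial>lebesgue)"
      using sub[of k] by (intro nn_integral_mono) (auto simp: indicator_def)
    also have "\<dots> = mean_osc f (C k) * ennreal (L k ^ CARD('n))"
      using al(1) \<delta>[of k] mean_abs_times[of "C k" "\<lambda>y. f y - average f (C k)"] by (simp add: mean_osc_def meas L_def)
    finally show ?thesis using al(1) by (simp add: emeasure_cube)
  qed
  have "\<exists>k. s < mean_osc f (C k)"
  proof (rule ccontr)
    assume "\<not> ?thesis"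
    then have le: "mean_osc f (C k) \<le> s" for k by (simp add: not_less)
    obtain \<sigma> where \<sigma>: "s = ennreal \<sigma>" "0 \<le> \<sigma>" using al(3) by (cases s) auto
    have "mean_osc f ?C * ennreal (l ^ CARD('n)) \<le> ennreal (\<sigma> * l ^ CARD('n) + 0 * l ^ CARD('n))"
    proof (rule LIMSEQ_le_const)
      show "(\<lambda>k. ennreal (\<sigma> * L k ^ CARD('n) + cmod (average f ?C - average f (C k)) * l ^ CARD('n)))
          \<longlonglongrightarrow> ennreal (\<sigma> * l ^ CARD('n) + 0 * l ^ CARD('n))"
        by (intro tendsto_ennrealI tendsto_add tendsto_mult limA limD tendsto_const)
      have "mean_osc f ?C * ennreal (l ^ CARD('n)) \<le> ennreal (\<sigma> * L k ^ CARD('n) + cmod (average f ?C - average f (C k)) * l ^ CARD('n))" for k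
      proof -
        have "0 \<le> L k" using al(1) \<delta>[of k] by (simp add: L_def)
        have "mean_osc f ?C * ennreal (l ^ CARD('n))
           \<le> s * ennreal (L k ^ CARD('n)) + ennreal (cmod (average f ?C - average f (C k))) * ennreal (l ^ CARD('n))"
          by (rule order_trans[OF key[of k]]) (intro add_right_mono mult_right_mono le zero_le)
        then show ?thesis using al(1) \<sigma> \<open>0 \<le> L k\<close> by (simp add: ennreal_mult ennreal_plus)
      qed
      then show "\<exists>N. \<forall>k\<ge>N. mean_osc f ?C * ennreal (l ^ CARD('n)) \<le> ennreal (\<sigma> * L k ^ CARD('n) + cmod (average f ?C - average f (C k)) * l ^ CARD('n))"
        by blast
    qed
    then have "ennreal (l ^ CARD('n)) * mean_osc f ?C \<le> ennreal (l ^ CARD('n)) * s"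
      using \<sigma> al(1) by (simp add: ennreal_mult mult.commute)
    then have "mean_osc f ?C \<le> s"
      using al(1) by (subst (asm) ennreal_mult_le_mult_iff) auto
    with al(3) show False by simp
  qed
  then obtain k where k: "s < mean_osc f (C k)" by blast
  define U where "U = box (\<chi> i. a $ i - \<delta> k) (\<chi> i. a $ i + l + \<delta> k)"
  have "x \<in> U" using al(2) \<delta>[of k] unfolding U_def mem_box_cart mem vec_lambda_beta by (smt (verit))
  moreover have "U \<subseteq> {x. s < sharp_maximal f x}"
  proof clarify
    fix y assume "y \<in> U"
    then have "y \<in> C k" by (auto simp: U_def mem_box_cart memC less_imp_le)
    then have "mean_osc f (C k) \<le> sharp_maximal f y"
      unfolding sharp_maximal_def mean_osc_def using al(1) \<delta>[of k]
      by (intro SUP_upper) (auto simp: cubes_at_def C_def L_def intro!: exI[of _ "\<chi> i. a $ i - \<delta> k"] exI[of _ "l + 2 * \<delta> k"])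
    with k show "s < sharp_maximal f y" by simp
  qed
  ultimately show "\<exists>T. open T \<and> x \<in> T \<and> T \<subseteq> {x. s < sharp_maximal f x}"
    unfolding U_def using open_box by blast
qed

lemma sharp_maximal_measurable:
  fixes f :: "real^'n \<Rightarrow> complex"
  assumes "locally_integrable f"
  shows "sharp_maximal f \<in> borel_measurable lebesgue"
  using sharp_maximal_open[OF assms] by (intro borel_measurableI_greater) (auto simp: borel_open)

subsection \<open>The dyadic maximal function\<close>

lemma mean_abs_le_dyadic_maximal:
  "x \<in> dyadic_cube i \<Longrightarrow> mean_abs g (dyadic_cube i) \<le> dyadic_maximal g x"
  unfolding dyadic_maximal_def by (intro SUP_upper) (auto simp: dyadic_cubes_def)

lemma dyadic_maximal_measurable: "dyadic_maximal (g :: real^'n \<Rightarrow> complex) \<in> borel_measurable lebesgue"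
proof -
  have "dyadic_maximal g x = (SUP i. mean_abs g (dyadic_cube i) * indicator (dyadic_cube i) x)" for x
  proof (rule antisym)
    show "dyadic_maximal g x \<le> (SUP i. mean_abs g (dyadic_cube i) * indicator (dyadic_cube i) x)"
      unfolding dyadic_maximal_def
    proof (rule SUP_least)
      fix Q assume "Q \<in> {Q \<in> dyadic_cubes. x \<in> Q}"
      then obtain i where "Q = dyadic_cube i" "x \<in> dyadic_cube i" by (auto simp: dyadic_cubes_def)
      then show "mean_abs g Q \<le> (SUP i. mean_abs g (dyadic_cube i) * indicator (dyadic_cube i) x)"
        by (intro SUP_upper2[of i]) auto
    qed
    show "(SUP i. mean_abs g (dyadic_cube i) * indicator (dyadic_cube i) x) \<le> dyadic_maximal g x"
      by (intro SUP_least) (auto simp: indicator_def mean_abs_le_dyadic_maximal)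
  qed
  then have "dyadic_maximal g = (\<lambda>x. SUP i. mean_abs g (dyadic_cube i) * indicator (dyadic_cube i) x)"
    by blast
  also have "\<dots> \<in> borel_measurable lebesgue"
    by (intro borel_measurable_SUP) auto
  finally show ?thesis .
qed

text \<open>A cube of side l containing x lies in the ball around x of radius n l, and this ball in
  a cube of side 2 n l. The ratio of volumes is (2n)^n.\<close>

lemma dyadic_maximal_le_maximal:
  fixes g :: "real^'n \<Rightarrow> complex"
  shows "dyadic_maximal g x \<le> ennreal ((2 * real CARD('n)) ^ CARD('n)) * maximal g x"
  unfolding dyadic_maximal_def
proof (rule SUP_least)
  fix Q assume "Q \<in> {Q \<in> dyadic_cubes. x \<in> Q}"
  then obtain i where i: "Q = dyadic_cube i" "x \<in> dyadic_cube i" by (auto simp: dyadic_cubes_def)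
  define \<rho> where "\<rho> = real CARD('n) * 2 powi (- fst i)"
  have \<rho>: "0 < \<rho>" by (simp add: \<rho>_def)
  let ?B = "ball x \<rho>"
  have sub: "Q \<subseteq> ?B" using dist_dyadic_cube[OF i(2)] by (auto simp: i \<rho>_def)
  have "?B \<subseteq> cube (\<chi> l. x $ l - \<rho>) (2 * \<rho>)"
  proof
    fix y assume "y \<in> ?B"
    then have "\<bar>(x - y) $ l\<bar> < \<rho>" for l
      using component_le_norm_cart[of "x - y" l] by (simp add: dist_norm)
    then have "x $ l - \<rho> \<le> y $ l \<and> y $ l \<le> x $ l + \<rho>" for l
      by (simp add: abs_less_iff) (metis add.commute less_eq_real_def less_diff_eq diff_less_eq)
    then show "y \<in> cube (\<chi> l. x $ l - \<rho>) (2 * \<rho>)"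
      by (simp add: cube_def mem_box_cart algebra_simps)
  qed
  then have "emeasure lebesgue ?B \<le> emeasure lebesgue (cube (\<chi> l. x $ l - \<rho>) (2 * \<rho>))"
    by (intro emeasure_mono) auto
  also have "\<dots> = ennreal ((2 * real CARD('n)) ^ CARD('n)) * emeasure lebesgue Q"
    using \<rho> by (simp add: emeasure_cube emeasure_dyadic_cube i \<rho>_def power_mult_distrib mult.assoc flip: ennreal_mult)
  finally have B: "emeasure lebesgue ?B \<le> ennreal ((2 * real CARD('n)) ^ CARD('n)) * emeasure lebesgue Q" .
  have Bpos: "0 < emeasure lebesgue ?B"
    using emeasure_dyadic_cube_pos[of i] emeasure_mono[OF sub, of lebesgue] by (auto simp: i intro: less_le_trans)
  have Bfin: "emeasure lebesgue ?B < \<infinity>" 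
    using lmeasurable_ball[of x \<rho>] by (auto simp: fmeasurable_def)
  have "mean_abs g Q * emeasure lebesgue Q \<le> mean_abs g ?B * emeasure lebesgue ?B"
    unfolding i(1) mean_abs_dyadic_times mean_abs_times[OF Bpos Bfin]
    using sub by (intro nn_integral_mono) (auto simp: indicator_def i)
  also have "\<dots> \<le> maximal g x * (ennreal ((2 * real CARD('n)) ^ CARD('n)) * emeasure lebesgue Q)"
    using \<rho> B unfolding maximal_def by (intro mult_mono SUP_upper) (auto simp: balls_at_def)
  finally have "emeasure lebesgue Q * mean_abs g Q \<le> emeasure lebesgue Q * (ennreal ((2 * real CARD('n)) ^ CARD('n)) * maximal g x)"
    by (simp add: ac_simps)
  then show "mean_abs g Q \<le> ennreal ((2 * real CARD('n)) ^ CARD('n)) * maximal g x"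
    using emeasure_dyadic_cube_pos[of i] emeasure_dyadic_cube_finite[of i]
    by (subst (asm) ennreal_mult_le_mult_iff) (auto simp: i)
qed

text \<open>Dyadic cubes do not cross coordinate hyperplanes, so an increasing chain of them
  exhausts at most one orthant. There is one chain for each sign pattern \<open>e\<close>, made of
  cubes with a corner at the origin.\<close>

definition orthant_index :: "('n \<Rightarrow> bool) \<Rightarrow> nat \<Rightarrow> int \<times> (int^'n)" where
  "orthant_index e N = (- int N, \<chi> l. if e l then 0 else - 1)"

lemma ancestor_orthant_index: "ancestor 1 (orthant_index e N) = orthant_index e (Suc N)"
  by (auto simp: ancestor_def orthant_index_def vec_eq_iff)

lemma mem_orthant_cube:
  fixes x :: "real^'n"
  assumes "norm x < 2 ^ N"
  shows "x \<in> dyadic_cube (orthant_index (\<lambda>l. 0 \<le> x $ l) N)"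
proof -
  have "\<bar>x $ l\<bar> < 2 ^ N" for l
    using assms component_le_norm_cart[of x l] by simp
  then show ?thesis
    by (auto simp: orthant_index_def dyadic_cube_def abs_less_iff intro: less_imp_le)
      (smt (verit))+
qed

subsection \<open>Domination of the pairing\<close>

text \<open>Both means are bounded by the maximal functions at every point of the cube, and the
  complement of \<open>S\<close> carries at least half of its measure. Charging only this complement
  keeps \<open>S\<close> free for later charges.\<close>

lemma mean_osc_half_mass:
  fixes f g :: "real^'n \<Rightarrow> complex"
  assumes [measurable]: "f \<in> borel_measurable lebesgue" "S \<in> sets lebesgue"
    and S: "S \<subseteq> dyadic_cube i" "2 * emeasure lebesgue S \<le> emeasure lebesgue (dyadic_cube i)"
  shows "mean_osc f (dyadic_cube i) * (\<integral>\<^sup>+x\<in>dyadic_cube i. ennreal (cmod (g x)) \<partial>lebesgue)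
    \<le> 2 * (\<integral>\<^sup>+x\<in>dyadic_cube i - S. sharp_maximal f x * dyadic_maximal g x \<partial>lebesgue)"
proof -
  let ?Q = "dyadic_cube i"
  let ?c = "mean_osc f ?Q * mean_abs g ?Q"
  have Q: "emeasure lebesgue ?Q = emeasure lebesgue S + emeasure lebesgue (?Q - S)"
    using S(1) by (subst plus_emeasure) (auto simp: Un_absorb1)
  have "emeasure lebesgue S < top"
    using S emeasure_dyadic_cube_finite[of i] emeasure_mono[OF S(1), of lebesgue] by (auto intro: le_less_trans)
  moreover have "emeasure lebesgue S + emeasure lebesgue S \<le> emeasure lebesgue S + emeasure lebesgue (?Q - S)"
    using S(2) Q by (simp add: mult_2)
  ultimately have "emeasure lebesgue S \<le> emeasure lebesgue (?Q - S)"
    by (auto simp: ennreal_add_left_cancel_le)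
  then have "emeasure lebesgue ?Q \<le> 2 * emeasure lebesgue (?Q - S)"
    unfolding Q mult_2 by (rule add_right_mono)
  then have "?c * emeasure lebesgue ?Q \<le> ?c * (2 * emeasure lebesgue (?Q - S))"
    by (rule mult_left_mono) simp
  also have "\<dots> = 2 * (\<integral>\<^sup>+x. ?c * indicator (?Q - S) x \<partial>lebesgue)"
    by (subst nn_integral_cmult_indicator) (auto simp: ac_simps)
  also have "\<dots> \<le> 2 * (\<integral>\<^sup>+x\<in>?Q - S. sharp_maximal f x * dyadic_maximal g x \<partial>lebesgue)"
    by (intro mult_left_mono nn_integral_mono)
      (auto simp: indicator_def intro!: mult_mono mean_osc_le_sharp_maximal mean_abs_le_dyadic_maximal)
  finally show ?thesis
    by (simp add: mean_abs_dyadic_times mult.assoc)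
qed

lemma nn_set_integral_disjoint_Un:
  assumes [measurable]: "h \<in> borel_measurable M" "A \<in> sets M" "B \<in> sets M" and "A \<inter> B = {}"
  shows "(\<integral>\<^sup>+x\<in>A \<union> B. h x \<partial>M) = (\<integral>\<^sup>+x\<in>A. h x \<partial>M) + (\<integral>\<^sup>+x\<in>B. h x \<partial>M)"
  using assms(4) by (subst nn_integral_add[symmetric]) (auto intro!: nn_integral_cong simp: indicator_def)

lemma nn_set_integral_subset:
  "A \<subseteq> B \<Longrightarrow> (\<integral>\<^sup>+x\<in>A. h x \<partial>M) \<le> (\<integral>\<^sup>+x\<in>B. h x \<partial>M)"
  by (intro nn_integral_mono) (auto simp: indicator_def)

context
  fixes f g :: "real^'n \<Rightarrow> complex"
  assumes f [measurable]: "f \<in> borel_measurable lebesgue" and loc: "locally_integrable f"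
    and g [measurable]: "g \<in> borel_measurable lebesgue"
begin

private definition W where "W x = sharp_maximal f x * dyadic_maximal g x"

private lemma W_measurable [measurable]: "W \<in> borel_measurable lebesgue"
  unfolding W_def using sharp_maximal_measurable[OF loc] dyadic_maximal_measurable by measurable

text \<open>After \<open>m\<close> rounds of the decomposition the remainder lives on \<open>\<Omega>\<close>. Leaving \<open>\<Omega>\<close> out of the integral
  avoids estimating the averages over the cubes of the last generation against \<open>g\<close>.\<close>
private lemma pairing_off_small_set:
  "\<exists>\<Omega>. \<Omega> \<in> sets lebesgue \<and> \<Omega> \<subseteq> dyadic_cube i \<and>
     emeasure lebesgue \<Omega> \<le> ennreal ((1/2) ^ m) * emeasure lebesgue (dyadic_cube i) \<and>
     (\<integral>\<^sup>+x\<in>dyadic_cube i - \<Omega>. ennreal (cmod (f x - average f (dyadic_cube i)) * cmod (g x)) \<partial>lebesgue)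
        \<le> ennreal (2 ^ (CARD('n) + 2)) * (\<integral>\<^sup>+x\<in>dyadic_cube i. W x \<partial>lebesgue)"
proof (induction m arbitrary: i)
  case 0
  \<comment> \<open>The whole cube is left out, so the integral is over the empty set.\<close>
  show ?case by (intro exI[of _ "dyadic_cube i"]) auto
next
  case (Suc m)
  let ?d = "CARD('n)"
  let ?Q = "dyadic_cube i"
  define c where "c = average f ?Q"
  define h where "h x = ennreal (cmod (f x - c))" for x
  have [measurable]: "h \<in> borel_measurable lebesgue" unfolding h_def by measurable
  have hQ: "(\<integral>\<^sup>+x\<in>?Q. h x \<partial>lebesgue) = mean_osc f ?Q * emeasure lebesgue ?Q"
    by (simp add: mean_osc_def mean_abs_dyadic_times h_def c_def)
  have "(\<integral>\<^sup>+x\<in>?Q. h x \<partial>lebesgue) < \<infinity>"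
  proof -
    have "set_integrable lebesgue ?Q (\<lambda>x. f x - c)"
      unfolding set_integrable_def using locally_integrable_dyadic[OF loc, of i] emeasure_dyadic_cube_finite[of i]
      by (subst scaleR_diff_right, intro Bochner_Integration.integrable_diff integrable_scaleR_left)
        (auto simp: set_integrable_def integrable_real_indicator)
    then have "(\<integral>\<^sup>+x. norm (indicator ?Q x *\<^sub>R (f x - c)) \<partial>lebesgue) < \<infinity>"
      by (simp add: set_integrable_def integrable_iff_bounded)
    then show ?thesis
      by (simp add: h_def ennreal_mult' mult.commute[of "ennreal (cmod _)"] flip: ennreal_indicator)
  qed
  \<comment> \<open>Local integrability makes the oscillation a real number, which can then serve as
    a stopping height.\<close>
  then have "mean_osc f ?Q \<noteq> \<infinity>"
    using emeasure_dyadic_cube_pos[of i] unfolding hQ by (auto simp: ennreal_top_mult split: if_splits)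
  then obtain \<omega> where \<omega>: "mean_osc f ?Q = ennreal \<omega>" "0 \<le> \<omega>" by (cases "mean_osc f ?Q") auto
  show ?case
  proof (cases "\<omega> = 0")
    \<comment> \<open>With zero oscillation f equals its average almost everywhere on the cube. The
      case is separate because the measure bound for \<open>U\<close> divides by \<omega>.\<close>
    case True
    then have "(\<integral>\<^sup>+x\<in>?Q. h x \<partial>lebesgue) = 0" using hQ \<omega> by simp
    then have "AE x in lebesgue. h x * indicator ?Q x = 0"
      by (subst (asm) nn_integral_0_iff_AE) auto
    then have "AE x in lebesgue. ennreal (cmod (f x - c) * cmod (g x)) * indicator ?Q x = 0"
      by eventually_elim (auto simp: h_def indicator_def)
    then have "(\<integral>\<^sup>+x\<in>?Q. ennreal (cmod (f x - c) * cmod (g x)) \<partial>lebesgue) = 0"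
      by (subst nn_integral_0_iff_AE) auto
    then show ?thesis by (intro exI[of _ "{}"]) (auto simp: c_def)
  next
    case False
    then have \<omega>0: "0 < \<omega>" using \<omega>(2) by simp
    have "(\<integral>\<^sup>+x\<in>?Q. h x \<partial>lebesgue) \<le> ennreal (2 * \<omega>) * emeasure lebesgue ?Q"
      unfolding hQ \<omega>(1) using \<omega>0 by (intro mult_right_mono ennreal_leI) auto
    \<comment> \<open>Height 2\<omega> against a mean of \<omega>: by Chebyshev the selected cubes
      fill at most half of the cube.\<close>
    then obtain F where F: "disjoint_family_on dyadic_cube F"
      and sub: "\<And>j. j \<in> F \<Longrightarrow> dyadic_cube j \<subseteq> ?Q"
      and low: "\<And>j. j \<in> F \<Longrightarrow> ennreal (2 * \<omega>) * emeasure lebesgue (dyadic_cube j) < (\<integral>\<^sup>+x\<in>dyadic_cube j. h x \<partial>lebesgue)"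
      and up: "\<And>j. j \<in> F \<Longrightarrow> (\<integral>\<^sup>+x\<in>dyadic_cube j. h x \<partial>lebesgue)
          \<le> ennreal (2 ^ ?d * (2 * \<omega>)) * emeasure lebesgue (dyadic_cube j)"
      and AE: "AE x in lebesgue. x \<in> ?Q - (\<Union>j\<in>F. dyadic_cube j) \<longrightarrow> h x \<le> ennreal (2 * \<omega>)"
      using calderon_zygmund[of h "2 * \<omega>" i] \<omega>0 by auto
    define U where "U = (\<Union>j\<in>F. dyadic_cube j)"
    have [measurable, simp]: "U \<in> sets lebesgue" by (simp add: U_def)
    have U: "U \<subseteq> ?Q" using sub by (auto simp: U_def)
    have "ennreal \<omega> * (2 * emeasure lebesgue U) = (\<integral>\<^sup>+j. ennreal (2 * \<omega>) * emeasure lebesgue (dyadic_cube j) \<partial>count_space F)"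
      unfolding U_def emeasure_UN_dyadic[OF F] using \<omega>0 by (simp add: nn_integral_cmult ennreal_mult ac_simps)
    also have "\<dots> \<le> (\<integral>\<^sup>+j. (\<integral>\<^sup>+x\<in>dyadic_cube j. h x \<partial>lebesgue) \<partial>count_space F)"
      using low by (intro nn_integral_mono) (auto intro: less_imp_le)
    also have "\<dots> = (\<integral>\<^sup>+x\<in>U. h x \<partial>lebesgue)"
      unfolding U_def using F by (intro nn_set_integral_UN_countable[symmetric]) auto
    also have "\<dots> \<le> (\<integral>\<^sup>+x\<in>?Q. h x \<partial>lebesgue)" using U by (rule nn_set_integral_subset)
    also have "\<dots> = ennreal \<omega> * emeasure lebesgue ?Q" by (simp add: hQ \<omega>)
    finally have half: "2 * emeasure lebesgue U \<le> emeasure lebesgue ?Q"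
      using \<omega>0 by (subst (asm) ennreal_mult_le_mult_iff) auto
    have "\<forall>j. \<exists>\<Omega>. \<Omega> \<in> sets lebesgue \<and> \<Omega> \<subseteq> dyadic_cube j \<and>
     emeasure lebesgue \<Omega> \<le> ennreal ((1/2) ^ m) * emeasure lebesgue (dyadic_cube j) \<and>
     (\<integral>\<^sup>+x\<in>dyadic_cube j - \<Omega>. ennreal (cmod (f x - average f (dyadic_cube j)) * cmod (g x)) \<partial>lebesgue)
        \<le> ennreal (2 ^ (?d + 2)) * (\<integral>\<^sup>+x\<in>dyadic_cube j. W x \<partial>lebesgue)"
      using Suc.IH by blast
    from choice[OF this] obtain \<Omega> where \<Omega>: "\<And>j. \<Omega> j \<in> sets lebesgue" "\<And>j. \<Omega> j \<subseteq> dyadic_cube j"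
      "\<And>j. emeasure lebesgue (\<Omega> j) \<le> ennreal ((1/2) ^ m) * emeasure lebesgue (dyadic_cube j)"
      "\<And>j. (\<integral>\<^sup>+x\<in>dyadic_cube j - \<Omega> j. ennreal (cmod (f x - average f (dyadic_cube j)) * cmod (g x)) \<partial>lebesgue)
        \<le> ennreal (2 ^ (?d + 2)) * (\<integral>\<^sup>+x\<in>dyadic_cube j. W x \<partial>lebesgue)"
      by auto
    note [measurable] = \<Omega>(1)
    define V where "V = (\<Union>j\<in>F. \<Omega> j)"
    have [measurable, simp]: "V \<in> sets lebesgue"
      unfolding V_def using \<Omega>(1) by (intro sets.countable_UN') auto
    have disj\<Omega>: "disjoint_family_on \<Omega> F"
      using F \<Omega>(2) unfolding disjoint_family_on_def by blast
    have "emeasure lebesgue V = (\<integral>\<^sup>+j. emeasure lebesgue (\<Omega> j) \<partial>count_space F)"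
      unfolding V_def using disj\<Omega> \<Omega>(1) by (intro emeasure_UN_countable) auto
    also have "\<dots> \<le> (\<integral>\<^sup>+j. ennreal ((1/2) ^ m) * emeasure lebesgue (dyadic_cube j) \<partial>count_space F)"
      by (intro nn_integral_mono \<Omega>(3))
    also have "\<dots> = ennreal ((1/2) ^ m) * emeasure lebesgue U"
      unfolding U_def emeasure_UN_dyadic[OF F] by (simp add: nn_integral_cmult)
    also have "\<dots> = ennreal ((1/2) ^ Suc m) * (2 * emeasure lebesgue U)"
    proof -
      have "ennreal ((1/2) ^ Suc m) * 2 = ennreal ((1/2) ^ m)"
        by (simp add: ennreal_mult'[symmetric] flip: ennreal_numeral)
      then show ?thesis by (metis mult.assoc)
    qed
    also have "\<dots> \<le> ennreal ((1/2) ^ Suc m) * emeasure lebesgue ?Q"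
      using half by (rule mult_left_mono) simp
    finally have small: "emeasure lebesgue V \<le> ennreal ((1/2) ^ Suc m) * emeasure lebesgue ?Q" .
    have VU: "V \<subseteq> U" using \<Omega>(2) by (auto simp: V_def U_def)
    let ?g = "\<lambda>x. ennreal (cmod (g x))"
    \<comment> \<open>2^n times the height 2\<omega>. It bounds the jump of the average from the
      cube to a selected subcube, and also h off the selected cubes.\<close>
    let ?K = "ennreal (2 ^ (?d + 1) * \<omega>)"
    have off: "(\<integral>\<^sup>+x\<in>?Q - U. h x * ?g x \<partial>lebesgue) \<le> ?K * (\<integral>\<^sup>+x\<in>?Q - U. ?g x \<partial>lebesgue)"
    proof -
      have "(1::real) \<le> 2 ^ ?d" by simp
      then have le: "ennreal (2 * \<omega>) \<le> ?K" using \<omega>0 by (intro ennreal_leI) simp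
      have "(\<integral>\<^sup>+x\<in>?Q - U. h x * ?g x \<partial>lebesgue) \<le> (\<integral>\<^sup>+x. ?K * (?g x * indicator (?Q - U) x) \<partial>lebesgue)"
        using AE
      proof (intro nn_integral_mono_AE, eventually_elim)
        case (elim x)
        show ?case
        proof (cases "x \<in> ?Q - U")
          case True
          then have "h x \<le> ?K" using elim le unfolding U_def by (meson order_trans)
          from mult_right_mono[OF this, of "?g x"] True show ?thesis by simp
        qed auto
      qed
      then show ?thesis by (simp add: nn_integral_cmult)
    qed
    \<comment> \<open>On a selected cube, h is at most the deviation from the average of that cube,
      handled by the induction hypothesis, plus the jump between averages.\<close>
    have on: "(\<integral>\<^sup>+x\<in>dyadic_cube j - \<Omega> j. h x * ?g x \<partial>lebesgue)
        \<le> ennreal (2 ^ (?d + 2)) * (\<integral>\<^sup>+x\<in>dyadic_cube j. W x \<partial>lebesgue) + ?K * (\<integral>\<^sup>+x\<in>dyadic_cube j. ?g x \<partial>lebesgue)"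
      if j: "j \<in> F" for j
    proof -
      let ?cj = "average f (dyadic_cube j)"
      have "emeasure lebesgue (dyadic_cube j) * ennreal (cmod (?cj - c)) \<le> (\<integral>\<^sup>+x\<in>dyadic_cube j. h x \<partial>lebesgue)"
        unfolding h_def by (subst mult.commute, intro average_diff_le locally_integrable_dyadic loc sets_dyadic_cube
          emeasure_dyadic_cube_pos emeasure_dyadic_cube_finite)
      also have "\<dots> \<le> emeasure lebesgue (dyadic_cube j) * ?K"
        using up[OF j] by (simp add: ac_simps)
      finally have cj: "ennreal (cmod (?cj - c)) \<le> ?K"
        using emeasure_dyadic_cube_pos[of j] emeasure_dyadic_cube_finite[of j]
        by (subst (asm) ennreal_mult_le_mult_iff) auto
      have "h x \<le> ennreal (cmod (f x - ?cj)) + ?K" for x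
      proof -
        have "h x \<le> ennreal (cmod (f x - ?cj)) + ennreal (cmod (?cj - c))"
          unfolding h_def using norm_triangle_ineq[of "f x - ?cj" "?cj - c"]
          by (simp flip: ennreal_plus)
        also have "\<dots> \<le> ennreal (cmod (f x - ?cj)) + ?K" using cj by (rule add_left_mono)
        finally show ?thesis .
      qed
      then have "h x * ?g x \<le> ennreal (cmod (f x - ?cj) * cmod (g x)) + ?K * ?g x" for x
        using mult_right_mono[of "h x" "ennreal (cmod (f x - ?cj)) + ?K" "?g x"] by (simp add: distrib_right ennreal_mult)
      then have "(\<integral>\<^sup>+x\<in>dyadic_cube j - \<Omega> j. h x * ?g x \<partial>lebesgue)
          \<le> (\<integral>\<^sup>+x. ennreal (cmod (f x - ?cj) * cmod (g x)) * indicator (dyadic_cube j - \<Omega> j) x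
              + ?K * (?g x * indicator (dyadic_cube j) x) \<partial>lebesgue)"
        by (intro nn_integral_mono) (auto simp: indicator_def)
      also have "\<dots> = (\<integral>\<^sup>+x\<in>dyadic_cube j - \<Omega> j. ennreal (cmod (f x - ?cj) * cmod (g x)) \<partial>lebesgue)
          + ?K * (\<integral>\<^sup>+x\<in>dyadic_cube j. ?g x \<partial>lebesgue)"
        by (subst nn_integral_add) (auto simp: nn_integral_cmult)
      also have "\<dots> \<le> ennreal (2 ^ (?d + 2)) * (\<integral>\<^sup>+x\<in>dyadic_cube j. W x \<partial>lebesgue) + ?K * (\<integral>\<^sup>+x\<in>dyadic_cube j. ?g x \<partial>lebesgue)"
        by (intro add_right_mono \<Omega>(4))
      finally show ?thesis .
    qed
    have "?Q - V \<subseteq> (?Q - U) \<union> (\<Union>j\<in>F. dyadic_cube j - \<Omega> j)"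
      by (auto simp: U_def V_def)
    then have "(\<integral>\<^sup>+x\<in>?Q - V. h x * ?g x \<partial>lebesgue) \<le> (\<integral>\<^sup>+x\<in>(?Q - U) \<union> (\<Union>j\<in>F. dyadic_cube j - \<Omega> j). h x * ?g x \<partial>lebesgue)"
      by (rule nn_set_integral_subset)
    also have "\<dots> = (\<integral>\<^sup>+x\<in>?Q - U. h x * ?g x \<partial>lebesgue) + (\<integral>\<^sup>+x\<in>(\<Union>j\<in>F. dyadic_cube j - \<Omega> j). h x * ?g x \<partial>lebesgue)"
      by (intro nn_set_integral_disjoint_Un sets.countable_UN' countable_indices) (auto simp: U_def)
    also have "(\<integral>\<^sup>+x\<in>(\<Union>j\<in>F. dyadic_cube j - \<Omega> j). h x * ?g x \<partial>lebesgue)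
        = (\<integral>\<^sup>+j. (\<integral>\<^sup>+x\<in>dyadic_cube j - \<Omega> j. h x * ?g x \<partial>lebesgue) \<partial>count_space F)"
    proof (intro nn_set_integral_UN_countable)
      show "disjoint_family_on (\<lambda>j. dyadic_cube j - \<Omega> j) F"
        using F unfolding disjoint_family_on_def by blast
    qed auto
    also have "\<dots> \<le> (\<integral>\<^sup>+j. ennreal (2 ^ (?d + 2)) * (\<integral>\<^sup>+x\<in>dyadic_cube j. W x \<partial>lebesgue) + ?K * (\<integral>\<^sup>+x\<in>dyadic_cube j. ?g x \<partial>lebesgue) \<partial>count_space F)"
      using on by (intro nn_integral_mono) auto
    also have "\<dots> = ennreal (2 ^ (?d + 2)) * (\<integral>\<^sup>+x\<in>U. W x \<partial>lebesgue) + ?K * (\<integral>\<^sup>+x\<in>U. ?g x \<partial>lebesgue)"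
      unfolding U_def using F by (simp add: nn_integral_add nn_integral_cmult nn_set_integral_UN_countable)
    also have "(\<integral>\<^sup>+x\<in>?Q - U. h x * ?g x \<partial>lebesgue) + (ennreal (2 ^ (?d + 2)) * (\<integral>\<^sup>+x\<in>U. W x \<partial>lebesgue) + ?K * (\<integral>\<^sup>+x\<in>U. ?g x \<partial>lebesgue))
        \<le> ?K * (\<integral>\<^sup>+x\<in>?Q - U. ?g x \<partial>lebesgue) + (ennreal (2 ^ (?d + 2)) * (\<integral>\<^sup>+x\<in>U. W x \<partial>lebesgue) + ?K * (\<integral>\<^sup>+x\<in>U. ?g x \<partial>lebesgue))"
      by (intro add_right_mono off)
    also have "\<dots> = ?K * (\<integral>\<^sup>+x\<in>(?Q - U) \<union> U. ?g x \<partial>lebesgue) + ennreal (2 ^ (?d + 2)) * (\<integral>\<^sup>+x\<in>U. W x \<partial>lebesgue)"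
      by (subst nn_set_integral_disjoint_Un) (auto simp: distrib_left ac_simps)
    also have "(?Q - U) \<union> U = ?Q" using U by auto
    \<comment> \<open>The jump terms and the part off \<open>U\<close> add up to one integral of |g|
      over the whole cube, which is paid by \<open>W\<close> off \<open>U\<close>. The induction
      hypothesis pays with \<open>W\<close> on \<open>U\<close>, so both charges fit under the same
      constant for every m. Its value is 2^(n+1) from \<open>?K\<close> times 2 from the half
      mass.\<close>
    also have "?K * (\<integral>\<^sup>+x\<in>?Q. ?g x \<partial>lebesgue) \<le> ennreal (2 ^ (?d + 2)) * (\<integral>\<^sup>+x\<in>?Q - U. W x \<partial>lebesgue)"
    proof -
      have "?K * (\<integral>\<^sup>+x\<in>?Q. ?g x \<partial>lebesgue) = ennreal (2 ^ (?d + 1)) * (mean_osc f ?Q * (\<integral>\<^sup>+x\<in>?Q. ?g x \<partial>lebesgue))"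
        using \<omega> by (simp add: ennreal_mult mult.assoc)
      also have "\<dots> \<le> ennreal (2 ^ (?d + 1)) * (2 * (\<integral>\<^sup>+x\<in>?Q - U. W x \<partial>lebesgue))"
        unfolding W_def using half U by (intro mult_left_mono mean_osc_half_mass) auto
      also have "\<dots> = ennreal (2 ^ (?d + 2)) * (\<integral>\<^sup>+x\<in>?Q - U. W x \<partial>lebesgue)"
      proof -
        have "ennreal (2 ^ (?d + 2)) = ennreal (2 ^ (?d + 1)) * 2"
          by (simp add: ennreal_mult'[symmetric] flip: ennreal_numeral)
        then show ?thesis by (simp add: mult.assoc)
      qed
      finally show ?thesis .
    qed
    also have "ennreal (2 ^ (?d + 2)) * (\<integral>\<^sup>+x\<in>?Q - U. W x \<partial>lebesgue) + ennreal (2 ^ (?d + 2)) * (\<integral>\<^sup>+x\<in>U. W x \<partial>lebesgue)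
        = ennreal (2 ^ (?d + 2)) * (\<integral>\<^sup>+x\<in>(?Q - U) \<union> U. W x \<partial>lebesgue)"
      by (subst nn_set_integral_disjoint_Un) (auto simp: distrib_left)
    also have "(?Q - U) \<union> U = ?Q" using U by auto
    finally have "(\<integral>\<^sup>+x\<in>?Q - V. h x * ?g x \<partial>lebesgue) \<le> ennreal (2 ^ (?d + 2)) * (\<integral>\<^sup>+x\<in>?Q. W x \<partial>lebesgue)"
      by (auto intro: add_right_mono)
    then show ?thesis
      using small VU U by (intro exI[of _ V]) (auto simp: h_def c_def ennreal_mult)
  qed
qed

text \<open>The exceptional sets have summable measures, so by Borel-Cantelli almost every point
  eventually lies outside them. Fatou then passes the uniform bound to the whole cube.\<close>

private lemma local_pairing:
  "(\<integral>\<^sup>+x\<in>dyadic_cube i. ennreal (cmod (f x - average f (dyadic_cube i)) * cmod (g x)) \<partial>lebesgue)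
        \<le> ennreal (2 ^ (CARD('n) + 2)) * (\<integral>\<^sup>+x\<in>dyadic_cube i. W x \<partial>lebesgue)"
proof -
  let ?Q = "dyadic_cube i"
  let ?H = "\<lambda>x. ennreal (cmod (f x - average f (dyadic_cube i)) * cmod (g x))"
  have "\<forall>m. \<exists>\<Omega>. \<Omega> \<in> sets lebesgue \<and> \<Omega> \<subseteq> ?Q \<and>
     emeasure lebesgue \<Omega> \<le> ennreal ((1/2) ^ m) * emeasure lebesgue ?Q \<and>
     (\<integral>\<^sup>+x\<in>?Q - \<Omega>. ?H x \<partial>lebesgue) \<le> ennreal (2 ^ (CARD('n) + 2)) * (\<integral>\<^sup>+x\<in>?Q. W x \<partial>lebesgue)"
    using pairing_off_small_set by blast
  from choice[OF this] obtain \<Omega> where \<Omega>: "\<And>m. \<Omega> m \<in> sets lebesgue" "\<And>m. \<Omega> m \<subseteq> ?Q"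
      "\<And>m. emeasure lebesgue (\<Omega> m) \<le> ennreal ((1/2) ^ m) * emeasure lebesgue ?Q"
      "\<And>m. (\<integral>\<^sup>+x\<in>?Q - \<Omega> m. ?H x \<partial>lebesgue)
        \<le> ennreal (2 ^ (CARD('n) + 2)) * (\<integral>\<^sup>+x\<in>?Q. W x \<partial>lebesgue)"
    by blast
  note [measurable] = \<Omega>(1)
  have fin: "emeasure lebesgue (\<Omega> m) < \<infinity>" for m
    using emeasure_mono[OF \<Omega>(2), of lebesgue m] emeasure_dyadic_cube_finite[of i] by (auto intro: le_less_trans)
  have "measure lebesgue (\<Omega> m) \<le> (1/2) ^ m * measure lebesgue ?Q" for m
  proof -
    have "ennreal (measure lebesgue (\<Omega> m)) \<le> ennreal ((1/2) ^ m * measure lebesgue ?Q)"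
      using \<Omega>(3)[of m] fin[of m] unfolding emeasure_dyadic_cube'
      by (simp add: emeasure_eq_ennreal_measure ennreal_mult)
    then show ?thesis by (subst (asm) ennreal_le_iff) auto
  qed
  then have "summable (\<lambda>m. measure lebesgue (\<Omega> m))"
    by (intro summable_comparison_test'[OF summable_mult2[OF summable_geometric[of "1/2"]]]) auto
  then have "AE x in lebesgue. eventually (\<lambda>m. x \<in> space lebesgue - \<Omega> m) sequentially"
    using \<Omega>(1) fin by (intro borel_cantelli_AE1) auto
  then have "AE x in lebesgue. ?H x * indicator ?Q x \<le> liminf (\<lambda>m. ?H x * indicator (?Q - \<Omega> m) x)"
  proof (rule eventually_mono)
    fix x assume "\<forall>\<^sub>F m in sequentially. x \<in> space lebesgue - \<Omega> m"
    then have "eventually (\<lambda>m. ?H x * indicator ?Q x \<le> ?H x * indicator (?Q - \<Omega> m) x) sequentially"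
      by eventually_elim (auto simp: indicator_def)
    then show "?H x * indicator ?Q x \<le> liminf (\<lambda>m. ?H x * indicator (?Q - \<Omega> m) x)" by (rule Liminf_bounded)
  qed
  then have "(\<integral>\<^sup>+x\<in>?Q. ?H x \<partial>lebesgue) \<le> (\<integral>\<^sup>+x. liminf (\<lambda>m. ?H x * indicator (?Q - \<Omega> m) x) \<partial>lebesgue)"
    by (rule nn_integral_mono_AE)
  also have "\<dots> \<le> liminf (\<lambda>m. \<integral>\<^sup>+x\<in>?Q - \<Omega> m. ?H x \<partial>lebesgue)"
    by (intro nn_integral_liminf) measurable
  also have "\<dots> \<le> liminf (\<lambda>m::nat. ennreal (2 ^ (CARD('n) + 2)) * (\<integral>\<^sup>+x\<in>?Q. W x \<partial>lebesgue))"
    using \<Omega>(4) by (intro Liminf_mono always_eventually) auto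
  also have "\<dots> = ennreal (2 ^ (CARD('n) + 2)) * (\<integral>\<^sup>+x\<in>?Q. W x \<partial>lebesgue)"
    by (simp add: Liminf_const)
  finally show ?thesis .
qed

text \<open>Each jump of averages is charged to the shell between consecutive ancestors; the shells
  are disjoint, so the constant does not depend on k. It is 2^n from the jump times 2 from the half
  mass.\<close>

private lemma average_ancestor_pairing:
  "ennreal (cmod (average f (dyadic_cube i) - average f (dyadic_cube (ancestor k i))))
      * (\<integral>\<^sup>+x\<in>dyadic_cube i. ennreal (cmod (g x)) \<partial>lebesgue)
    \<le> ennreal (2 ^ (CARD('n) + 1)) * (\<integral>\<^sup>+x\<in>dyadic_cube (ancestor k i). W x \<partial>lebesgue)"
proof (induction k)
  case (Suc k)
  let ?G = "\<integral>\<^sup>+x\<in>dyadic_cube i. ennreal (cmod (g x)) \<partial>lebesgue"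
  let ?j = "ancestor k i" and ?j' = "ancestor (Suc k) i"
  let ?Q = "dyadic_cube ?j" and ?Q' = "dyadic_cube ?j'"
  have anc: "ancestor 1 ?j = ?j'" by (simp add: ancestor_add)
  then have sub: "?Q \<subseteq> ?Q'" using dyadic_cube_subset_ancestor by metis
  \<comment> \<open>In dimension at least 1 a child fills at most half of its parent, so the child
    itself can be the set left out.\<close>
  have "(2::real) \<le> 2 ^ CARD('n)" using power_increasing[of 1 "CARD('n)" "2::real"] by simp
  then have half: "2 * emeasure lebesgue ?Q \<le> emeasure lebesgue ?Q'"
    using emeasure_dyadic_cube_ancestor[of 1 ?j] unfolding anc
    by (simp add: mult_right_mono flip: ennreal_numeral)
  have "ennreal (cmod (average f ?Q - average f ?Q')) * ?G \<le> (ennreal (2 ^ CARD('n)) * mean_osc f ?Q') * (\<integral>\<^sup>+x\<in>?Q'. ennreal (cmod (g x)) \<partial>lebesgue)"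
    using average_ancestor_diff_le[OF loc, of ?j] dyadic_cube_subset_ancestor[of i "Suc k"] unfolding anc
    by (intro mult_mono nn_set_integral_subset) auto
  also have "\<dots> \<le> ennreal (2 ^ CARD('n)) * (2 * (\<integral>\<^sup>+x\<in>?Q' - ?Q. W x \<partial>lebesgue))"
    unfolding mult.assoc using mean_osc_half_mass[OF f sets_dyadic_cube sub half, of g]
    by (intro mult_left_mono) (auto simp: W_def mult.assoc)
  also have "\<dots> = ennreal (2 ^ (CARD('n) + 1)) * (\<integral>\<^sup>+x\<in>?Q' - ?Q. W x \<partial>lebesgue)"
    by (simp add: ennreal_mult' mult.assoc mult.left_commute)
  finally have step: "ennreal (cmod (average f ?Q - average f ?Q')) * ?G \<le> ennreal (2 ^ (CARD('n) + 1)) * (\<integral>\<^sup>+x\<in>?Q' - ?Q. W x \<partial>lebesgue)" .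
  have "ennreal (cmod (average f (dyadic_cube i) - average f ?Q')) * ?G
      \<le> (ennreal (cmod (average f (dyadic_cube i) - average f ?Q)) + ennreal (cmod (average f ?Q - average f ?Q'))) * ?G"
    using norm_triangle_ineq[of "average f (dyadic_cube i) - average f ?Q" "average f ?Q - average f ?Q'"]
    by (intro mult_right_mono) (auto simp flip: ennreal_plus)
  also have "\<dots> \<le> ennreal (2 ^ (CARD('n) + 1)) * (\<integral>\<^sup>+x\<in>?Q. W x \<partial>lebesgue)
      + ennreal (2 ^ (CARD('n) + 1)) * (\<integral>\<^sup>+x\<in>?Q' - ?Q. W x \<partial>lebesgue)"
    unfolding distrib_right by (intro add_mono Suc.IH step)
  also have "\<dots> = ennreal (2 ^ (CARD('n) + 1)) * (\<integral>\<^sup>+x\<in>?Q \<union> (?Q' - ?Q). W x \<partial>lebesgue)"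
    by (subst nn_set_integral_disjoint_Un) (auto simp: distrib_left)
  also have "?Q \<union> (?Q' - ?Q) = ?Q'" using sub by auto
  finally show ?case .
qed simp

text \<open>On each cube the deviation from the average and the average itself contribute 2^(n+2)
  each, independently of the cube. Monotone convergence along each of the 2^n chains of orthant
  cubes then reaches the whole space.\<close>

lemma pairing_le_sharp_dyadic:
  assumes decay: "\<And>i \<epsilon>. 0 < \<epsilon> \<Longrightarrow> \<exists>k. cmod (average f (dyadic_cube (ancestor k i))) < \<epsilon>"
  shows "(\<integral>\<^sup>+x. ennreal (cmod (f x * g x)) \<partial>lebesgue)
    \<le> ennreal (2 ^ CARD('n) * 2 ^ (CARD('n) + 3)) * (\<integral>\<^sup>+x. sharp_maximal f x * dyadic_maximal g x \<partial>lebesgue)"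
proof -
  let ?W = "\<integral>\<^sup>+x. W x \<partial>lebesgue"
  let ?d = "CARD('n)"
  have cube: "(\<integral>\<^sup>+x\<in>dyadic_cube i. ennreal (cmod (f x * g x)) \<partial>lebesgue) \<le> ennreal (2 ^ (?d + 3)) * ?W" for i
  proof -
    let ?Q = "dyadic_cube i" and ?G = "\<integral>\<^sup>+x\<in>dyadic_cube i. ennreal (cmod (g x)) \<partial>lebesgue"
    have QW: "(\<integral>\<^sup>+x\<in>A. W x \<partial>lebesgue) \<le> ?W" for A
      by (intro nn_integral_mono) (auto simp: indicator_def)
    have "ennreal (cmod (average f ?Q)) * ?G \<le> ennreal (2 ^ (?d + 2)) * ?W"
    proof (cases "average f ?Q = 0")
      case False
      \<comment> \<open>An ancestor whose average is less than half as large: the telescoped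
        difference then controls the average up to the factor 2.\<close>
      then obtain k where k: "cmod (average f (dyadic_cube (ancestor k i))) < cmod (average f ?Q) / 2"
        using decay[of "cmod (average f ?Q) / 2" i] by auto
      have "cmod (average f ?Q) \<le> 2 * cmod (average f ?Q - average f (dyadic_cube (ancestor k i)))"
        using k norm_triangle_ineq2[of "average f ?Q" "average f (dyadic_cube (ancestor k i))"] by linarith
      then have "ennreal (cmod (average f ?Q)) * ?G
          \<le> ennreal (2 * cmod (average f ?Q - average f (dyadic_cube (ancestor k i)))) * ?G"
        by (intro mult_right_mono ennreal_leI) auto
      also have "\<dots> = 2 * (ennreal (cmod (average f ?Q - average f (dyadic_cube (ancestor k i)))) * ?G)"
        by (simp add: ennreal_mult mult.assoc)
      also have "\<dots> \<le> 2 * (ennreal (2 ^ (?d + 1)) * ?W)"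
        by (intro mult_left_mono order_trans[OF average_ancestor_pairing] QW) auto
      also have "\<dots> = ennreal (2 ^ (?d + 2)) * ?W"
        by (simp add: ennreal_mult' mult.assoc mult.left_commute power_add)
      finally show ?thesis .
    qed simp
    then have split: "(\<integral>\<^sup>+x\<in>?Q. ennreal (cmod (f x - average f ?Q) * cmod (g x)) \<partial>lebesgue) + ennreal (cmod (average f ?Q)) * ?G
        \<le> ennreal (2 ^ (?d + 2)) * ?W + ennreal (2 ^ (?d + 2)) * ?W"
      by (intro add_mono order_trans[OF local_pairing] mult_left_mono QW) auto
    have "(\<integral>\<^sup>+x\<in>?Q. ennreal (cmod (f x * g x)) \<partial>lebesgue)
      \<le> (\<integral>\<^sup>+x. ennreal (cmod (f x - average f ?Q) * cmod (g x)) * indicator ?Q x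
            + ennreal (cmod (average f ?Q)) * (ennreal (cmod (g x)) * indicator ?Q x) \<partial>lebesgue)"
    proof (intro nn_integral_mono)
      fix x
      have "cmod (f x * g x) \<le> cmod (f x - average f ?Q) * cmod (g x) + cmod (average f ?Q) * cmod (g x)"
        using norm_triangle_ineq[of "f x - average f ?Q" "average f ?Q"]
        by (simp add: norm_mult mult_right_mono flip: distrib_right)
      then show "ennreal (cmod (f x * g x)) * indicator ?Q x \<le> ennreal (cmod (f x - average f ?Q) * cmod (g x)) * indicator ?Q x
            + ennreal (cmod (average f ?Q)) * (ennreal (cmod (g x)) * indicator ?Q x)"
        by (auto simp: indicator_def simp flip: ennreal_plus ennreal_mult)
    qed
    also have "\<dots> = (\<integral>\<^sup>+x\<in>?Q. ennreal (cmod (f x - average f ?Q) * cmod (g x)) \<partial>lebesgue) + ennreal (cmod (average f ?Q)) * ?G"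
      by (subst nn_integral_add) (auto simp: nn_integral_cmult)
    also note split
    also have "ennreal (2 ^ (?d + 2)) * ?W + ennreal (2 ^ (?d + 2)) * ?W = ennreal (2 ^ (?d + 3)) * ?W"
    proof -
      have 2: "(2::real) ^ (?d + 3) = 2 ^ (?d + 2) + 2 ^ (?d + 2)" by (simp add: power_add)
      show ?thesis unfolding 2 by (simp only: distrib_right ennreal_plus zero_le_power zero_le_numeral)
    qed
    finally show ?thesis .
  qed
  define Q where "Q e N = dyadic_cube (orthant_index e N :: int \<times> (int^'n))" for e N
  have [measurable]: "Q e N \<in> sets lebesgue" for e N by (simp add: Q_def)
  have "Q e N \<subseteq> Q e (Suc N)" for e N
    unfolding Q_def by (metis ancestor_orthant_index dyadic_cube_subset_ancestor)
  then have inc: "incseq (Q e)" for e by (intro incseq_SucI)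
  have orthant: "(\<integral>\<^sup>+x\<in>(\<Union>N. Q e N). ennreal (cmod (f x * g x)) \<partial>lebesgue) \<le> ennreal (2 ^ (?d + 3)) * ?W" for e
  proof -
    have "(\<integral>\<^sup>+x\<in>(\<Union>N. Q e N). ennreal (cmod (f x * g x)) \<partial>lebesgue) = emeasure (density lebesgue (\<lambda>x. ennreal (cmod (f x * g x)))) (\<Union>N. Q e N)"
      by (subst emeasure_density) auto
    also have "\<dots> = (SUP N. emeasure (density lebesgue (\<lambda>x. ennreal (cmod (f x * g x)))) (Q e N))"
      using inc by (intro SUP_emeasure_incseq[symmetric]) auto
    also have "\<dots> = (SUP N. \<integral>\<^sup>+x\<in>Q e N. ennreal (cmod (f x * g x)) \<partial>lebesgue)"
      by (subst emeasure_density) auto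
    also have "\<dots> \<le> ennreal (2 ^ (?d + 3)) * ?W"
      unfolding Q_def by (intro SUP_least cube)
    finally show ?thesis .
  qed
  have cover: "\<exists>e. x \<in> (\<Union>N. Q e N)" for x
  proof -
    obtain N where "norm x < 2 ^ N"
      using real_arch_pow[of 2] by auto
    then have "x \<in> Q (\<lambda>l. 0 \<le> x $ l) N" unfolding Q_def by (rule mem_orthant_cube)
    then show ?thesis by blast
  qed
  have "(\<integral>\<^sup>+x. ennreal (cmod (f x * g x)) \<partial>lebesgue)
      \<le> (\<integral>\<^sup>+x. (\<Sum>e\<in>UNIV. ennreal (cmod (f x * g x)) * indicator (\<Union>N. Q e N) x) \<partial>lebesgue)"
  proof (intro nn_integral_mono)
    fix x
    obtain e where e: "x \<in> (\<Union>N. Q e N)" using cover by blast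
    have "ennreal (cmod (f x * g x)) * indicator (\<Union>N. Q e N) x \<le> (\<Sum>e\<in>UNIV. ennreal (cmod (f x * g x)) * indicator (\<Union>N. Q e N) x)"
      by (rule member_le_sum) auto
    with e show "ennreal (cmod (f x * g x)) \<le> (\<Sum>e\<in>UNIV. ennreal (cmod (f x * g x)) * indicator (\<Union>N. Q e N) x)"
      by (simp add: indicator_def)
  qed
  also have "\<dots> = (\<Sum>e\<in>UNIV. \<integral>\<^sup>+x\<in>(\<Union>N. Q e N). ennreal (cmod (f x * g x)) \<partial>lebesgue)"
    by (intro nn_integral_sum) measurable
  also have "\<dots> \<le> (\<Sum>e\<in>(UNIV :: ('n \<Rightarrow> bool) set). ennreal (2 ^ (?d + 3)) * ?W)"
    by (intro sum_mono orthant)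
  also have "\<dots> = ennreal (2 ^ ?d * 2 ^ (?d + 3)) * ?W"
    by (simp add: card_fun ennreal_mult' mult.assoc flip: ennreal_power)
  finally show ?thesis by (simp add: W_def)
qed

end

subsection \<open>Powers and the Hoelder inequality for extended nonnegative functions\<close>

lemma ennpowr_ennreal [simp]: "0 \<le> x \<Longrightarrow> ennpowr (ennreal x) a = ennreal (x powr a)"
  by (simp add: ennpowr_def)

lemma ennpowr_top [simp]: "ennpowr top a = top"
  by (simp add: ennpowr_def)

lemma ennpowr_0 [simp]: "ennpowr 0 a = 0"
  by (simp add: ennpowr_def)

lemma ennpowr_eq_0_iff [simp]: "ennpowr x a = 0 \<longleftrightarrow> x = 0"
  by (cases x) auto

lemma ennpowr_eq_top_iff [simp]: "ennpowr x a = top \<longleftrightarrow> x = top"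
  by (cases x) auto

lemma ennpowr_mono: "x \<le> y \<Longrightarrow> 0 \<le> a \<Longrightarrow> ennpowr x a \<le> ennpowr y a"
  by (cases x; cases y) (auto simp: top_unique intro!: ennreal_leI powr_mono2)

lemma ennpowr_mult: "ennpowr (x * y) a = ennpowr x a * ennpowr y a"
  by (cases x; cases y)
    (auto simp: powr_mult ennreal_mult_top ennreal_top_mult simp flip: ennreal_mult)

lemma ennpowr_ennpowr: "ennpowr (ennpowr x a) b = ennpowr x (a * b)"
  by (cases x) (auto simp: powr_powr)

lemma ennpowr_1 [simp]: "ennpowr x 1 = x"
  by (cases x) auto

lemma ennpowr_inverse_cancel:
  "a \<noteq> 0 \<Longrightarrow> ennpowr (ennpowr x a) (1 / a) = x" "a \<noteq> 0 \<Longrightarrow> ennpowr (ennpowr x (1 / a)) a = x"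
  by (simp_all add: ennpowr_ennpowr)

lemma ennpowr_measurable [measurable]: "(\<lambda>x. ennpowr x a) \<in> borel_measurable borel"
  unfolding ennpowr_def by measurable

text \<open>From x + y \<le> 2 max x y, hence valid for exponents below 1 too; it is applied both
  with q and with 1 / q.\<close>

lemma ennpowr_add_le:
  assumes "0 \<le> a"
  shows "ennpowr (x + y) a \<le> ennreal (2 powr a) * (ennpowr x a + ennpowr y a)"
proof -
  have "x + y \<le> 2 * max x y"
    by (metis add_mono max.cobounded1 max.cobounded2 mult_2)
  then have "ennpowr (x + y) a \<le> ennpowr 2 a * ennpowr (max x y) a"
    unfolding ennpowr_mult[symmetric] using assms by (rule ennpowr_mono)
  also have "ennpowr 2 a = ennreal (2 powr a)"
    using ennpowr_ennreal[of 2 a] by simp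
  also have "ennpowr (max x y) a \<le> ennpowr x a + ennpowr y a"
    by (simp add: max_def)
  finally show ?thesis by (simp add: mult_left_mono)
qed

text \<open>Young's inequality after normalising by the two norms. The degenerate cases are split
  off: a vanishing norm makes the integrand vanish almost everywhere, and an infinite one beside a
  nonzero one makes the right side infinite.\<close>

lemma nn_integral_Hoelder:
  assumes [measurable]: "f \<in> borel_measurable M" "g \<in> borel_measurable M"
    and pq: "1 < p" "1 < q" "1 / p + 1 / q = (1::real)"
  shows "(\<integral>\<^sup>+x. f x * g x \<partial>M) \<le> ennpowr (\<integral>\<^sup>+x. ennpowr (f x) p \<partial>M) (1 / p) * ennpowr (\<integral>\<^sup>+x. ennpowr (g x) q \<partial>M) (1 / q)"
    (is "_ \<le> ennpowr ?A _ * ennpowr ?B _")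
proof -
  have [measurable]: "(\<lambda>x. ennpowr (f x) p) \<in> borel_measurable M" "(\<lambda>x. ennpowr (g x) q) \<in> borel_measurable M"
    by (auto intro: measurable_compose[OF _ ennpowr_measurable])
  consider "?A = 0" | "?B = 0" | "?A \<noteq> 0" "?B = top" | "?A = top" "?B \<noteq> 0"
    | a b where "?A = ennreal a" "?B = ennreal b" "0 < a" "0 < b"
    by (cases ?A; cases ?B) (auto simp: order_less_le)
  then show ?thesis
  proof cases
    case 1
    then have "AE x in M. f x = 0" by (subst (asm) nn_integral_0_iff_AE) auto
    then have "(\<integral>\<^sup>+x. f x * g x \<partial>M) = 0" by (subst nn_integral_0_iff_AE) (auto elim: eventually_mono)
    then show ?thesis by simp
  next
    case 2
    then have "AE x in M. g x = 0" by (subst (asm) nn_integral_0_iff_AE) auto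
    then have "(\<integral>\<^sup>+x. f x * g x \<partial>M) = 0" by (subst nn_integral_0_iff_AE) (auto elim: eventually_mono)
    then show ?thesis by simp
  next
    case 5
    define \<alpha> where "\<alpha> = a powr (1 / p)"
    define \<beta> where "\<beta> = b powr (1 / q)"
    have pos: "0 < \<alpha>" "0 < \<beta>" using 5 by (auto simp: \<alpha>_def \<beta>_def)
    have pow: "\<alpha> powr p = a" "\<beta> powr q = b" using 5 pq by (auto simp: \<alpha>_def \<beta>_def powr_powr)
    have pt: "f x * g x \<le> ennreal (\<alpha> * \<beta> / (p * a)) * ennpowr (f x) p + ennreal (\<alpha> * \<beta> / (q * b)) * ennpowr (g x) q" for x
    proof -
      consider "f x = 0 \<or> g x = 0" | "f x = top \<or> g x = top"
        | u v where "f x = ennreal u" "g x = ennreal v" "0 \<le> u" "0 \<le> v"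
        by (cases "f x"; cases "g x") auto
      then show ?thesis
      proof cases
        case 2
        then show ?thesis using pos pq 5 by (auto simp: ennreal_mult_top)
      next
        case 3
        have "(u / \<alpha>) * (v / \<beta>) \<le> (u / \<alpha>) powr p / p + (v / \<beta>) powr q / q"
          using pq 3 pos by (intro Youngs_inequality) auto
        also have "\<dots> = u powr p / (p * a) + v powr q / (q * b)"
          using 3 pos by (simp add: powr_divide pow mult.commute)
        finally have "u * v \<le> \<alpha> * \<beta> * (u powr p / (p * a) + v powr q / (q * b))"
          using pos by (simp add: field_simps)
        then have "ennreal (u * v) \<le> ennreal (\<alpha> * \<beta> / (p * a) * u powr p + \<alpha> * \<beta> / (q * b) * v powr q)"
          by (intro ennreal_leI) (simp add: field_simps)
        also have "\<dots> = ennreal (\<alpha> * \<beta> / (p * a)) * ennreal (u powr p) + ennreal (\<alpha> * \<beta> / (q * b)) * ennreal (v powr q)"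
        proof -
          have nn: "0 \<le> \<alpha> * \<beta> / (p * a)" "0 \<le> \<alpha> * \<beta> / (q * b)" using pos pq 5 by auto
          show ?thesis
            by (simp only: ennreal_plus mult_nonneg_nonneg nn powr_ge_zero ennreal_mult)
        qed
        finally show ?thesis using 3 by (simp add: ennreal_mult)
      qed auto
    qed
    have "(\<integral>\<^sup>+x. f x * g x \<partial>M) \<le> (\<integral>\<^sup>+x. ennreal (\<alpha> * \<beta> / (p * a)) * ennpowr (f x) p + ennreal (\<alpha> * \<beta> / (q * b)) * ennpowr (g x) q \<partial>M)"
      by (intro nn_integral_mono pt)
    also have "\<dots> = ennreal (\<alpha> * \<beta> / (p * a)) * ennreal a + ennreal (\<alpha> * \<beta> / (q * b)) * ennreal b"
      using 5 by (subst nn_integral_add) (auto simp: nn_integral_cmult)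
    also have "\<dots> = ennreal (\<alpha> * \<beta> * (1 / p + 1 / q))"
      using pos pq(1,2) 5 by (simp add: field_simps flip: ennreal_plus ennreal_mult)
    also have "\<dots> = ennreal \<alpha> * ennreal \<beta>" using pq(3) pos by (simp add: ennreal_mult)
    finally show ?thesis using 5 by (simp add: \<alpha>_def \<beta>_def)
  qed (auto simp: ennreal_mult_top ennreal_top_mult)
qed

text \<open>The weights turn the \<open>l\<^sup>1\<close> sum into a supremum, so no convexity of \<open>x\<^sup>s\<close> is required.\<close>
lemma ennpowr_suminf_le:
  fixes x :: "nat \<Rightarrow> ennreal"
  assumes \<beta>: "0 < \<beta>" and s: "0 < s"
  shows "ennpowr (\<Sum>k. x k) s \<le> ennreal ((1 / (1 - 2 powr (- \<beta>))) powr s) * (\<Sum>k. ennreal (2 powr (\<beta> * s * real k)) * ennpowr (x k) s)"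
proof -
  have lt1: "(2::real) powr (- \<beta>) < 1" using \<beta> by (simp add: powr_less_one)
  let ?y = "\<lambda>k. ennreal (2 powr (\<beta> * real k)) * x k"
  define T where "T = (\<Sum>k. ennpowr (?y k) s)"
  have y: "?y k \<le> ennpowr T (1 / s)" for k
  proof -
    have "(\<Sum>k\<in>{k}. ennpowr (?y k) s) \<le> T" unfolding T_def by (intro sum_le_suminf) auto
    then have "ennpowr (ennpowr (?y k) s) (1 / s) \<le> ennpowr T (1 / s)" using s by (intro ennpowr_mono) auto
    then show ?thesis using s by (simp add: ennpowr_inverse_cancel)
  qed
  have "x k \<le> ennreal ((2 powr (- \<beta>)) ^ k) * ennpowr T (1 / s)" for k
  proof -
    have "(2 powr (- \<beta>)) ^ k = 2 powr (- (\<beta> * real k))"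
      by (subst powr_realpow[symmetric]) (auto simp: powr_powr)
    then have "ennreal ((2 powr (- \<beta>)) ^ k) * ennreal (2 powr (\<beta> * real k)) = 1"
      by (simp flip: ennreal_mult powr_add)
    then have "x k = ennreal ((2 powr (- \<beta>)) ^ k) * ?y k"
      by (simp flip: mult.assoc)
    also have "\<dots> \<le> ennreal ((2 powr (- \<beta>)) ^ k) * ennpowr T (1 / s)"
      by (intro mult_left_mono y) simp
    finally show ?thesis .
  qed
  then have "(\<Sum>k. x k) \<le> (\<Sum>k. ennreal ((2 powr (- \<beta>)) ^ k) * ennpowr T (1 / s))"
    by (intro suminf_le) auto
  also have "\<dots> = (\<Sum>k. ennreal ((2 powr (- \<beta>)) ^ k)) * ennpowr T (1 / s)"
    by simp
  also have "(\<Sum>k. ennreal ((2 powr (- \<beta>)) ^ k)) = ennreal (1 / (1 - 2 powr (- \<beta>)))"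
  proof (rule suminf_ennreal_eq)
    show "(\<lambda>k. (2 powr (- \<beta>)) ^ k) sums (1 / (1 - 2 powr (- \<beta>)))"
      using lt1 by (intro geometric_sums) auto
  qed auto
  finally have "ennpowr (\<Sum>k. x k) s \<le> ennpowr (ennreal (1 / (1 - 2 powr (- \<beta>))) * ennpowr T (1 / s)) s"
    using s by (intro ennpowr_mono) auto
  also have "\<dots> = ennreal ((1 / (1 - 2 powr (- \<beta>))) powr s) * T"
    using s lt1 by (simp add: ennpowr_mult ennpowr_inverse_cancel)
  finally show ?thesis using s
    by (simp add: T_def ennpowr_mult powr_powr mult.commute mult.left_commute)
qed

subsection \<open>Decreasing rearrangements\<close>

lemma antimono_borel_measurable:
  fixes f :: "real \<Rightarrow> ennreal"
  assumes "antimono f"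
  shows "f \<in> borel_measurable borel"
proof (rule borel_measurableI_greater)
  fix y
  have "is_interval {x. y < f x}"
    using assms unfolding is_interval_1 by (auto dest: antimonoD intro: less_le_trans)
  then show "{x \<in> space borel. y < f x} \<in> sets borel"
    by (simp add: real_interval_borel_measurable)
qed

lemma sets_superlevel [simp]:
  fixes F :: "'a \<Rightarrow> ennreal"
  assumes [measurable]: "F \<in> borel_measurable M" and "space M = UNIV"
  shows "{x. a < F x} \<in> sets M"
proof -
  have "{x \<in> space M. a < F x} \<in> sets M" by measurable
  then show ?thesis by (simp add: assms(2))
qed

lemma antimono_distr_fun:
  assumes "F \<in> borel_measurable lebesgue"
  shows "antimono (distr_fun F)"
  using assms unfolding distr_fun_def
  by (intro antimonoI emeasure_mono) (auto intro: le_less_trans ennreal_leI)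

lemma distr_fun_mono:
  assumes "G \<in> borel_measurable lebesgue" "\<And>x. F x \<le> G x"
  shows "distr_fun F s \<le> distr_fun G s"
  using assms unfolding distr_fun_def by (intro emeasure_mono) (auto intro: less_le_trans)

lemma antimono_rearrangement: "antimono (rearrangement F)"
  unfolding rearrangement_def by (intro antimonoI INF_superset_mono) (auto intro: order_trans ennreal_leI)

lemma rearrangement_mono:
  assumes "G \<in> borel_measurable lebesgue" "\<And>x. F x \<le> G x"
  shows "rearrangement F u \<le> rearrangement G u"
  unfolding rearrangement_def using distr_fun_mono[OF assms]
  by (intro INF_superset_mono) (auto intro: order_trans)

lemmas rearrangement_measurable [measurable] = antimono_borel_measurable[OF antimono_rearrangement]

lemma rearrangement_le: "0 < s \<Longrightarrow> distr_fun F s \<le> ennreal u \<Longrightarrow> rearrangement F u \<le> ennreal s"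
  unfolding rearrangement_def by (rule INF_lower) simp

lemma le_rearrangement:
  assumes "F \<in> borel_measurable lebesgue" "ennreal u < distr_fun F s"
  shows "ennreal s \<le> rearrangement F u"
  unfolding rearrangement_def
proof (rule INF_greatest)
  fix s' assume "s' \<in> {s. 0 < s \<and> distr_fun F s \<le> ennreal u}"
  then show "ennreal s \<le> ennreal s'"
    using assms antimonoD[OF antimono_distr_fun, of F s' s] by (cases "s' \<le> s") (auto intro: ennreal_leI)
qed

text \<open>The integral is the length of the set of levels whose distribution function exceeds u,
  and all these levels lie below the rearrangement at u.\<close>

lemma nn_integral_level_sets_le_rearrangement:
  assumes [measurable]: "F \<in> borel_measurable lebesgue"
  shows "(\<integral>\<^sup>+s\<in>{0<..}. indicator {s. ennreal u < distr_fun F s} s \<partial>lborel) \<le> rearrangement F u"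
proof -
  have [measurable]: "distr_fun F \<in> borel_measurable borel"
    by (intro antimono_borel_measurable antimono_distr_fun) simp
  have "(\<integral>\<^sup>+s\<in>{0<..}. indicator {s. ennreal u < distr_fun F s} s \<partial>lborel)
      = (\<integral>\<^sup>+s. indicator ({s. ennreal u < distr_fun F s} \<inter> {0<..}) s \<partial>lborel)"
    by (intro nn_integral_cong) (simp add: indicator_def)
  also have "\<dots> = emeasure lborel ({s. ennreal u < distr_fun F s} \<inter> {0<..})"
    by (intro nn_integral_indicator) measurable
  also have "\<dots> \<le> rearrangement F u"
  proof (cases "rearrangement F u")
    case (real r)
    have "{s. ennreal u < distr_fun F s} \<inter> {0<..} \<subseteq> {0..r}"
    proof
      fix s assume "s \<in> {s. ennreal u < distr_fun F s} \<inter> {0<..}"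
      then have "ennreal s \<le> ennreal r" "0 < s" using le_rearrangement[OF assms, of u s] real by auto
      then show "s \<in> {0..r}" using real by (auto simp: ennreal_le_iff)
    qed
    then have "emeasure lborel ({s. ennreal u < distr_fun F s} \<inter> {0<..}) \<le> emeasure lborel {0..r}"
      by (intro emeasure_mono) auto
    then show ?thesis using real by simp
  qed simp
  finally show ?thesis .
qed

section \<open>The layer-cake formula and the Hardy-Littlewood inequality\<close>

lemma emeasure_lborel_greaterThan: "emeasure lborel {a::real<..} = top"
proof (cases "emeasure lborel {a<..}")
  case (real r)
  have "emeasure lborel {a<..<a + (r + 1)} \<le> emeasure lborel {a<..}"
    by (intro emeasure_mono) auto
  then show ?thesis using real by (simp add: ennreal_le_iff)
qed

lemma layer_cake: "(a::ennreal) = (\<integral>\<^sup>+s\<in>{0<..}. indicator {s. ennreal s < a} s \<partial>lborel)"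
proof -
  have "(\<integral>\<^sup>+s\<in>{0<..}. indicator {s. ennreal s < a} s \<partial>lborel) = (\<integral>\<^sup>+s. indicator ({s. ennreal s < a} \<inter> {0<..}) s \<partial>lborel)"
    by (intro nn_integral_cong) (simp add: indicator_def)
  also have "\<dots> = emeasure lborel ({s. ennreal s < a} \<inter> {0<..})"
    by (intro nn_integral_indicator) measurable
  also have "\<dots> = a"
  proof (cases a)
    case (real r)
    then have "{s. ennreal s < a} \<inter> {0<..} = {0<..<r}" by (auto simp: ennreal_less_iff)
    then show ?thesis using real by simp
  next
    case top
    then have "{s. ennreal s < a} \<inter> {0<..} = {0<..}" by auto
    then show ?thesis using top by (simp add: emeasure_lborel_greaterThan)
  qed
  finally show ?thesis by simp
qed

lemma sigma_finite_lebesgue: "sigma_finite_measure (lebesgue :: 'a::euclidean_space measure)"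
proof
  obtain A :: "'a set set" where "countable A" "A \<subseteq> sets lborel" "\<Union>A = space lborel" "\<forall>a\<in>A. emeasure lborel a \<noteq> \<infinity>"
    using lborel.sigma_finite_countable by metis
  then show "\<exists>A::'a set set. countable A \<and> A \<subseteq> sets lebesgue \<and> \<Union> A = space lebesgue \<and> (\<forall>a\<in>A. emeasure lebesgue a \<noteq> \<infinity>)"
    by (intro exI[of _ A]) (auto simp: emeasure_completion)
qed

interpretation lborel_lebesgue: pair_sigma_finite "lborel :: real measure" "lebesgue :: 'a::euclidean_space measure"
  by (intro pair_sigma_finite.intro sigma_finite_lborel sigma_finite_lebesgue)

text \<open>By the layer-cake formula in G, everything reduces to the measure of {G > t} inside A,
  which is at most min |A| (d_G t). This minimum is written as an integral over u, and Tonelli lets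
  the integral over t produce the rearrangement.\<close>

lemma nn_set_integral_le_rearrangement:
  fixes G :: "real^'n \<Rightarrow> ennreal"
  assumes G [measurable]: "G \<in> borel_measurable lebesgue" and [measurable]: "A \<in> sets lebesgue"
  shows "(\<integral>\<^sup>+x\<in>A. G x \<partial>lebesgue) \<le> (\<integral>\<^sup>+u\<in>{0<..}. indicator {u. ennreal u < emeasure lebesgue A} u * rearrangement G u \<partial>lborel)"
proof -
  have [measurable]: "distr_fun G \<in> borel_measurable borel"
    by (intro antimono_borel_measurable antimono_distr_fun) simp
  let ?\<mu> = "emeasure lebesgue A"
  have "(\<integral>\<^sup>+x\<in>A. G x \<partial>lebesgue) = (\<integral>\<^sup>+x. (\<integral>\<^sup>+t. indicator {t. ennreal t < G x} t * indicator {0<..} t * indicator A x \<partial>lborel) \<partial>lebesgue)"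
    by (subst layer_cake[of "G _"], intro nn_integral_cong, subst nn_integral_multc) auto
  also have "\<dots> = (\<integral>\<^sup>+t. (\<integral>\<^sup>+x. indicator {t. ennreal t < G x} t * indicator {0<..} t * indicator A x \<partial>lebesgue) \<partial>lborel)"
    by (intro lborel_lebesgue.Fubini') measurable
  also have "\<dots> \<le> (\<integral>\<^sup>+t. (\<integral>\<^sup>+u. indicator {u. ennreal u < ?\<mu>} u * indicator {0<..} u * (indicator {t. ennreal u < distr_fun G t} t * indicator {0<..} t) \<partial>lborel) \<partial>lborel)"
  proof (rule nn_integral_mono)
    fix t :: real
    show "(\<integral>\<^sup>+x. indicator {t. ennreal t < G x} t * indicator {0<..} t * indicator A x \<partial>lebesgue)
        \<le> (\<integral>\<^sup>+u. indicator {u. ennreal u < ?\<mu>} u * indicator {0<..} u * (indicator {t. ennreal u < distr_fun G t} t * indicator {0<..} t) \<partial>lborel)"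
    proof (cases "0 < t")
      case True
      have "(\<integral>\<^sup>+x. indicator {t. ennreal t < G x} t * indicator {0<..} t * indicator A x \<partial>lebesgue)
          = (\<integral>\<^sup>+x. indicator ({x. ennreal t < G x} \<inter> A) x \<partial>lebesgue)"
        using True by (intro nn_integral_cong) (auto simp: indicator_def)
      also have "\<dots> = emeasure lebesgue ({x. ennreal t < G x} \<inter> A)"
        by (intro nn_integral_indicator) measurable
      also have "\<dots> \<le> min ?\<mu> (distr_fun G t)"
        unfolding distr_fun_def using G by (intro min.boundedI emeasure_mono) auto
      also have "\<dots> = (\<integral>\<^sup>+u\<in>{0<..}. indicator {u. ennreal u < min ?\<mu> (distr_fun G t)} u \<partial>lborel)"
        by (rule layer_cake)
      also have "\<dots> = (\<integral>\<^sup>+u. indicator {u. ennreal u < ?\<mu>} u * indicator {0<..} u * (indicator {t. ennreal u < distr_fun G t} t * indicator {0<..} t) \<partial>lborel)"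
        using True by (intro nn_integral_cong) (auto simp: indicator_def)
      finally show ?thesis .
    qed simp
  qed
  also have "\<dots> = (\<integral>\<^sup>+u. (\<integral>\<^sup>+t. indicator {u. ennreal u < ?\<mu>} u * indicator {0<..} u * (indicator {t. ennreal u < distr_fun G t} t * indicator {0<..} t) \<partial>lborel) \<partial>lborel)"
    by (intro lborel_pair.Fubini') measurable
  also have "\<dots> \<le> (\<integral>\<^sup>+u. indicator {u. ennreal u < ?\<mu>} u * indicator {0<..} u * rearrangement G u \<partial>lborel)"
    using nn_integral_level_sets_le_rearrangement[OF G]
    by (intro nn_integral_mono) (subst nn_integral_cmult, auto intro: mult_left_mono)
  finally show ?thesis by (simp add: ac_simps)
qed

text \<open>The layer-cake formula in F replaces F by indicators of its superlevel sets, for which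
  the bound over a set A applies; Tonelli reassembles the rearrangement of F.\<close>

lemma Hardy_Littlewood_rearrangement:
  fixes F G :: "real^'n \<Rightarrow> ennreal"
  assumes F [measurable]: "F \<in> borel_measurable lebesgue" and G [measurable]: "G \<in> borel_measurable lebesgue"
  shows "(\<integral>\<^sup>+x. F x * G x \<partial>lebesgue) \<le> (\<integral>\<^sup>+u\<in>{0<..}. rearrangement F u * rearrangement G u \<partial>lborel)"
proof -
  have [measurable]: "distr_fun F \<in> borel_measurable borel"
    by (intro antimono_borel_measurable antimono_distr_fun) simp
  have "(\<integral>\<^sup>+x. F x * G x \<partial>lebesgue) = (\<integral>\<^sup>+x. (\<integral>\<^sup>+s. indicator {s. ennreal s < F x} s * indicator {0<..} s * G x \<partial>lborel) \<partial>lebesgue)"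
    by (subst layer_cake[of "F _"], intro nn_integral_cong, subst nn_integral_multc) auto
  also have "\<dots> = (\<integral>\<^sup>+s. (\<integral>\<^sup>+x. indicator {s. ennreal s < F x} s * indicator {0<..} s * G x \<partial>lebesgue) \<partial>lborel)"
    by (intro lborel_lebesgue.Fubini') measurable
  also have "\<dots> \<le> (\<integral>\<^sup>+s. (\<integral>\<^sup>+u. (indicator {0<..} u * rearrangement G u) * (indicator {s. ennreal u < distr_fun F s} s * indicator {0<..} s) \<partial>lborel) \<partial>lborel)"
  proof (rule nn_integral_mono)
    fix s :: real
    show "(\<integral>\<^sup>+x. indicator {s. ennreal s < F x} s * indicator {0<..} s * G x \<partial>lebesgue)
      \<le> (\<integral>\<^sup>+u. (indicator {0<..} u * rearrangement G u) * (indicator {s. ennreal u < distr_fun F s} s * indicator {0<..} s) \<partial>lborel)"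
    proof (cases "0 < s")
      case True
      have "(\<integral>\<^sup>+x. indicator {s. ennreal s < F x} s * indicator {0<..} s * G x \<partial>lebesgue) = (\<integral>\<^sup>+x\<in>{x. ennreal s < F x}. G x \<partial>lebesgue)"
        using True by (intro nn_integral_cong) (auto simp: indicator_def)
      also have "\<dots> \<le> (\<integral>\<^sup>+u\<in>{0<..}. indicator {u. ennreal u < emeasure lebesgue {x. ennreal s < F x}} u * rearrangement G u \<partial>lborel)"
        using F by (intro nn_set_integral_le_rearrangement) auto
      also have "\<dots> = (\<integral>\<^sup>+u. (indicator {0<..} u * rearrangement G u) * (indicator {s. ennreal u < distr_fun F s} s * indicator {0<..} s) \<partial>lborel)"
        using True by (intro nn_integral_cong) (auto simp: indicator_def distr_fun_def)
      finally show ?thesis .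
    qed simp
  qed
  also have "\<dots> = (\<integral>\<^sup>+u. (\<integral>\<^sup>+s. (indicator {0<..} u * rearrangement G u) * (indicator {s. ennreal u < distr_fun F s} s * indicator {0<..} s) \<partial>lborel) \<partial>lborel)"
    by (intro lborel_pair.Fubini') measurable
  also have "\<dots> \<le> (\<integral>\<^sup>+u. (indicator {0<..} u * rearrangement G u) * rearrangement F u \<partial>lborel)"
    using nn_integral_level_sets_le_rearrangement[OF F]
    by (intro nn_integral_mono) (subst nn_integral_cmult, auto intro: mult_left_mono)
  finally show ?thesis by (simp add: ac_simps)
qed

subsection \<open>Lorentz norms\<close>

text \<open>Hardy-Littlewood reduces to functions on the half-line, where ordinary Hoelder with
  exponents q and q' applies.\<close>

lemma lorentz_Hoelder:
  fixes F G :: "real^'n \<Rightarrow> ennreal"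
  assumes "F \<in> borel_measurable lebesgue" "G \<in> borel_measurable lebesgue"
    and p: "1 / p + 1 / p' = 1" and q: "1 < q" "1 < q'" "1 / q + 1 / q' = 1"
  shows "(\<integral>\<^sup>+x. F x * G x \<partial>lebesgue) \<le> lorentz_norm p q F * lorentz_norm p' q' G"
proof -
  \<comment> \<open>The factor u^(-1/q) absorbs du/u, so that the Lorentz norm is the plain L^q norm
    of \<open>X\<close>.\<close>
  define X where "X = (\<lambda>(p::real) q (H :: real^'n \<Rightarrow> ennreal) u. ennreal (u powr (1 / p - 1 / q)) * rearrangement H u * indicator {0<..} u)"
  have [measurable]: "X p q H \<in> borel_measurable lborel" for p q H unfolding X_def by measurable
  have pow: "(\<integral>\<^sup>+u. ennpowr (X p q H u) q \<partial>lborel) = (\<integral>\<^sup>+u\<in>{0<..}. ennpowr (ennreal (u powr (1 / p)) * rearrangement H u) q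
                               * ennreal (1 / u) \<partial>lborel)" if "1 < q" for p q H
  proof (intro nn_integral_cong)
    fix u :: real
    show "ennpowr (X p q H u) q = ennpowr (ennreal (u powr (1 / p)) * rearrangement H u) q * ennreal (1 / u) * indicator {0<..} u"
    proof (cases "0 < u")
      case True
      have "(1 / p - 1 / q) * q = q / p - 1" using that by (simp add: left_diff_distrib)
      then have "(u powr (1 / p - 1 / q)) powr q = u powr (q / p) * (1 / u)"
        using True by (simp only: powr_powr) (simp add: powr_diff)
      then have "ennreal ((u powr (1 / p - 1 / q)) powr q) = ennreal ((u powr (1 / p)) powr q) * ennreal (1 / u)"
        using True by (simp add: powr_powr flip: ennreal_mult)
      then show ?thesis using True by (simp add: X_def ennpowr_mult ac_simps)
    qed (simp add: X_def)
  qed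
  have "(\<integral>\<^sup>+x. F x * G x \<partial>lebesgue) \<le> (\<integral>\<^sup>+u\<in>{0<..}. rearrangement F u * rearrangement G u \<partial>lborel)"
    using assms(1,2) by (rule Hardy_Littlewood_rearrangement)
  also have "\<dots> = (\<integral>\<^sup>+u. X p q F u * X p' q' G u \<partial>lborel)"
  proof (intro nn_integral_cong)
    fix u :: real
    show "rearrangement F u * rearrangement G u * indicator {0<..} u = X p q F u * X p' q' G u"
    proof (cases "0 < u")
      case True
      \<comment> \<open>Both pairs of exponents are conjugate, so the two weights cancel.\<close>
      have "(1 / p - 1 / q) + (1 / p' - 1 / q') = 0" using p q by simp
      then have "ennreal (u powr (1 / p - 1 / q)) * ennreal (u powr (1 / p' - 1 / q')) = 1"
        using True by (simp flip: ennreal_mult powr_add)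
      then show ?thesis using True by (simp add: X_def) (metis mult.assoc mult.commute mult_1)
    qed (simp add: X_def)
  qed
  also have "\<dots> \<le> ennpowr (\<integral>\<^sup>+u. ennpowr (X p q F u) q \<partial>lborel) (1 / q) * ennpowr (\<integral>\<^sup>+u. ennpowr (X p' q' G u) q' \<partial>lborel) (1 / q')"
    using q by (intro nn_integral_Hoelder) auto
  also have "\<dots> = lorentz_norm p q F * lorentz_norm p' q' G"
    using q by (simp add: lorentz_norm_def pow)
  finally show ?thesis .
qed

lemma nn_integral_powr_0:
  assumes "0 < a" "0 \<le> v"
  shows "(\<integral>\<^sup>+u\<in>{0<..<v}. ennreal (u powr a * (1 / u)) \<partial>lborel) = ennreal (v powr a / a)"
proof -
  have "(\<integral>\<^sup>+u\<in>{0<..<v}. ennreal (u powr a * (1 / u)) \<partial>lborel) = (\<integral>\<^sup>+u. ennreal (u powr (a - 1)) * indicator {0..v} u \<partial>lborel)"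
  proof (rule nn_integral_cong_AE)
    have "AE u in lborel. u \<noteq> (0::real)" "AE u in lborel. u \<noteq> v"
      by (auto intro!: AE_lborel_singleton)
    then show "AE u in lborel. ennreal (u powr a * (1 / u)) * indicator {0<..<v} u = ennreal (u powr (a - 1)) * indicator {0..v} u"
      by eventually_elim (auto simp: indicator_def powr_diff)
  qed
  also have "\<dots> = ennreal (v powr (a - 1 + 1) / (a - 1 + 1))"
    using assms by (intro nn_integral_has_integral_lebesgue' has_integral_powr_from_0) auto
  finally show ?thesis by simp
qed

lemma le_rearrangement_on_cube:
  fixes F :: "real^'n \<Rightarrow> ennreal"
  assumes F: "F \<in> borel_measurable lebesgue" and c: "\<And>x. x \<in> dyadic_cube i \<Longrightarrow> c \<le> F x"
    and u: "0 \<le> u" "u < measure lebesgue (dyadic_cube i)"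
  shows "c \<le> rearrangement F u"
proof (rule ccontr)
  assume "\<not> c \<le> rearrangement F u"
  then obtain s where s: "0 < s" "distr_fun F s \<le> ennreal u" "ennreal s < c"
    unfolding rearrangement_def by (auto simp: not_le INF_less_iff)
  have "ennreal (measure lebesgue (dyadic_cube i)) = emeasure lebesgue (dyadic_cube i)"
    by (simp add: emeasure_dyadic_cube')
  also have "\<dots> \<le> distr_fun F s"
    unfolding distr_fun_def using c s F by (intro emeasure_mono) (auto intro: less_le_trans)
  also note s(2)
  finally show False using u by (simp add: ennreal_le_iff)
qed

text \<open>The rearrangement is at least c below |Q|. The integral of u^(q/p - 1) over (0, |Q|) is
  (p/q) |Q|^(q/p), so the factor is the Lorentz norm of the indicator of the cube.\<close>

lemma lorentz_norm_ge:
  fixes F :: "real^'n \<Rightarrow> ennreal"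
  assumes F: "F \<in> borel_measurable lebesgue" and "0 < p" "0 < q"
    and c: "\<And>x. x \<in> dyadic_cube i \<Longrightarrow> c \<le> F x"
  shows "c * ennreal ((p / q) powr (1 / q) * measure lebesgue (dyadic_cube i) powr (1 / p)) \<le> lorentz_norm p q F"
proof -
  let ?v = "measure lebesgue (dyadic_cube i)"
  have le: "c \<le> rearrangement F u" if "0 < u" "u < ?v" for u
    using that by (intro le_rearrangement_on_cube[OF F c]) auto
  have "ennpowr c q * ennreal (?v powr (q / p) / (q / p))
      = (\<integral>\<^sup>+u. ennpowr c q * (ennreal (u powr (q / p) * (1 / u)) * indicator {0<..<?v} u) \<partial>lborel)"
    using assms by (subst nn_integral_cmult, simp, subst nn_integral_powr_0) auto
  also have "\<dots> \<le> (\<integral>\<^sup>+u\<in>{0<..}. ennpowr (ennreal (u powr (1 / p)) * rearrangement F u) q * ennreal (1 / u) \<partial>lborel)"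
  proof (rule nn_integral_mono)
    fix u :: real
    show "ennpowr c q * (ennreal (u powr (q / p) * (1 / u)) * indicator {0<..<?v} u)
        \<le> ennpowr (ennreal (u powr (1 / p)) * rearrangement F u) q * ennreal (1 / u) * indicator {0<..} u"
    proof (cases "0 < u \<and> u < ?v")
      case True
      then have "ennpowr c q * (ennreal (u powr (q / p)) * ennreal (1 / u)) \<le> ennpowr (rearrangement F u) q * (ennreal (u powr (q / p)) * ennreal (1 / u))"
        using le[of u] assms by (intro mult_right_mono ennpowr_mono) auto
      moreover have e: "ennreal (u powr (q / p) * (1 / u)) = ennreal (u powr (q / p)) * ennreal (1 / u)"
        using True by (intro ennreal_mult) auto
      ultimately show ?thesis using True unfolding e by (simp add: ennpowr_mult powr_powr ac_simps)
    qed (auto simp: indicator_def)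
  qed
  finally have "ennpowr (ennpowr c q * ennreal (?v powr (q / p) / (q / p))) (1 / q) \<le> lorentz_norm p q F"
    unfolding lorentz_norm_def using assms by (intro ennpowr_mono) auto
  moreover have "(?v powr (q / p) / (q / p)) powr (1 / q) = (p / q) powr (1 / q) * ?v powr (1 / p)"
  proof -
    have "?v powr (q / p) / (q / p) = (p / q) * ?v powr (q / p)" using assms by simp
    then show ?thesis using assms by (simp only:) (subst powr_mult, auto simp: powr_powr)
  qed
  ultimately show ?thesis
    using assms by (simp add: ennpowr_mult ennpowr_inverse_cancel)
qed

lemma rearrangement_eq_0:
  assumes "\<And>x. x \<notin> A \<Longrightarrow> F x = 0" "emeasure lebesgue A \<le> ennreal u" "A \<in> sets lebesgue"
  shows "rearrangement F u = 0"
proof -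
  have "rearrangement F u \<le> 0 + ennreal e" if "0 < e" for e
  proof -
    have "x \<in> A" if "ennreal e < F x" for x using that assms(1)[of x] by (cases "x \<in> A") auto
    then have "{x. ennreal e < F x} \<subseteq> A" by blast
    then have "distr_fun F e \<le> ennreal u"
      unfolding distr_fun_def using emeasure_mono[of _ A lebesgue] assms(2,3) by (blast intro: order_trans)
    then show ?thesis unfolding add_0 using that by (intro rearrangement_le)
  qed
  then have "rearrangement F u \<le> 0" by (rule ennreal_le_epsilon)
  then show ?thesis by simp
qed

lemma lorentz_norm_indicator_le:
  fixes i :: "int \<times> (int^'n)"
  assumes "0 < p" "0 < q"
  shows "lorentz_norm p q (indicator (dyadic_cube i))
    \<le> ennreal ((p / q) powr (1 / q) * measure lebesgue (dyadic_cube i) powr (1 / p))"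
proof -
  let ?v = "measure lebesgue (dyadic_cube i)" and ?F = "indicator (dyadic_cube i) :: real^'n \<Rightarrow> ennreal"
  have le1: "rearrangement ?F u \<le> 1" for u
    using rearrangement_le[of 1 ?F u] by (auto simp: distr_fun_def indicator_def)
  have 0: "rearrangement ?F u = 0" if "?v \<le> u" for u
    using that by (intro rearrangement_eq_0[of "dyadic_cube i"]) (auto simp: emeasure_dyadic_cube' ennreal_leI)
  have "(\<integral>\<^sup>+u\<in>{0<..}. ennpowr (ennreal (u powr (1 / p)) * rearrangement ?F u) q * ennreal (1 / u) \<partial>lborel)
      \<le> (\<integral>\<^sup>+u\<in>{0<..<?v}. ennreal (u powr (q / p) * (1 / u)) \<partial>lborel)"
  proof (rule nn_integral_mono)
    fix u :: real
    show "ennpowr (ennreal (u powr (1 / p)) * rearrangement ?F u) q * ennreal (1 / u) * indicator {0<..} u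
        \<le> ennreal (u powr (q / p) * (1 / u)) * indicator {0<..<?v} u"
    proof (cases "0 < u \<and> u < ?v")
      case True
      have "ennpowr (ennreal (u powr (1 / p)) * rearrangement ?F u) q \<le> ennpowr (ennreal (u powr (1 / p)) * 1) q"
        using le1[of u] assms by (intro ennpowr_mono mult_left_mono) auto
      also have "\<dots> = ennreal (u powr (q / p))" by (simp add: powr_powr)
      finally have "ennpowr (ennreal (u powr (1 / p)) * rearrangement ?F u) q * ennreal (1 / u) \<le> ennreal (u powr (q / p)) * ennreal (1 / u)"
        by (rule mult_right_mono) simp
      with True show ?thesis by (simp flip: ennreal_mult)
    qed (auto simp: indicator_def 0)
  qed
  also have "\<dots> = ennreal (?v powr (q / p) / (q / p))"
    using assms by (intro nn_integral_powr_0) auto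
  finally have "lorentz_norm p q ?F \<le> ennpowr (ennreal (?v powr (q / p) / (q / p))) (1 / q)"
    unfolding lorentz_norm_def using assms by (intro ennpowr_mono) auto
  moreover have "(?v powr (q / p) / (q / p)) powr (1 / q) = (p / q) powr (1 / q) * ?v powr (1 / p)"
  proof -
    have "?v powr (q / p) / (q / p) = (p / q) * ?v powr (q / p)" using assms by simp
    then show ?thesis using assms by (simp only:) (subst powr_mult, auto simp: powr_powr)
  qed
  ultimately show ?thesis using assms by simp
qed

subsection \<open>A rearrangement inequality for the local sharp maximal function\<close>

text \<open>Passes from distribution functions to rearrangements: the rearrangement of H at v is
  approximated from above by an admissible level s, and s + c is admissible for F at u.\<close>

lemma rearrangement_shift_le:
  assumes "\<And>s. 0 < s \<Longrightarrow> distr_fun H s \<le> ennreal v \<Longrightarrow> distr_fun F (s + c) \<le> ennreal u" "0 \<le> c"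
  shows "rearrangement F u \<le> rearrangement H v + ennreal c"
proof (rule ennreal_le_epsilon)
  fix e :: real assume e: "rearrangement H v + ennreal c < top" "0 < e"
  then obtain r where r: "rearrangement H v = ennreal r" "0 \<le> r" by (cases "rearrangement H v") auto
  then have "rearrangement H v < ennreal (r + e)" using e by (simp add: ennreal_less_iff)
  then obtain s where s: "0 < s" "distr_fun H s \<le> ennreal v" "ennreal s < ennreal (r + e)"
    unfolding rearrangement_def by (auto simp: INF_less_iff)
  then have "s < r + e" by (simp add: ennreal_less_iff del: ennreal_plus)
  have "rearrangement F u \<le> ennreal (s + c)"
    using s assms by (intro rearrangement_le) auto
  also have "\<dots> \<le> ennreal (r + c + e)"
    using \<open>s < r + e\<close> by (intro ennreal_leI) simp
  also have "\<dots> = rearrangement H v + ennreal c + ennreal e"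
    using r e assms(2) by (simp add: ennreal_plus)
  finally show "rearrangement F u \<le> rearrangement H v + ennreal c + ennreal e" .
qed

context
  fixes f :: "real^'n \<Rightarrow> complex" and i :: "int \<times> (int^'n)"
  assumes f [measurable]: "f \<in> borel_measurable lebesgue" and loc: "locally_integrable f"
begin

private definition h where "h x = ennreal (cmod (f x - average f (dyadic_cube i))) * indicator (dyadic_cube i) x"
private definition S where "S x = sharp_maximal f x * indicator (dyadic_cube i) x"

private lemma h_measurable [measurable]: "h \<in> borel_measurable lebesgue"
  unfolding h_def by measurable

private lemma S_measurable [measurable]: "S \<in> borel_measurable lebesgue"
  unfolding S_def using sharp_maximal_measurable[OF loc] by measurable

text \<open>Decompose the indicator of \<open>{h > s}\<close> so that \<open>h \<le> s\<close> on at least half of every selected cube. A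
  selected cube outside \<open>{S > \<sigma>}\<close> then has its average within \<open>s + 2\<sigma>\<close> of \<open>f\<^sub>Q\<close>, and Chebyshev's
  inequality bounds the rest.\<close>
private lemma distr_fun_step:
  assumes "0 < s" "0 < \<sigma>" and hs: "distr_fun h s \<le> ennreal (2 * u)" and S\<sigma>: "distr_fun S \<sigma> \<le> ennreal (u / 2)"
    and u: "0 < u" "2 ^ (CARD('n) + 2) * u \<le> measure lebesgue (dyadic_cube i)"
  shows "distr_fun h (s + (2 ^ (CARD('n) + 3) + 2) * \<sigma>) \<le> ennreal u"
proof -
  let ?d = "CARD('n)"
  let ?Q = "dyadic_cube i"
  define c where "c = average f ?Q"
  define E where "E = {x. ennreal s < h x}"
  have E [measurable]: "E \<in> sets lebesgue" by (simp add: E_def)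
  have EQ: "E \<subseteq> ?Q" by (auto simp: E_def h_def indicator_def split: if_splits)
  have Eu: "emeasure lebesgue E \<le> ennreal (2 * u)" using hs by (simp add: distr_fun_def E_def)
  \<comment> \<open>The upper density 2^n \<theta> of a selected cube is then 1/2, and \<theta> < 1
    puts almost every unselected point outside E.\<close>
  define \<theta> :: real where "\<theta> = 1 / 2 ^ (?d + 1)"
  have \<theta>: "0 < \<theta>" "\<theta> < 1"
    using one_less_power[of "2::real" "?d + 1"] by (auto simp: \<theta>_def simp del: power_Suc)
  have "(\<integral>\<^sup>+x\<in>?Q. indicator E x \<partial>lebesgue) = (\<integral>\<^sup>+x. indicator E x \<partial>lebesgue)"
    using EQ by (intro nn_integral_cong) (auto simp: indicator_def)
  also have "\<dots> = emeasure lebesgue E" by simp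
  also have "\<dots> \<le> ennreal (2 * u)" by (fact Eu)
  also have "\<dots> \<le> ennreal (\<theta> * measure lebesgue ?Q)"
    using u by (intro ennreal_leI) (simp add: \<theta>_def field_simps)
  also have "\<dots> = ennreal \<theta> * emeasure lebesgue ?Q"
    using \<theta> by (simp add: emeasure_dyadic_cube' ennreal_mult)
  finally have le: "(\<integral>\<^sup>+x\<in>?Q. indicator E x \<partial>lebesgue) \<le> ennreal \<theta> * emeasure lebesgue ?Q" .
  have intE: "(\<integral>\<^sup>+x\<in>dyadic_cube j. indicator E x \<partial>lebesgue) = emeasure lebesgue (E \<inter> dyadic_cube j)" for j
  proof -
    have "(\<integral>\<^sup>+x\<in>dyadic_cube j. indicator E x \<partial>lebesgue) = (\<integral>\<^sup>+x. indicator (E \<inter> dyadic_cube j) x \<partial>lebesgue)"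
      by (intro nn_integral_cong) (auto simp: indicator_def)
    then show ?thesis by simp
  qed
  obtain F where F: "disjoint_family_on dyadic_cube F"
    and sub: "\<And>j. j \<in> F \<Longrightarrow> dyadic_cube j \<subseteq> ?Q"
    and low: "\<And>j. j \<in> F \<Longrightarrow> ennreal \<theta> * emeasure lebesgue (dyadic_cube j) < emeasure lebesgue (E \<inter> dyadic_cube j)"
    and up: "\<And>j. j \<in> F \<Longrightarrow> emeasure lebesgue (E \<inter> dyadic_cube j) \<le> ennreal (2 ^ ?d * \<theta>) * emeasure lebesgue (dyadic_cube j)"
    and AE: "AE x in lebesgue. x \<in> ?Q - (\<Union>j\<in>F. dyadic_cube j) \<longrightarrow> indicator E x \<le> ennreal \<theta>"
    using calderon_zygmund[OF borel_measurable_indicator[OF E] less_imp_le[OF \<theta>(1)] le, unfolded intE] by blast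
  define U where "U = (\<Union>j\<in>F. dyadic_cube j)"
  have [measurable]: "U \<in> sets lebesgue" by (simp add: U_def)
  have "ennreal \<theta> * emeasure lebesgue U = (\<integral>\<^sup>+j. ennreal \<theta> * emeasure lebesgue (dyadic_cube j) \<partial>count_space F)"
    unfolding U_def emeasure_UN_dyadic[OF F] by (simp add: nn_integral_cmult)
  also have "\<dots> \<le> (\<integral>\<^sup>+j. emeasure lebesgue (E \<inter> dyadic_cube j) \<partial>count_space F)"
    using low by (intro nn_integral_mono) (auto intro: less_imp_le)
  also have "\<dots> = emeasure lebesgue (\<Union>j\<in>F. E \<inter> dyadic_cube j)"
  proof (intro emeasure_UN_countable[symmetric])
    show "disjoint_family_on (\<lambda>j. E \<inter> dyadic_cube j) F"
      using F unfolding disjoint_family_on_def by blast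
  qed auto
  also have "\<dots> \<le> emeasure lebesgue E"
    by (intro emeasure_mono) auto
  also have "\<dots> \<le> ennreal (2 * u)" by (fact Eu)
  also have "\<dots> = ennreal \<theta> * ennreal (2 ^ (?d + 2) * u)"
    using \<theta> u by (simp add: \<theta>_def flip: ennreal_mult)
  finally have Uu: "emeasure lebesgue U \<le> ennreal (2 ^ (?d + 2) * u)"
    using \<theta> by (subst (asm) ennreal_mult_le_mult_iff) auto
  \<comment> \<open>A selected cube outside \<open>R\<close> lies entirely in {S > \<sigma>}. In a
    cube of \<open>R\<close> one point with S at most \<sigma> bounds the oscillation over the cube
    by \<sigma>.\<close>
  define R where "R = {j \<in> F. \<exists>x\<in>dyadic_cube j. S x \<le> ennreal \<sigma>}"
  \<comment> \<open>The selected cubes have total measure at most 2^(n+2) u; Chebyshev at height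
    K\<sigma> divides this by K and leaves u/2.\<close>
  define K :: real where "K = 2 ^ (?d + 3)"
  have K: "0 < K" by (simp add: K_def)
  define B where "B j = {x \<in> dyadic_cube j. ennreal (K * \<sigma>) < ennreal (cmod (f x - average f (dyadic_cube j)))}" for j
  have [measurable]: "B j \<in> sets lebesgue" for j
  proof -
    have "B j = dyadic_cube j \<inter> {x. ennreal (K * \<sigma>) < ennreal (cmod (f x - average f (dyadic_cube j)))}" by (auto simp: B_def)
    also have "\<dots> \<in> sets lebesgue" by (intro sets.Int sets_superlevel) auto
    finally show ?thesis .
  qed
  have oscR: "(\<integral>\<^sup>+x\<in>dyadic_cube j. ennreal (cmod (f x - average f (dyadic_cube j))) \<partial>lebesgue) \<le> ennreal \<sigma> * emeasure lebesgue (dyadic_cube j)"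
    if jR: "j \<in> R" for j
  proof -
    obtain x where x: "x \<in> dyadic_cube j" "S x \<le> ennreal \<sigma>" "j \<in> F" using jR by (auto simp: R_def)
    have "mean_osc f (dyadic_cube j) \<le> sharp_maximal f x" using f x(1) by (rule mean_osc_le_sharp_maximal)
    also have "\<dots> = S x" using subsetD[OF sub[OF x(3)] x(1)] by (simp add: S_def)
    also note x(2)
    finally show ?thesis
      unfolding mean_osc_def mean_abs_dyadic_times[symmetric] by (rule mult_right_mono) simp
  qed
  have BR: "emeasure lebesgue (B j) \<le> ennreal (1 / K) * emeasure lebesgue (dyadic_cube j)" if "j \<in> R" for j
  proof -
    have "ennreal (K * \<sigma>) * emeasure lebesgue (B j) = (\<integral>\<^sup>+x. ennreal (K * \<sigma>) * indicator (B j) x \<partial>lebesgue)"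
      by (simp add: nn_integral_cmult_indicator)
    also have "\<dots> \<le> (\<integral>\<^sup>+x\<in>dyadic_cube j. ennreal (cmod (f x - average f (dyadic_cube j))) \<partial>lebesgue)"
      using K \<open>0 < \<sigma>\<close> by (intro nn_integral_mono) (auto simp: indicator_def B_def ennreal_less_iff)
    also have "\<dots> \<le> ennreal \<sigma> * emeasure lebesgue (dyadic_cube j)" using that by (rule oscR)
    also have "ennreal \<sigma> = ennreal (K * \<sigma>) * ennreal (1 / K)"
      using K \<open>0 < \<sigma>\<close> by (simp flip: ennreal_mult)
    finally have "ennreal (K * \<sigma>) * emeasure lebesgue (B j) \<le> ennreal (K * \<sigma>) * (ennreal (1 / K) * emeasure lebesgue (dyadic_cube j))"
      by (simp add: mult.assoc)
    then show ?thesis using K \<open>0 < \<sigma>\<close> by (subst (asm) ennreal_mult_le_mult_iff) auto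
  qed
  \<comment> \<open>Otherwise |f - f_Q| \<le> s on at least half of the cube forces |f - f_j| >
    2\<sigma> there, against a mean oscillation of at most \<sigma>.\<close>
  have avR: "cmod (average f (dyadic_cube j) - c) \<le> s + 2 * \<sigma>" if jR: "j \<in> R" for j
  proof (rule ccontr)
    let ?cj = "average f (dyadic_cube j)" and ?v = "measure lebesgue (dyadic_cube j)"
    assume "\<not> cmod (?cj - c) \<le> s + 2 * \<sigma>"
    define \<eta> where "\<eta> = cmod (?cj - c) - s"
    have \<eta>: "2 * \<sigma> < \<eta>" using \<open>\<not> _\<close> by (simp add: \<eta>_def)
    have jF: "j \<in> F" using jR by (simp add: R_def)
    have half: "emeasure lebesgue (E \<inter> dyadic_cube j) \<le> ennreal (?v / 2)"
    proof -
      have 2: "2 ^ ?d * \<theta> = 1 / 2" by (simp add: \<theta>_def)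
      have "emeasure lebesgue (E \<inter> dyadic_cube j) \<le> ennreal (1 / 2) * emeasure lebesgue (dyadic_cube j)"
        using up[OF jF] unfolding 2 .
      also have "\<dots> = ennreal (1 / 2 * ?v)"
        unfolding emeasure_dyadic_cube' by (rule ennreal_mult[symmetric]) auto
      finally show ?thesis by simp
    qed
    have "ennreal ?v = emeasure lebesgue (E \<inter> dyadic_cube j) + emeasure lebesgue (dyadic_cube j - E)"
      by (subst plus_emeasure) (auto simp: emeasure_dyadic_cube'[symmetric] intro!: arg_cong[where f = "emeasure lebesgue"])
    also have "\<dots> \<le> ennreal (?v / 2) + emeasure lebesgue (dyadic_cube j - E)"
      using half by (rule add_right_mono)
    finally have "ennreal (?v / 2) + ennreal (?v / 2) \<le> ennreal (?v / 2) + emeasure lebesgue (dyadic_cube j - E)"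
      by (simp flip: ennreal_plus)
    then have "ennreal (?v / 2) \<le> emeasure lebesgue (dyadic_cube j - E)"
      by (auto simp: ennreal_add_left_cancel_le)
    then have "ennreal \<eta> * ennreal (?v / 2) \<le> ennreal \<eta> * emeasure lebesgue (dyadic_cube j - E)"
      by (rule mult_left_mono) simp
    also have "\<dots> = (\<integral>\<^sup>+x. ennreal \<eta> * indicator (dyadic_cube j - E) x \<partial>lebesgue)"
      by (simp add: nn_integral_cmult_indicator)
    also have "\<dots> \<le> (\<integral>\<^sup>+x\<in>dyadic_cube j. ennreal (cmod (f x - ?cj)) \<partial>lebesgue)"
    proof (rule nn_integral_mono)
      fix x
      show "ennreal \<eta> * indicator (dyadic_cube j - E) x \<le> ennreal (cmod (f x - ?cj)) * indicator (dyadic_cube j) x"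
      proof (cases "x \<in> dyadic_cube j - E")
        case True
        then have "\<not> ennreal s < ennreal (cmod (f x - c))"
          using sub[OF jF] by (auto simp: E_def h_def c_def indicator_def)
        then have "cmod (f x - c) \<le> s" using \<open>0 < s\<close> by (simp add: ennreal_less_iff)
        then have "\<eta> \<le> cmod (f x - ?cj)"
          using norm_triangle_ineq[of "?cj - f x" "f x - c"] by (simp add: \<eta>_def norm_minus_commute)
        then show ?thesis using True by (simp add: ennreal_leI)
      qed simp
    qed
    also have "\<dots> \<le> ennreal \<sigma> * emeasure lebesgue (dyadic_cube j)" using jR by (rule oscR)
    finally have "ennreal (\<eta> * (?v / 2)) \<le> ennreal (\<sigma> * ?v)"
      using \<eta> \<open>0 < \<sigma>\<close> unfolding emeasure_dyadic_cube'
      by (subst (1 2) ennreal_mult) auto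
    then have "\<eta> * (?v / 2) \<le> \<sigma> * ?v"
      using \<open>0 < \<sigma>\<close> by (subst (asm) ennreal_le_iff) auto
    then show False using \<eta> measure_dyadic_cube_pos[of j] by simp
  qed
  \<comment> \<open>The level splits as (s + 2\<sigma>) + K\<sigma>: in a cube of \<open>R\<close>
    the average accounts for s + 2\<sigma>, so the point deviates from that average by more than
    K\<sigma>.\<close>
  have "emeasure lebesgue {x. ennreal (s + (K + 2) * \<sigma>) < h x} \<le> emeasure lebesgue ({x. ennreal \<sigma> < S x} \<union> (\<Union>j\<in>R. B j))"
  proof (rule emeasure_mono_AE)
    show "AE x in lebesgue. x \<in> {x. ennreal (s + (K + 2) * \<sigma>) < h x} \<longrightarrow> x \<in> {x. ennreal \<sigma> < S x} \<union> (\<Union>j\<in>R. B j)"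
      using AE
    proof eventually_elim
      case (elim x)
      show ?case
      proof clarify
        assume x: "ennreal (s + (K + 2) * \<sigma>) < h x" "x \<notin> (\<Union>j\<in>R. B j)"
        have "ennreal s \<le> ennreal (s + (K + 2) * \<sigma>)"
          using K \<open>0 < \<sigma>\<close> by (intro ennreal_leI) simp
        then have "x \<in> E" using x(1) by (auto simp: E_def)
        then have "x \<in> U" using elim EQ \<theta> by (auto simp: U_def indicator_def)
        then obtain j where j: "j \<in> F" "x \<in> dyadic_cube j" by (auto simp: U_def)
        have "h x = ennreal (cmod (f x - c))" using subsetD[OF sub[OF j(1)] j(2)] by (simp add: h_def c_def)
        then have fx: "s + (K + 2) * \<sigma> < cmod (f x - c)"
          using x(1) K \<open>0 < \<sigma>\<close> \<open>0 < s\<close> by (simp add: ennreal_less_iff del: ennreal_plus)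
        have "j \<notin> R"
        proof
          assume "j \<in> R"
          then have "K * \<sigma> < cmod (f x - average f (dyadic_cube j))"
            using avR[of j] fx norm_triangle_ineq[of "f x - average f (dyadic_cube j)" "average f (dyadic_cube j) - c"]
            by (simp add: algebra_simps)
          then have "x \<in> B j" using j K \<open>0 < \<sigma>\<close> by (simp add: B_def ennreal_less_iff)
          then show False using x(2) \<open>j \<in> R\<close> by blast
        qed
        then show "ennreal \<sigma> < S x" using j by (auto simp: R_def not_le)
      qed
    qed
    show "{x. ennreal \<sigma> < S x} \<union> (\<Union>j\<in>R. B j) \<in> sets lebesgue"
      by (intro sets.Un sets.countable_UN' sets_superlevel) auto
  qed
  also have "\<dots> \<le> emeasure lebesgue {x. ennreal \<sigma> < S x} + emeasure lebesgue (\<Union>j\<in>R. B j)"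
    by (intro emeasure_subadditive sets_superlevel sets.countable_UN') auto
  also have "emeasure lebesgue (\<Union>j\<in>R. B j) = (\<integral>\<^sup>+j. emeasure lebesgue (B j) \<partial>count_space R)"
  proof (intro emeasure_UN_countable)
    show "disjoint_family_on B R"
      using F unfolding disjoint_family_on_def R_def B_def by blast
  qed auto
  also have "\<dots> \<le> (\<integral>\<^sup>+j. ennreal (1 / K) * emeasure lebesgue (dyadic_cube j) \<partial>count_space R)"
    using BR by (intro nn_integral_mono) auto
  also have "\<dots> = ennreal (1 / K) * emeasure lebesgue (\<Union>j\<in>R. dyadic_cube j)"
  proof -
    have "disjoint_family_on dyadic_cube R" using F unfolding disjoint_family_on_def R_def by blast
    then show ?thesis by (simp add: emeasure_UN_dyadic nn_integral_cmult)
  qed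
  also have "\<dots> \<le> ennreal (1 / K) * ennreal (2 ^ (?d + 2) * u)"
  proof -
    have "emeasure lebesgue (\<Union>j\<in>R. dyadic_cube j) \<le> emeasure lebesgue U"
      by (intro emeasure_mono) (auto simp: U_def R_def)
    then show ?thesis using Uu by (intro mult_left_mono) auto
  qed
  also have "\<dots> = ennreal (u / 2)"
    using u by (simp add: K_def power_add field_simps flip: ennreal_mult)
  also have "emeasure lebesgue {x. ennreal \<sigma> < S x} + ennreal (u / 2) \<le> ennreal (u / 2) + ennreal (u / 2)"
    using S\<sigma> by (intro add_right_mono) (simp add: distr_fun_def)
  also have "\<dots> = ennreal u" using u by (simp flip: ennreal_plus)
  finally show ?thesis
    by (simp add: distr_fun_def K_def add_left_mono add_right_mono)
qed

text \<open>Three ranges of u. For u at least |Q| the left side vanishes. For u comparable to |Q|,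
  Chebyshev on the whole cube suffices, because the mean oscillation is a lower bound of
  \<open>S\<close> on the cube and so of its rearrangement at u/2. For small u the decomposition
  applies, with \<sigma> an admissible level close to that rearrangement.\<close>

private lemma rearrangement_step:
  assumes "0 < u"
  shows "rearrangement h u \<le> rearrangement h (2 * u) + ennreal (2 ^ (CARD('n) + 3) + 2) * rearrangement S (u / 2)"
proof -
  let ?d = "CARD('n)" and ?v = "measure lebesgue (dyadic_cube i)"
  let ?C = "2 ^ (CARD('n) + 3) + 2 :: real"
  have C: "0 < ?C" by (simp add: add_pos_pos)
  consider "?v \<le> u" | "u < ?v" "?v < 2 ^ (?d + 2) * u" | "2 ^ (?d + 2) * u \<le> ?v"
    by linarith
  then show ?thesis
  proof cases
    case 1
    then have "rearrangement h u = 0"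
      by (intro rearrangement_eq_0[of "dyadic_cube i"]) (auto simp: h_def emeasure_dyadic_cube' ennreal_leI)
    then show ?thesis by simp
  next
    case 2
    let ?o = "mean_osc f (dyadic_cube i)"
    have oS: "?o \<le> rearrangement S (u / 2)"
      using 2 assms mean_osc_le_sharp_maximal[OF f]
      by (intro le_rearrangement_on_cube[where i = i]) (auto simp: S_def)
    show ?thesis
    proof (cases ?o)
      case (real \<omega>)
      have "rearrangement h u \<le> ennreal (?C * \<omega>)"
      proof (rule ennreal_le_epsilon)
        fix e :: real assume e: "0 < e"
        let ?s = "?C * \<omega> + e"
        have s: "0 < ?s" using e real C by (simp add: add_nonneg_pos)
        have "ennreal ?s * distr_fun h ?s = (\<integral>\<^sup>+x. ennreal ?s * indicator {x. ennreal ?s < h x} x \<partial>lebesgue)"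
          unfolding distr_fun_def by (subst nn_integral_cmult_indicator) (auto intro: sets_superlevel)
        also have "\<dots> \<le> (\<integral>\<^sup>+x. h x \<partial>lebesgue)"
          by (intro nn_integral_mono) (auto simp: indicator_def intro: less_imp_le)
        also have "\<dots> = ennreal (\<omega> * ?v)"
          using real by (simp add: h_def mean_abs_dyadic_times[symmetric] mean_osc_def[symmetric] emeasure_dyadic_cube' ennreal_mult)
        also have "\<dots> \<le> ennreal (?s * u)"
        proof (rule ennreal_leI)
          have "\<omega> * ?v \<le> \<omega> * (2 ^ (?d + 2) * u)" using 2 real by (intro mult_left_mono) auto
          also have "\<dots> \<le> ?s * u"
            using real assms e by (simp add: algebra_simps power_add)
          finally show "\<omega> * ?v \<le> ?s * u" .
        qed
        also have "\<dots> = ennreal ?s * ennreal u" using s assms by (simp add: ennreal_mult)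
        finally have "distr_fun h ?s \<le> ennreal u"
          using s by (subst (asm) ennreal_mult_le_mult_iff) auto
        then have "rearrangement h u \<le> ennreal ?s" using s by (intro rearrangement_le)
        also have "\<dots> = ennreal (?C * \<omega>) + ennreal e"
          using real e C by (intro ennreal_plus) auto
        finally show "rearrangement h u \<le> ennreal (?C * \<omega>) + ennreal e" .
      qed
      also have "\<dots> = ennreal ?C * ?o" using real C by (simp add: ennreal_mult)
      also have "\<dots> \<le> ennreal ?C * rearrangement S (u / 2)" by (intro mult_left_mono oS) simp
      finally show ?thesis by (rule order_trans) simp
    next
      case top
      then have "rearrangement S (u / 2) = top" using oS by (simp add: top_unique)
      then show ?thesis using C by (simp add: ennreal_mult_top)
    qed
  next
    case 3
    show ?thesis
    proof (cases "rearrangement S (u / 2)")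
      case (real b)
      show ?thesis
      proof (rule ennreal_le_epsilon)
        fix e :: real assume e: "0 < e"
        have "rearrangement S (u / 2) < ennreal (b + e / ?C)"
          using real e C by (simp add: ennreal_less_iff)
        then obtain \<sigma> where \<sigma>: "0 < \<sigma>" "distr_fun S \<sigma> \<le> ennreal (u / 2)" "ennreal \<sigma> < ennreal (b + e / ?C)"
          unfolding rearrangement_def[of S] INF_less_iff by auto
        have "rearrangement h u \<le> rearrangement h (2 * u) + ennreal (?C * \<sigma>)"
        proof (rule rearrangement_shift_le)
          show "distr_fun h (s + ?C * \<sigma>) \<le> ennreal u" if "0 < s" "distr_fun h s \<le> ennreal (2 * u)" for s
            using that \<sigma> assms 3 by (intro distr_fun_step) auto
          show "0 \<le> ?C * \<sigma>" using C \<sigma> by simp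
        qed
        also have "ennreal (?C * \<sigma>) \<le> ennreal (?C * b + e)"
        proof (rule ennreal_leI)
          have "\<sigma> \<le> b + e / ?C" using \<sigma> by (simp add: ennreal_less_iff)
          then have "?C * \<sigma> \<le> ?C * (b + e / ?C)" using C by (intro mult_left_mono) auto
          also have "\<dots> = ?C * b + e" using C by (simp add: distrib_left)
          finally show "?C * \<sigma> \<le> ?C * b + e" .
        qed
        also have "\<dots> = ennreal ?C * rearrangement S (u / 2) + ennreal e"
          using real e C by (subst ennreal_plus) (auto simp: ennreal_mult)
        finally show "rearrangement h u \<le> rearrangement h (2 * u) + ennreal ?C * rearrangement S (u / 2) + ennreal e"
          by (simp add: add.assoc add_left_mono)
      qed
    next
      case top
      then show ?thesis using C by (simp add: ennreal_mult_top)
    qed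
  qed
qed

private lemma rearrangement_le_sharp:
  assumes "0 < u"
  shows "rearrangement h u \<le> ennreal (2 ^ (CARD('n) + 3) + 2) * (\<Sum>k. rearrangement S (2 ^ k * (u / 2)))"
proof -
  let ?C = "ennreal (2 ^ (CARD('n) + 3) + 2)"
  have iter: "rearrangement h u \<le> rearrangement h (2 ^ m * u) + ?C * (\<Sum>k<m. rearrangement S (2 ^ k * (u / 2)))" for m
  proof (induction m)
    case (Suc m)
    have "rearrangement h (2 ^ m * u) \<le> rearrangement h (2 ^ Suc m * u) + ?C * rearrangement S (2 ^ m * (u / 2))"
      using rearrangement_step[of "2 ^ m * u"] assms by (simp add: mult.assoc)
    then have "rearrangement h (2 ^ m * u) + ?C * (\<Sum>k<m. rearrangement S (2 ^ k * (u / 2)))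
      \<le> rearrangement h (2 ^ Suc m * u) + ?C * rearrangement S (2 ^ m * (u / 2)) + ?C * (\<Sum>k<m. rearrangement S (2 ^ k * (u / 2)))"
      by (rule add_right_mono)
    from order_trans[OF Suc.IH this] show ?case
      by (simp only: sum.lessThan_Suc distrib_left add.assoc add.commute add.left_commute)
  qed simp
  obtain m where m: "measure lebesgue (dyadic_cube i) / u < 2 ^ m"
    using real_arch_pow[of 2] by auto
  then have "rearrangement h (2 ^ m * u) = 0"
    using assms by (intro rearrangement_eq_0[of "dyadic_cube i"])
      (auto simp: h_def emeasure_dyadic_cube' field_simps intro!: ennreal_leI)
  then have "rearrangement h u \<le> ?C * (\<Sum>k<m. rearrangement S (2 ^ k * (u / 2)))"
    using iter[of m] by simp
  also have "\<dots> \<le> ?C * (\<Sum>k. rearrangement S (2 ^ k * (u / 2)))"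
    by (intro mult_left_mono sum_le_suminf) auto
  finally show ?thesis .
qed

text \<open>The average is multiplied by the rearrangement of the indicator, which is at least 1 for
  u < |Q|. A bare constant would make the Lorentz integral over all u diverge.\<close>

lemma rearrangement_local_le:
  assumes "0 < u"
  shows "rearrangement (\<lambda>x. modulus f x * indicator (dyadic_cube i) x) u
    \<le> ennreal (2 ^ (CARD('n) + 3) + 2) * (\<Sum>k. rearrangement (\<lambda>x. sharp_maximal f x * indicator (dyadic_cube i) x) (2 ^ k * (u / 2)))
      + ennreal (cmod (average f (dyadic_cube i))) * rearrangement (indicator (dyadic_cube i)) u"
proof (cases "u < measure lebesgue (dyadic_cube i)")
  case True
  let ?c = "average f (dyadic_cube i)"
  let ?F = "\<lambda>x. modulus f x * indicator (dyadic_cube i) x"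
  have "rearrangement ?F u \<le> rearrangement h u + ennreal (cmod ?c)"
  proof (rule rearrangement_shift_le)
    fix s :: real assume s: "0 < s" "distr_fun h s \<le> ennreal u"
    have "{x. ennreal (s + cmod ?c) < ?F x} \<subseteq> {x. ennreal s < h x}"
    proof clarify
      fix x assume x: "ennreal (s + cmod ?c) < ?F x"
      then have xQ: "x \<in> dyadic_cube i" by (cases "x \<in> dyadic_cube i") auto
      then have "s + cmod ?c < cmod (f x)"
        using x s by (simp add: modulus_def ennreal_less_iff del: ennreal_plus)
      then have "s < cmod (f x - ?c)"
        using norm_triangle_ineq[of "f x - ?c" ?c] by simp
      then show "ennreal s < h x" using s xQ by (simp add: h_def ennreal_less_iff)
    qed
    then have "distr_fun ?F (s + cmod ?c) \<le> distr_fun h s"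
      unfolding distr_fun_def by (intro emeasure_mono sets_superlevel) auto
    with s show "distr_fun ?F (s + cmod ?c) \<le> ennreal u" by simp
  qed simp
  also have "\<dots> \<le> ennreal (2 ^ (CARD('n) + 3) + 2) * (\<Sum>k. rearrangement S (2 ^ k * (u / 2)))
      + ennreal (cmod ?c) * rearrangement (indicator (dyadic_cube i)) u"
  proof (rule add_mono)
    show "rearrangement h u \<le> ennreal (2 ^ (CARD('n) + 3) + 2) * (\<Sum>k. rearrangement S (2 ^ k * (u / 2)))"
      using assms by (rule rearrangement_le_sharp)
    have "1 \<le> rearrangement (indicator (dyadic_cube i)) u"
      using True assms by (intro le_rearrangement_on_cube[where i = i]) auto
    from mult_left_mono[OF this, of "ennreal (cmod ?c)"]
    show "ennreal (cmod ?c) \<le> ennreal (cmod ?c) * rearrangement (indicator (dyadic_cube i)) u" by simp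
  qed
  finally show ?thesis by (simp add: S_def[abs_def])
next
  case False
  then have "rearrangement (\<lambda>x. modulus f x * indicator (dyadic_cube i) x) u = 0"
    by (intro rearrangement_eq_0[of "dyadic_cube i"]) (auto simp: emeasure_dyadic_cube' ennreal_leI)
  then show ?thesis by simp
qed

end

subsection \<open>The local Fefferman-Stein inequality in Lorentz norm\<close>

definition lorentz_integral :: "real \<Rightarrow> real \<Rightarrow> (real^'n \<Rightarrow> ennreal) \<Rightarrow> ennreal" where
  "lorentz_integral p q F = (\<integral>\<^sup>+u\<in>{0<..}. ennpowr (ennreal (u powr (1 / p)) * rearrangement F u) q
                               * ennreal (1 / u) \<partial>lborel)"

lemma lorentz_norm_eq: "lorentz_norm p q F = ennpowr (lorentz_integral p q F) (1 / q)"
  by (simp add: lorentz_norm_def lorentz_integral_def)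

lemma lorentz_integrand_measurable:
  assumes [measurable]: "H \<in> borel_measurable borel"
  shows "(\<lambda>u. ennpowr (ennreal (u powr a) * H u) q * ennreal (1 / u) * indicator {0<..} u) \<in> borel_measurable borel"
proof -
  have [measurable]: "(\<lambda>u. ennpowr (ennreal (u powr a) * H u) q) \<in> borel_measurable borel"
    by (rule measurable_compose[OF _ ennpowr_measurable]) measurable
  show ?thesis by measurable
qed

text \<open>Substitute v = c u: du/u is invariant and only the power u^(q/p) scales.\<close>

lemma lorentz_integral_dilation:
  assumes c: "0 < c"
  shows "(\<integral>\<^sup>+u\<in>{0<..}. ennpowr (ennreal (u powr (1 / p)) * rearrangement F (c * u)) q * ennreal (1 / u) \<partial>lborel)
    = ennreal (c powr (- (q / p))) * lorentz_integral p q F"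
proof -
  define g where "g v = ennpowr (ennreal (v powr (1 / p)) * rearrangement F v) q * ennreal (1 / v) * indicator {0<..} v" for v
  have [measurable]: "g \<in> borel_measurable borel"
    unfolding g_def by (intro lorentz_integrand_measurable) measurable
  have "ennpowr (ennreal (u powr (1 / p)) * rearrangement F (c * u)) q * ennreal (1 / u) * indicator {0<..} u
      = ennreal (c powr (- (q / p))) * (ennreal c * g (0 + c * u))" for u
  proof (cases "0 < u")
    case True
    have "c powr (- (q / p)) * (c * ((c * u) powr (q / p) * (1 / (c * u)))) = u powr (q / p) * (1 / u)"
      using c True by (simp add: powr_mult powr_minus field_simps)
    then have "ennreal (c powr (- (q / p))) * (ennreal c * (ennreal ((c * u) powr (q / p)) * ennreal (1 / (c * u))))
        = ennreal (u powr (q / p)) * ennreal (1 / u)"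
      using c True by (simp flip: ennreal_mult)
    then have "ennpowr (rearrangement F (c * u)) q * (ennreal (c powr (- (q / p))) * (ennreal c * (ennreal ((c * u) powr (q / p)) * ennreal (1 / (c * u)))))
        = ennpowr (rearrangement F (c * u)) q * (ennreal (u powr (q / p)) * ennreal (1 / u))"
      by simp
    with True c show ?thesis
      by (simp add: g_def ennpowr_mult powr_powr ac_simps)
  qed (use c in \<open>simp add: g_def zero_less_mult_iff\<close>)
  then have "(\<integral>\<^sup>+u\<in>{0<..}. ennpowr (ennreal (u powr (1 / p)) * rearrangement F (c * u)) q * ennreal (1 / u) \<partial>lborel)
      = ennreal (c powr (- (q / p))) * (ennreal c * (\<integral>\<^sup>+u. g (0 + c * u) \<partial>lborel))"
    by (simp add: nn_integral_cmult)
  also have "ennreal c * (\<integral>\<^sup>+u. g (0 + c * u) \<partial>lborel) = (\<integral>\<^sup>+u. g u \<partial>lborel)"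
    using c nn_integral_real_affine[of g c 0] by simp
  finally show ?thesis by (simp add: g_def lorentz_integral_def)
qed

text \<open>The series of dilated rearrangements is raised to the power q with geometric weights and
  integrated term by term; each dilation contributes a power of 2 that beats the weight.\<close>

lemma local_Fefferman_Stein:
  assumes p: "0 < p" and q: "0 < q"
  obtains K where "0 < K"
    "\<And>(f :: real^'n \<Rightarrow> complex) i. f \<in> borel_measurable lebesgue \<Longrightarrow> locally_integrable f \<Longrightarrow>
      lorentz_norm_on p q (dyadic_cube i) (modulus f)
        \<le> ennreal K * (lorentz_norm_on p q (dyadic_cube i) (sharp_maximal f)
            + ennreal (cmod (average f (dyadic_cube i)) * measure lebesgue (dyadic_cube i) powr (1 / p)))"
proof -
  \<comment> \<open>Half of 1/p: the k-th dilation gives 2^(-qk/p) up to a constant, the weight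
    takes 2^(\<beta>qk), and 2^(-\<beta>qk) remains. The sum of the resulting geometric series is
    \<open>D\<close>.\<close>
  define \<beta> where "\<beta> = 1 / (2 * p)"
  have \<beta>: "0 < \<beta>" using p by (simp add: \<beta>_def)
  define C :: real where "C = 2 ^ (CARD('n) + 3) + 2"
  have C: "0 < C" by (simp add: C_def add_pos_pos)
  define W where "W = 1 / (1 - 2 powr (- \<beta>))"
  define D where "D = 2 powr (q / p) / (1 - 2 powr (- (\<beta> * q)))"
  have lt1: "(2::real) powr (- \<beta>) < 1" "(2::real) powr (- (\<beta> * q)) < 1"
    using \<beta> q by (auto intro!: powr_less_one)
  define A where "A = 2 powr q * (C powr q * W powr q)"
  have A0: "0 \<le> A" by (simp add: A_def)
  have D0: "0 \<le> D" using lt1 by (simp add: D_def)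
  \<comment> \<open>The factor in the Lorentz norm of the indicator of a cube.\<close>
  define \<kappa> where "\<kappa> = (p / q) powr (1 / q)"
  define K where "K = 2 powr (1 / q) * ((A * D) powr (1 / q) + 2 * \<kappa>)"
  have \<kappa>: "0 < \<kappa>" using p q by (simp add: \<kappa>_def)
  have K: "0 < K" using \<kappa> by (simp add: K_def add_nonneg_pos)
  show thesis
  proof (rule that[OF K])
    fix f :: "real^'n \<Rightarrow> complex" and i :: "int \<times> (int^'n)"
    assume f: "f \<in> borel_measurable lebesgue" "locally_integrable f"
    let ?Q = "dyadic_cube i"
    let ?v = "measure lebesgue ?Q"
    define c where "c = cmod (average f ?Q)"
    define G where "G = rearrangement (\<lambda>x. modulus f x * indicator ?Q x)"
    define SS where "SS = (\<lambda>x. sharp_maximal f x * indicator ?Q x)"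
    define I where "I = rearrangement (indicator ?Q :: real^'n \<Rightarrow> ennreal)"
    have [measurable]: "G \<in> borel_measurable borel" "I \<in> borel_measurable borel" by (auto simp: G_def I_def)
    let ?w = "\<lambda>H u. ennpowr (ennreal (u powr (1 / p)) * H u) q * ennreal (1 / u) * indicator {0<..} u"
    have [measurable]: "?w I \<in> borel_measurable borel" "\<And>k::nat. ?w (\<lambda>u. rearrangement SS (2 ^ k / 2 * u)) \<in> borel_measurable borel"
      by (intro lorentz_integrand_measurable, measurable)+
    have pt: "?w G u \<le> ennreal A * (\<Sum>k. ennreal (2 powr (\<beta> * q * real k)) * ?w (\<lambda>u. rearrangement SS (2 ^ k / 2 * u)) u)
        + ennreal (2 powr q * c powr q) * ?w I u" for u
    proof (cases "0 < u")
      case True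
      let ?\<Sigma> = "\<Sum>k. rearrangement SS (2 ^ k / 2 * u)"
      have "G u \<le> ennreal C * ?\<Sigma> + ennreal c * I u"
        using rearrangement_local_le[OF f True, of i] by (simp add: G_def SS_def I_def C_def c_def)
      then have "ennpowr (G u) q \<le> ennpowr (ennreal C * ?\<Sigma> + ennreal c * I u) q"
        using q by (intro ennpowr_mono) auto
      also have "\<dots> \<le> ennreal (2 powr q) * (ennpowr (ennreal C * ?\<Sigma>) q + ennpowr (ennreal c * I u) q)"
        using q by (intro ennpowr_add_le) auto
      also have "\<dots> = ennreal (2 powr q) * (ennreal (C powr q) * ennpowr ?\<Sigma> q) + ennreal (2 powr q * c powr q) * ennpowr (I u) q"
        using C by (simp add: ennpowr_mult distrib_left c_def ennreal_mult mult.assoc)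
      also have "\<dots> \<le> ennreal (2 powr q) * (ennreal (C powr q) * (ennreal (W powr q) * (\<Sum>k. ennreal (2 powr (\<beta> * q * real k)) * ennpowr (rearrangement SS (2 ^ k / 2 * u)) q)))
          + ennreal (2 powr q * c powr q) * ennpowr (I u) q"
        unfolding W_def using \<beta> q by (intro add_right_mono mult_left_mono ennpowr_suminf_le) auto
      also have "\<dots> = ennreal A * (\<Sum>k. ennreal (2 powr (\<beta> * q * real k)) * ennpowr (rearrangement SS (2 ^ k / 2 * u)) q)
          + ennreal (2 powr q * c powr q) * ennpowr (I u) q"
        by (simp add: A_def ennreal_mult mult.assoc)
      finally have le: "ennpowr (G u) q \<le> \<dots>" .
      let ?m = "ennreal ((u powr (1 / p)) powr q) * ennreal (1 / u)"
      have "?m * ennpowr (G u) q \<le> ?m * (ennreal A * (\<Sum>k. ennreal (2 powr (\<beta> * q * real k)) * ennpowr (rearrangement SS (2 ^ k / 2 * u)) q)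
          + ennreal (2 powr q * c powr q) * ennpowr (I u) q)"
        using le by (rule mult_left_mono) simp
      also have "\<dots> = ennreal A * (\<Sum>k. ?m * (ennreal (2 powr (\<beta> * q * real k)) * ennpowr (rearrangement SS (2 ^ k / 2 * u)) q))
          + ennreal (2 powr q * c powr q) * (?m * ennpowr (I u) q)"
        unfolding ennreal_suminf_cmult by (simp only: distrib_left mult.left_commute[of ?m])
      finally show ?thesis using True by (simp add: ennpowr_mult ac_simps)
    qed simp
    have "lorentz_integral p q (\<lambda>x. modulus f x * indicator ?Q x) = (\<integral>\<^sup>+u. ?w G u \<partial>lborel)"
      by (simp add: lorentz_integral_def G_def)
    also have "\<dots> \<le> (\<integral>\<^sup>+u. ennreal A * (\<Sum>k. ennreal (2 powr (\<beta> * q * real k)) * ?w (\<lambda>u. rearrangement SS (2 ^ k / 2 * u)) u)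
        + ennreal (2 powr q * c powr q) * ?w I u \<partial>lborel)"
      by (intro nn_integral_mono pt)
    also have "\<dots> = ennreal A * (\<Sum>k. ennreal (2 powr (\<beta> * q * real k)) * (\<integral>\<^sup>+u. ?w (\<lambda>u. rearrangement SS (2 ^ k / 2 * u)) u \<partial>lborel))
        + ennreal (2 powr q * c powr q) * (\<integral>\<^sup>+u. ?w I u \<partial>lborel)"
      by (simp add: nn_integral_add nn_integral_cmult nn_integral_suminf)
    also have "(\<integral>\<^sup>+u. ?w I u \<partial>lborel) = lorentz_integral p q (indicator ?Q)"
      by (simp add: lorentz_integral_def I_def)
    also have "(\<Sum>k. ennreal (2 powr (\<beta> * q * real k)) * (\<integral>\<^sup>+u. ?w (\<lambda>u. rearrangement SS (2 ^ k / 2 * u)) u \<partial>lborel))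
        = (\<Sum>k. ennreal (2 powr (q / p) * (2 powr (- (\<beta> * q))) ^ k) * lorentz_integral p q SS)"
    proof (rule arg_cong[where f = suminf], rule ext)
      fix k
      have "2 powr (\<beta> * q * real k) * (2 ^ k / 2) powr (- (q / p)) = 2 powr (q / p) * (2 powr (- (\<beta> * q))) ^ k"
      proof -
        have a: "(2::real) ^ k / 2 = 2 powr (real k - 1)" by (simp add: powr_diff powr_realpow)
        have b: "(2 powr (- (\<beta> * q))) ^ k = 2 powr (- (\<beta> * q) * real k)"
          by (subst powr_realpow[symmetric]) (auto simp: powr_powr)
        have c: "\<beta> * q * real k + (real k - 1) * (- (q / p)) = q / p + (- (\<beta> * q) * real k)"
          using p by (simp add: \<beta>_def field_simps)
        have "2 powr (\<beta> * q * real k) * (2 ^ k / 2) powr (- (q / p)) = 2 powr (\<beta> * q * real k + (real k - 1) * (- (q / p)))"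
          unfolding a by (simp only: powr_powr powr_add)
        then show ?thesis unfolding b c by (simp only: powr_add)
      qed
      then show "ennreal (2 powr (\<beta> * q * real k)) * (\<integral>\<^sup>+u. ?w (\<lambda>u. rearrangement SS (2 ^ k / 2 * u)) u \<partial>lborel)
          = ennreal (2 powr (q / p) * (2 powr (- (\<beta> * q))) ^ k) * lorentz_integral p q SS"
        by (subst lorentz_integral_dilation) (auto simp flip: mult.assoc ennreal_mult)
    qed
    also have "\<dots> = (\<Sum>k. ennreal (2 powr (q / p) * (2 powr (- (\<beta> * q))) ^ k)) * lorentz_integral p q SS"
      by simp
    also have "(\<Sum>k. ennreal (2 powr (q / p) * (2 powr (- (\<beta> * q))) ^ k)) = ennreal D"
    proof (rule suminf_ennreal_eq)
      show "(\<lambda>k. 2 powr (q / p) * (2 powr (- (\<beta> * q))) ^ k) sums D"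
        using sums_mult[OF geometric_sums[of "2 powr (- (\<beta> * q)) :: real"], of "2 powr (q / p)"] lt1 by (simp add: D_def)
    qed auto
    finally have main: "lorentz_integral p q (\<lambda>x. modulus f x * indicator ?Q x)
       \<le> ennreal A * (ennreal D * lorentz_integral p q SS) + ennreal (2 powr q * c powr q) * lorentz_integral p q (indicator ?Q)" .
    have "lorentz_norm_on p q ?Q (modulus f) \<le> ennpowr (ennreal (A * D) * lorentz_integral p q SS + ennreal (2 powr q * c powr q) * lorentz_integral p q (indicator ?Q)) (1 / q)"
      unfolding lorentz_norm_on_def lorentz_norm_eq using main A0 D0 q
      by (intro ennpowr_mono) (auto simp: ennreal_mult mult.assoc)
    also have "\<dots> \<le> ennreal (2 powr (1 / q)) * (ennpowr (ennreal (A * D) * lorentz_integral p q SS) (1 / q)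
        + ennpowr (ennreal (2 powr q * c powr q) * lorentz_integral p q (indicator ?Q)) (1 / q))"
      using q by (intro ennpowr_add_le) auto
    also have "\<dots> = ennreal (2 powr (1 / q)) * (ennreal ((A * D) powr (1 / q)) * lorentz_norm p q SS
        + ennreal (2 * c) * lorentz_norm p q (indicator ?Q))"
    proof -
      have "(2 powr q * c powr q) powr (1 / q) = 2 * c"
        using q by (simp add: powr_mult powr_powr c_def)
      then show ?thesis using A0 D0 by (simp add: ennpowr_mult lorentz_norm_eq)
    qed
    also have "\<dots> \<le> ennreal (2 powr (1 / q)) * (ennreal ((A * D) powr (1 / q)) * lorentz_norm p q SS
        + ennreal (2 * c) * ennreal (\<kappa> * ?v powr (1 / p)))"
      unfolding \<kappa>_def using p q by (intro mult_left_mono add_left_mono lorentz_norm_indicator_le) auto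
    also have "\<dots> \<le> ennreal K * lorentz_norm p q SS + ennreal K * ennreal (c * ?v powr (1 / p))"
    proof -
      have "2 powr (1 / q) * (A * D) powr (1 / q) \<le> K" "2 powr (1 / q) * (2 * \<kappa>) \<le> K"
        using \<kappa> by (auto simp: K_def intro!: mult_left_mono)
      then have "ennreal (2 powr (1 / q) * (A * D) powr (1 / q)) * lorentz_norm p q SS
          + ennreal (2 powr (1 / q) * (2 * \<kappa>)) * ennreal (c * ?v powr (1 / p))
          \<le> ennreal K * lorentz_norm p q SS + ennreal K * ennreal (c * ?v powr (1 / p))"
        by (intro add_mono mult_right_mono ennreal_leI) auto
      moreover have "ennreal (2 powr (1 / q)) * (ennreal (2 * c) * ennreal (\<kappa> * ?v powr (1 / p))) = ennreal (2 powr (1 / q) * (2 * \<kappa>)) * ennreal (c * ?v powr (1 / p))"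
        using \<kappa> by (simp add: c_def ac_simps flip: ennreal_mult)
      ultimately show ?thesis
        by (simp add: distrib_left ennreal_mult mult.assoc)
    qed
    finally show "lorentz_norm_on p q ?Q (modulus f)
        \<le> ennreal K * (lorentz_norm_on p q ?Q (sharp_maximal f) + ennreal (cmod (average f ?Q) * ?v powr (1 / p)))"
      by (simp add: distrib_left lorentz_norm_on_def SS_def c_def)
  qed
qed

subsection \<open>Averages along the chain of ancestors\<close>

text \<open>A finite telescope up to an ancestor of average below e. The series starts with the
  first ancestor, since each jump is paid by the oscillation over the larger cube.\<close>

lemma average_le_suminf_mean_osc:
  fixes f :: "real^'n \<Rightarrow> complex"
  assumes loc: "locally_integrable f"
    and decay: "\<And>i \<epsilon>. 0 < \<epsilon> \<Longrightarrow> \<exists>k. cmod (average f (dyadic_cube (ancestor k i))) < \<epsilon>"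
  shows "ennreal (cmod (average f (dyadic_cube i)))
    \<le> ennreal (2 ^ CARD('n)) * (\<Sum>k. mean_osc f (dyadic_cube (ancestor (Suc k) i)))"
proof (rule ennreal_le_epsilon)
  fix e :: real assume "0 < e"
  let ?c = "\<lambda>k. average f (dyadic_cube (ancestor k i))"
  let ?o = "\<lambda>k. mean_osc f (dyadic_cube (ancestor (Suc k) i))"
  let ?K = "ennreal (2 ^ CARD('n))"
  have tele: "ennreal (cmod (?c 0)) \<le> ?K * (\<Sum>k<m. ?o k) + ennreal (cmod (?c m))" for m
  proof (induction m)
    case (Suc m)
    have "ennreal (cmod (?c m)) \<le> ennreal (cmod (?c m - ?c (Suc m))) + ennreal (cmod (?c (Suc m)))"
      using norm_triangle_ineq[of "?c m - ?c (Suc m)" "?c (Suc m)"] by (simp flip: ennreal_plus)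
    also have "\<dots> \<le> ?K * ?o m + ennreal (cmod (?c (Suc m)))"
      using average_ancestor_diff_le[OF loc, of "ancestor m i"] by (intro add_right_mono) (simp add: ancestor_add)
    finally have "?K * (\<Sum>k<m. ?o k) + ennreal (cmod (?c m)) \<le> ?K * (\<Sum>k<m. ?o k) + (?K * ?o m + ennreal (cmod (?c (Suc m))))"
      by (rule add_left_mono)
    from order_trans[OF Suc.IH this] show ?case
      by (simp only: sum.lessThan_Suc distrib_left add.assoc)
  qed simp
  obtain m where m: "cmod (?c m) < e" using decay[OF \<open>0 < e\<close>] by blast
  have "ennreal (cmod (?c 0)) \<le> ?K * (\<Sum>k<m. ?o k) + ennreal (cmod (?c m))" by (rule tele)
  also have "\<dots> \<le> ?K * (\<Sum>k. ?o k) + ennreal e"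
    using m by (intro add_mono mult_left_mono sum_le_suminf ennreal_leI) auto
  finally show "ennreal (cmod (average f (dyadic_cube i))) \<le> ?K * (\<Sum>k. ?o k) + ennreal e" by simp
qed

lemma measure_dyadic_cube_ancestor:
  "measure lebesgue (dyadic_cube (ancestor k (i :: int \<times> (int^'n)))) = 2 ^ (k * CARD('n)) * measure lebesgue (dyadic_cube i)"
proof -
  have "ennreal (measure lebesgue (dyadic_cube (ancestor k i))) = ennreal (2 ^ (k * CARD('n)) * measure lebesgue (dyadic_cube i))"
    using emeasure_dyadic_cube_ancestor[of k i] unfolding emeasure_dyadic_cube' by (simp add: ennreal_mult)
  then show ?thesis by (subst (asm) ennreal_inj) auto
qed

text \<open>The contribution of one cube: the Bourgain-Morrey-Lorentz norm is the l^r norm of this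
  family.\<close>

definition scaled_norm :: "real \<Rightarrow> real \<Rightarrow> real \<Rightarrow> (real^'n \<Rightarrow> ennreal) \<Rightarrow> int \<times> (int^'n) \<Rightarrow> ennreal" where
  "scaled_norm p q t F i = ennreal (measure lebesgue (dyadic_cube i) powr (1 / t - 1 / p)) * lorentz_norm_on p q (dyadic_cube i) F"

text \<open>The sharp maximal function is at least the mean oscillation throughout an ancestor, so
  its Lorentz norm there controls that oscillation. Changing the normalisation from the cube to its
  k-th ancestor yields the factor 2^(-nk/t). The constant is uniform in f, t and the cube.\<close>

lemma scaled_norm_le_ancestors:
  assumes p: "0 < p" and q: "0 < q"
  obtains K where "0 < K"
    "\<And>(f :: real^'n \<Rightarrow> complex) t i. f \<in> borel_measurable lebesgue \<Longrightarrow> locally_integrable f \<Longrightarrow>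
      (\<And>i \<epsilon>. 0 < \<epsilon> \<Longrightarrow> \<exists>k. cmod (average f (dyadic_cube (ancestor k i))) < \<epsilon>) \<Longrightarrow>
      scaled_norm p q t (modulus f) i
        \<le> ennreal K * (\<Sum>k. ennreal (2 powr (- (real CARD('n) / t * real k))) * scaled_norm p q t (sharp_maximal f) (ancestor k i))"
proof -
  obtain K where K: "0 < K"
    "\<And>(f :: real^'n \<Rightarrow> complex) i. f \<in> borel_measurable lebesgue \<Longrightarrow> locally_integrable f \<Longrightarrow>
      lorentz_norm_on p q (dyadic_cube i) (modulus f)
        \<le> ennreal K * (lorentz_norm_on p q (dyadic_cube i) (sharp_maximal f)
            + ennreal (cmod (average f (dyadic_cube i)) * measure lebesgue (dyadic_cube i) powr (1 / p)))"
    using local_Fefferman_Stein[OF p q] by blast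
  define \<kappa> where "\<kappa> = (p / q) powr (1 / q)"
  have \<kappa>: "0 < \<kappa>" using p q by (simp add: \<kappa>_def)
  \<comment> \<open>One constant for the k = 0 term, which comes from the local inequality, and for
    the later terms, which come from the averages; the two parts then form a single series.\<close>
  define M where "M = max 1 (2 ^ CARD('n) / \<kappa>)"
  have M: "1 \<le> M" "2 ^ CARD('n) / \<kappa> \<le> M" "0 < K * M" using K by (auto simp: M_def less_max_iff_disj)
  show thesis
  proof (rule that[OF M(3)])
    fix f :: "real^'n \<Rightarrow> complex" and t :: real and i :: "int \<times> (int^'n)"
    assume f: "f \<in> borel_measurable lebesgue" "locally_integrable f"
      and decay: "\<And>i \<epsilon>. 0 < \<epsilon> \<Longrightarrow> \<exists>k. cmod (average f (dyadic_cube (ancestor k i))) < \<epsilon>"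
    let ?d = "real CARD('n)"
    define v where "v k = measure lebesgue (dyadic_cube (ancestor k i))" for k
    have v0: "0 < v k" for k by (simp add: v_def measure_dyadic_cube_pos)
    have vk: "v k = 2 powr (?d * real k) * v 0" for k
      by (simp add: v_def measure_dyadic_cube_ancestor powr_realpow[symmetric] mult.commute)
    define L where "L k = lorentz_norm_on p q (dyadic_cube (ancestor k i)) (sharp_maximal f)" for k
    define x where "x k = ennreal (2 powr (- (?d / t * real k))) * scaled_norm p q t (sharp_maximal f) (ancestor k i)" for k
    \<comment> \<open>The factor 2^(-nk/t) turns the power 1/t of the volume of the ancestor into
      that of the original cube.\<close>
    have x_eq: "x k = ennreal (v 0 powr (1 / t) * v k powr (- (1 / p))) * L k" for k
    proof -
      have "2 powr (- (?d / t * real k)) * v k powr (1 / t) = v 0 powr (1 / t)"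
        using v0[of 0] by (subst vk) (simp add: powr_mult powr_powr flip: mult.assoc powr_add)
      then have "2 powr (- (?d / t * real k)) * v k powr (1 / t - 1 / p) = v 0 powr (1 / t) * v k powr (- (1 / p))"
        using v0[of k] by (simp add: powr_diff powr_minus divide_inverse flip: mult.assoc)
      then have "ennreal (2 powr (- (?d / t * real k))) * ennreal (v k powr (1 / t - 1 / p)) = ennreal (v 0 powr (1 / t) * v k powr (- (1 / p)))"
        by (simp flip: ennreal_mult)
      then show ?thesis by (simp add: x_def scaled_norm_def L_def v_def flip: mult.assoc)
    qed
    have osc: "ennreal (v 0 powr (1 / t)) * mean_osc f (dyadic_cube (ancestor k i)) \<le> ennreal (1 / \<kappa>) * x k" for k
    proof -
      let ?o = "mean_osc f (dyadic_cube (ancestor k i))"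
      have "?o * ennreal (\<kappa> * v k powr (1 / p)) \<le> L k"
        unfolding \<kappa>_def v_def L_def lorentz_norm_on_def using p q f mean_osc_le_sharp_maximal[OF f(1)] sharp_maximal_measurable[OF f(2)]
        by (intro lorentz_norm_ge) auto
      then have le: "ennreal (1 / \<kappa> * (v 0 powr (1 / t) * v k powr (- (1 / p)))) * (?o * ennreal (\<kappa> * v k powr (1 / p)))
          \<le> ennreal (1 / \<kappa> * (v 0 powr (1 / t) * v k powr (- (1 / p)))) * L k"
        by (rule mult_left_mono) simp
      have "ennreal (1 / \<kappa> * (v 0 powr (1 / t) * v k powr (- (1 / p)))) * ennreal (\<kappa> * v k powr (1 / p)) = ennreal (v 0 powr (1 / t))"
        using \<kappa> v0[of k] by (simp add: powr_minus field_simps flip: ennreal_mult)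
      then have e: "ennreal (1 / \<kappa> * (v 0 powr (1 / t) * v k powr (- (1 / p)))) * (?o * ennreal (\<kappa> * v k powr (1 / p)))
          = ennreal (v 0 powr (1 / t)) * ?o"
        by (subst mult.commute[of ?o]) (simp only: mult.assoc[symmetric])
      have "ennreal (1 / \<kappa> * (v 0 powr (1 / t) * v k powr (- (1 / p)))) = ennreal (1 / \<kappa>) * ennreal (v 0 powr (1 / t) * v k powr (- (1 / p)))"
        using \<kappa> by (intro ennreal_mult) auto
      then show ?thesis using le unfolding e x_eq by (simp only: mult.assoc)
    qed
    have avg: "ennreal (v 0 powr (1 / t)) * ennreal (cmod (average f (dyadic_cube i))) \<le> ennreal M * (\<Sum>k. x (Suc k))"
    proof -
      have "ennreal (v 0 powr (1 / t)) * ennreal (cmod (average f (dyadic_cube i)))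
          \<le> ennreal (v 0 powr (1 / t)) * (ennreal (2 ^ CARD('n)) * (\<Sum>k. mean_osc f (dyadic_cube (ancestor (Suc k) i))))"
        using f decay by (intro mult_left_mono average_le_suminf_mean_osc) auto
      also have "\<dots> = ennreal (2 ^ CARD('n)) * (\<Sum>k. ennreal (v 0 powr (1 / t)) * mean_osc f (dyadic_cube (ancestor (Suc k) i)))"
        by (simp only: mult.left_commute ennreal_suminf_cmult)
      also have "\<dots> \<le> ennreal (2 ^ CARD('n)) * (\<Sum>k. ennreal (1 / \<kappa>) * x (Suc k))"
        by (intro mult_left_mono suminf_le osc) auto
      also have "\<dots> = ennreal (2 ^ CARD('n) / \<kappa>) * (\<Sum>k. x (Suc k))"
        using \<kappa> by (simp flip: mult.assoc ennreal_mult)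
      also have "\<dots> \<le> ennreal M * (\<Sum>k. x (Suc k))"
        using M by (intro mult_right_mono ennreal_leI) auto
      finally show ?thesis .
    qed
    have "scaled_norm p q t (modulus f) i
        \<le> ennreal (v 0 powr (1 / t - 1 / p)) * (ennreal K * (L 0 + ennreal (cmod (average f (dyadic_cube i)) * v 0 powr (1 / p))))"
      unfolding scaled_norm_def using K(2)[OF f, of i] by (simp add: v_def L_def mult_left_mono)
    also have "\<dots> = ennreal K * (x 0 + ennreal (v 0 powr (1 / t)) * ennreal (cmod (average f (dyadic_cube i))))"
    proof -
      have "ennreal (v 0 powr (1 / t - 1 / p)) * ennreal (cmod (average f (dyadic_cube i)) * v 0 powr (1 / p))
          = ennreal (v 0 powr (1 / t)) * ennreal (cmod (average f (dyadic_cube i)))"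
        using v0[of 0] by (simp add: powr_diff field_simps flip: ennreal_mult)
      moreover have "ennreal (v 0 powr (1 / t - 1 / p)) * L 0 = x 0"
        using v0[of 0] by (simp add: x_eq powr_diff powr_minus divide_inverse)
      ultimately show ?thesis by (simp add: distrib_left mult.left_commute)
    qed
    also have "\<dots> \<le> ennreal K * (ennreal M * x 0 + ennreal M * (\<Sum>k. x (Suc k)))"
    proof -
      have "x 0 \<le> ennreal M * x 0"
        using mult_right_mono[OF ennreal_leI[OF M(1)], of "x 0"] by simp
      then show ?thesis by (intro mult_left_mono add_mono avg) auto
    qed
    also have "\<dots> = ennreal (K * M) * (x 0 + (\<Sum>k. x (Suc k)))"
      using K M by (simp add: distrib_left ennreal_mult mult.assoc)
    also have "x 0 + (\<Sum>k. x (Suc k)) = (\<Sum>k. x k)"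
      using suminf_offset[of x 1] by (simp add: add.commute)
    finally show "scaled_norm p q t (modulus f) i
        \<le> ennreal (K * M) * (\<Sum>k. ennreal (2 powr (- (?d / t * real k))) * scaled_norm p q t (sharp_maximal f) (ancestor k i))"
      by (simp add: x_def)
  qed
qed

subsection \<open>Sums over dyadic cubes\<close>

text \<open>As integrals, sums over cubes admit monotone convergence, Tonelli and Hoelder.\<close>

lemma infsum_eq_nn_integral_count_space:
  fixes \<phi> :: "'a::countable \<Rightarrow> ennreal"
  shows "infsum \<phi> UNIV = (\<integral>\<^sup>+i. \<phi> i \<partial>count_space UNIV)"
proof (rule antisym)
  have inf: "infsum \<phi> UNIV = (SUP F\<in>{F. finite F \<and> F \<subseteq> UNIV}. sum \<phi> F)"
    by (rule nonneg_infsum_complete) simp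
  show "infsum \<phi> UNIV \<le> (\<integral>\<^sup>+i. \<phi> i \<partial>count_space UNIV)"
    unfolding inf
  proof (rule SUP_least)
    fix F :: "'a set" assume "F \<in> {F. finite F \<and> F \<subseteq> UNIV}"
    then have "sum \<phi> F = (\<integral>\<^sup>+i. \<phi> i * indicator F i \<partial>count_space UNIV)"
      by (simp add: nn_integral_count_space_finite flip: nn_integral_count_space_indicator)
    also have "\<dots> \<le> (\<integral>\<^sup>+i. \<phi> i \<partial>count_space UNIV)"
      by (intro nn_integral_mono) (simp add: indicator_def)
    finally show "sum \<phi> F \<le> (\<integral>\<^sup>+i. \<phi> i \<partial>count_space UNIV)" .
  qed
  define A where "A n = {i::'a. to_nat i < n}" for n
  have fin: "finite (A n)" for n
    by (rule finite_subset[OF _ finite_imageI[of "{..<n}" from_nat]])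
      (auto simp: A_def intro!: image_eqI[of _ _ "to_nat _"])
  have "\<phi> i = (SUP n. \<phi> i * indicator (A n) i)" for i
  proof (rule antisym)
    show "\<phi> i \<le> (SUP n. \<phi> i * indicator (A n) i)"
      by (rule SUP_upper2[of "Suc (to_nat i)"]) (auto simp: A_def)
    show "(SUP n. \<phi> i * indicator (A n) i) \<le> \<phi> i"
      by (intro SUP_least) (simp add: indicator_def)
  qed
  then have "(\<integral>\<^sup>+i. \<phi> i \<partial>count_space UNIV) = (\<integral>\<^sup>+i. (SUP n. \<phi> i * indicator (A n) i) \<partial>count_space UNIV)"
    by simp
  also have "\<dots> = (SUP n. \<integral>\<^sup>+i. \<phi> i * indicator (A n) i \<partial>count_space UNIV)"
    by (intro nn_integral_monotone_convergence_SUP) (auto simp: incseq_def le_fun_def A_def indicator_def)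
  also have "\<dots> = (SUP n. sum \<phi> (A n))"
    using fin by (simp add: nn_integral_count_space_finite flip: nn_integral_count_space_indicator)
  also have "\<dots> \<le> infsum \<phi> UNIV"
    unfolding inf using fin by (intro SUP_least SUP_upper) auto
  finally show "(\<integral>\<^sup>+i. \<phi> i \<partial>count_space UNIV) \<le> infsum \<phi> UNIV" .
qed

lemma infsum_dyadic_cubes:
  "(\<Sum>\<^sub>\<infinity>Q\<in>dyadic_cubes. \<phi> Q) = (\<integral>\<^sup>+i. \<phi> (dyadic_cube (i :: int \<times> (int^'n))) \<partial>count_space UNIV)"
  unfolding dyadic_cubes_def
  by (subst infsum_reindex[OF inj_dyadic_cube]) (simp add: infsum_eq_nn_integral_count_space comp_def)

text \<open>Counting by volume: the descendants are disjoint, lie in the cube and each has 2^(-nk)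
  of its volume.\<close>

lemma emeasure_children:
  fixes j :: "int \<times> (int^'n)"
  shows "emeasure (count_space UNIV) {i. ancestor k i = j} \<le> ennreal (2 ^ (k * CARD('n)))"
proof -
  let ?I = "{i. ancestor k i = j}"
  define w where "w = emeasure lebesgue (dyadic_cube j) / ennreal (2 ^ (k * CARD('n)))"
  have w: "emeasure lebesgue (dyadic_cube j) = ennreal (2 ^ (k * CARD('n))) * w"
    unfolding w_def by (subst ennreal_times_divide) (simp add: ennreal_mult_divide_eq mult.commute)
  have "w \<noteq> 0" "w \<noteq> top"
    using emeasure_dyadic_cube_pos[of j] emeasure_dyadic_cube_finite[of j]
    unfolding w by (auto simp: ennreal_mult_top)
  have vol: "emeasure lebesgue (dyadic_cube i) = w" if "i \<in> ?I" for i
  proof -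
    have "ennreal (2 ^ (k * CARD('n))) * emeasure lebesgue (dyadic_cube i) = ennreal (2 ^ (k * CARD('n))) * w"
      using that emeasure_dyadic_cube_ancestor[of k i] w by simp
    then show ?thesis by (simp add: ennreal_mult_cancel_left)
  qed
  have "disjoint_family_on dyadic_cube ?I"
    unfolding disjoint_family_on_def
  proof (intro ballI impI, rule ccontr)
    fix a b assume *: "a \<in> ?I" "b \<in> ?I" "a \<noteq> b" "dyadic_cube a \<inter> dyadic_cube b \<noteq> {}"
    then have "fst a = fst b" using fst_ancestor[of k a] fst_ancestor[of k b] by simp
    then show False using * by (metis disjoint_iff mem_dyadic_cube_iff)
  qed
  then have "(\<integral>\<^sup>+i. emeasure lebesgue (dyadic_cube i) \<partial>count_space ?I) = emeasure lebesgue (\<Union>i\<in>?I. dyadic_cube i)"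
    by (rule emeasure_UN_dyadic[symmetric])
  also have "\<dots> \<le> emeasure lebesgue (dyadic_cube j)"
    using dyadic_cube_subset_ancestor[of _ k] by (intro emeasure_mono) auto
  finally have "(\<integral>\<^sup>+i. emeasure lebesgue (dyadic_cube i) \<partial>count_space ?I) \<le> ennreal (2 ^ (k * CARD('n))) * w"
    by (simp add: w)
  moreover have "(\<integral>\<^sup>+i. emeasure lebesgue (dyadic_cube i) \<partial>count_space ?I) = (\<integral>\<^sup>+i. w \<partial>count_space ?I)"
    using vol by (intro nn_integral_cong) auto
  ultimately have "w * emeasure (count_space ?I) ?I \<le> w * ennreal (2 ^ (k * CARD('n)))"
    by (simp add: mult.commute)
  then have "emeasure (count_space ?I) ?I \<le> ennreal (2 ^ (k * CARD('n)))"
    using \<open>w \<noteq> 0\<close> \<open>w \<noteq> top\<close> by (simp add: ennreal_mult_le_mult_iff)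
  then show ?thesis by (simp add: emeasure_count_space)
qed

text \<open>Group the indices by their k-th ancestor and bound the size of each group.\<close>

lemma nn_integral_ancestor_le:
  fixes \<phi> :: "int \<times> (int^'n) \<Rightarrow> ennreal"
  shows "(\<integral>\<^sup>+i. \<phi> (ancestor k i) \<partial>count_space UNIV) \<le> ennreal (2 ^ (k * CARD('n))) * (\<integral>\<^sup>+i. \<phi> i \<partial>count_space UNIV)"
proof -
  have "\<phi> (ancestor k i) = (\<integral>\<^sup>+j. \<phi> j * indicator {i. ancestor k i = j} i \<partial>count_space UNIV)" for i
  proof -
    have "(\<integral>\<^sup>+j. \<phi> j * indicator {i. ancestor k i = j} i \<partial>count_space UNIV) = (\<integral>\<^sup>+j. \<phi> j * indicator {ancestor k i} j \<partial>count_space UNIV)"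
      by (intro nn_integral_cong) (auto simp: indicator_def)
    also have "\<dots> = \<phi> (ancestor k i)"
      by (simp add: nn_integral_count_space_finite flip: nn_integral_count_space_indicator)
    finally show ?thesis by simp
  qed
  then have "(\<integral>\<^sup>+i. \<phi> (ancestor k i) \<partial>count_space UNIV)
      = (\<integral>\<^sup>+i. (\<integral>\<^sup>+j. \<phi> j * indicator {i. ancestor k i = j} i \<partial>count_space UNIV) \<partial>count_space UNIV)"
    by simp
  also have "\<dots> = (\<integral>\<^sup>+j. (\<integral>\<^sup>+i. \<phi> j * indicator {i. ancestor k i = j} i \<partial>count_space UNIV) \<partial>count_space UNIV)"
    by (intro nn_integral_count_space_nn_integral) auto
  also have "\<dots> = (\<integral>\<^sup>+j. \<phi> j * emeasure (count_space UNIV) {i. ancestor k i = j} \<partial>count_space UNIV)"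
    by (intro nn_integral_cong nn_integral_cmult_indicator) auto
  also have "\<dots> \<le> (\<integral>\<^sup>+j. \<phi> j * ennreal (2 ^ (k * CARD('n))) \<partial>count_space UNIV)"
    by (intro nn_integral_mono mult_left_mono emeasure_children) auto
  also have "\<dots> = ennreal (2 ^ (k * CARD('n))) * (\<integral>\<^sup>+i. \<phi> i \<partial>count_space UNIV)"
    by (simp add: nn_integral_multc mult.commute)
  finally show ?thesis .
qed

subsection \<open>Bourgain-Morrey-Lorentz norms\<close>

lemma bml_norm_infinity: "bml_norm p q t \<infinity> F = (SUP i. scaled_norm p q t F i)"
  by (simp add: bml_norm_def scaled_norm_def dyadic_cubes_def image_image)

lemma bml_norm_finite:
  "bml_norm p q t (ereal \<rho>) F = ennpowr (\<integral>\<^sup>+i. ennpowr (scaled_norm p q t F i) \<rho> \<partial>count_space UNIV) (1 / \<rho>)"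
  by (simp add: bml_norm_def infsum_dyadic_cubes scaled_norm_def ennpowr_mult powr_powr left_diff_distrib)

lemma scaled_norm_le_bml_norm:
  assumes "0 < r"
  shows "scaled_norm p q t F i \<le> bml_norm p q t r F"
proof (cases r)
  case (real \<rho>)
  then have \<rho>: "0 < \<rho>" using assms by simp
  have "ennpowr (scaled_norm p q t F i) \<rho> = (\<integral>\<^sup>+j. ennpowr (scaled_norm p q t F j) \<rho> * indicator {i} j \<partial>count_space UNIV)"
    by (simp add: nn_integral_count_space_finite flip: nn_integral_count_space_indicator)
  also have "\<dots> \<le> (\<integral>\<^sup>+j. ennpowr (scaled_norm p q t F j) \<rho> \<partial>count_space UNIV)"
    by (intro nn_integral_mono) (simp add: indicator_def)
  finally have "ennpowr (ennpowr (scaled_norm p q t F i) \<rho>) (1 / \<rho>) \<le> bml_norm p q t r F"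
    unfolding real bml_norm_finite using \<rho> by (intro ennpowr_mono) auto
  then show ?thesis using \<rho> by (simp add: ennpowr_inverse_cancel)
next
  case PInf
  then show ?thesis unfolding PInf bml_norm_infinity by (intro SUP_upper) auto
qed (use assms in auto)

section \<open>Local integrability and decay of averages for functions of finite norm\<close>

lemma conj_exp_props:
  assumes "1 < s"
  shows "1 < conj_exp (ereal s)" "1 / s + 1 / conj_exp (ereal s) = 1"
  using assms by (auto simp: conj_exp_def field_simps)

text \<open>Lorentz-Hoelder against the indicator of the cube, whose conjugate norm is a constant
  times |Q|^(1/p').\<close>

lemma nn_set_integral_le_lorentz:
  fixes f :: "real^'n \<Rightarrow> complex"
  assumes pq: "1 < p" "1 < q" and [measurable]: "f \<in> borel_measurable lebesgue"
  obtains \<kappa> where "0 < \<kappa>" 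
    "\<And>i. (\<integral>\<^sup>+x\<in>dyadic_cube i. ennreal (cmod (f x)) \<partial>lebesgue)
      \<le> lorentz_norm_on p q (dyadic_cube i) (modulus f) * ennreal (\<kappa> * measure lebesgue (dyadic_cube i) powr (1 - 1 / p))"
proof -
  define p' where "p' = conj_exp (ereal p)"
  define q' where "q' = conj_exp (ereal q)"
  have p': "1 < p'" "1 / p + 1 / p' = 1" and q': "1 < q'" "1 / q + 1 / q' = 1"
    using conj_exp_props pq by (auto simp: p'_def q'_def)
  define \<kappa> where "\<kappa> = (p' / q') powr (1 / q')"
  show thesis
  proof (rule that)
    show "0 < \<kappa>" using p' q' by (simp add: \<kappa>_def)
    fix i :: "int \<times> (int^'n)"
    let ?Q = "dyadic_cube i"
    have m: "(\<lambda>x. modulus f x * indicator ?Q x) \<in> borel_measurable lebesgue" unfolding modulus_def by measurable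
    have "(\<integral>\<^sup>+x\<in>?Q. ennreal (cmod (f x)) \<partial>lebesgue) = (\<integral>\<^sup>+x. (modulus f x * indicator ?Q x) * indicator ?Q x \<partial>lebesgue)"
      by (intro nn_integral_cong) (auto simp: modulus_def indicator_def)
    also have "\<dots> \<le> lorentz_norm p q (\<lambda>x. modulus f x * indicator ?Q x) * lorentz_norm p' q' (indicator ?Q)"
      using p' q' pq m by (intro lorentz_Hoelder) auto
    also have "\<dots> \<le> lorentz_norm p q (\<lambda>x. modulus f x * indicator ?Q x) * ennreal (\<kappa> * measure lebesgue ?Q powr (1 / p'))"
      unfolding \<kappa>_def using p' q' by (intro mult_left_mono lorentz_norm_indicator_le) auto
    also have "1 / p' = 1 - 1 / p" using p' by simp
    finally show "(\<integral>\<^sup>+x\<in>?Q. ennreal (cmod (f x)) \<partial>lebesgue)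
      \<le> lorentz_norm_on p q ?Q (modulus f) * ennreal (\<kappa> * measure lebesgue ?Q powr (1 - 1 / p))"
      by (simp add: lorentz_norm_on_def)
  qed
qed

context
  fixes p q t :: real and r :: ereal and f :: "real^'n \<Rightarrow> complex"
  assumes p: "1 < p" and q: "1 < q" and t: "0 < t" and r: "0 < r" and f: "f \<in> bml_space p q t r"
begin

lemma bml_measurable [measurable]: "f \<in> borel_measurable lebesgue"
  using f by (simp add: bml_space_def)

text \<open>Each cube contributes at most the full norm of f, so the exponent 1 - 1/p becomes 1 -
  1/t. Averages are therefore of order |Q|^(-1/t), which is the source of their decay.\<close>

lemma bml_dyadic_L1:
  obtains N where "0 \<le> N" "\<And>i. (\<integral>\<^sup>+x\<in>dyadic_cube i. ennreal (cmod (f x)) \<partial>lebesgue)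
    \<le> ennreal (N * measure lebesgue (dyadic_cube i) powr (1 - 1 / t))"
proof -
  obtain \<kappa> where \<kappa>: "0 < \<kappa>" "\<And>i. (\<integral>\<^sup>+x\<in>dyadic_cube i. ennreal (cmod (f x)) \<partial>lebesgue)
      \<le> lorentz_norm_on p q (dyadic_cube i) (modulus f) * ennreal (\<kappa> * measure lebesgue (dyadic_cube i) powr (1 - 1 / p))"
    using nn_set_integral_le_lorentz[OF p q bml_measurable] by blast
  have "bml_norm p q t r (modulus f) < \<infinity>" using f by (simp add: bml_space_def)
  then obtain B where B: "bml_norm p q t r (modulus f) = ennreal B" "0 \<le> B"
    by (cases "bml_norm p q t r (modulus f)") auto
  show thesis
  proof (rule that)
    show "0 \<le> B * \<kappa>" using B \<kappa> by simp
    fix i :: "int \<times> (int^'n)"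
    let ?v = "measure lebesgue (dyadic_cube i)" and ?L = "lorentz_norm_on p q (dyadic_cube i) (modulus f)"
    have v: "0 < ?v" by (rule measure_dyadic_cube_pos)
    have "?L * ennreal (\<kappa> * ?v powr (1 - 1 / p)) = ennreal (\<kappa> * ?v powr (1 - 1 / t)) * scaled_norm p q t (modulus f) i"
    proof -
      have "\<kappa> * ?v powr (1 - 1 / p) = \<kappa> * ?v powr (1 - 1 / t) * ?v powr (1 / t - 1 / p)"
        by (simp flip: powr_add)
      then have "ennreal (\<kappa> * ?v powr (1 - 1 / p)) = ennreal (\<kappa> * ?v powr (1 - 1 / t)) * ennreal (?v powr (1 / t - 1 / p))"
        using \<kappa> by (simp flip: ennreal_mult)
      then show ?thesis by (simp add: scaled_norm_def ac_simps)
    qed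
    also have "\<dots> \<le> ennreal (\<kappa> * ?v powr (1 - 1 / t)) * ennreal B"
      using scaled_norm_le_bml_norm[OF r, of p q t "modulus f" i] B by (intro mult_left_mono) auto
    also have "\<dots> = ennreal (B * \<kappa> * ?v powr (1 - 1 / t))"
      using \<kappa> B by (simp add: ac_simps flip: ennreal_mult)
    finally show "(\<integral>\<^sup>+x\<in>dyadic_cube i. ennreal (cmod (f x)) \<partial>lebesgue) \<le> ennreal (B * \<kappa> * ?v powr (1 - 1 / t))"
      using \<kappa>(2)[of i] by (rule order_trans[rotated])
  qed
qed

lemma bml_integrable_dyadic: "set_integrable lebesgue (dyadic_cube i) f"
proof -
  obtain N where "(\<integral>\<^sup>+x\<in>dyadic_cube i. ennreal (cmod (f x)) \<partial>lebesgue) \<le> ennreal N"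
    using bml_dyadic_L1 by metis
  then have "(\<integral>\<^sup>+x\<in>dyadic_cube i. ennreal (cmod (f x)) \<partial>lebesgue) < \<infinity>"
    by (rule le_less_trans) simp
  moreover have "(\<integral>\<^sup>+x. norm (indicator (dyadic_cube i) x *\<^sub>R f x) \<partial>lebesgue) = (\<integral>\<^sup>+x\<in>dyadic_cube i. ennreal (cmod (f x)) \<partial>lebesgue)"
    by (intro nn_integral_cong) (auto simp: indicator_def)
  ultimately show ?thesis
    unfolding set_integrable_def by (intro integrableI_bounded) auto
qed

text \<open>An arbitrary cube may meet several orthants, so it is covered by finitely many large
  dyadic cubes, one for each sign pattern.\<close>

lemma bml_locally_integrable: "locally_integrable f"
  unfolding locally_integrable_def
proof (intro allI)
  fix a :: "real^'n" and l :: real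
  have "bounded (cube a l)" by (simp add: cube_def)
  then obtain B where B: "\<And>x. x \<in> cube a l \<Longrightarrow> norm x \<le> B" unfolding bounded_iff by blast
  obtain N where N: "B < 2 ^ N" using real_arch_pow[of 2 B] by auto
  have "cube a l \<subseteq> (\<Union>e. dyadic_cube (orthant_index e N))"
    using mem_orthant_cube[of _ N] le_less_trans[OF B N] by blast
  moreover have "set_integrable lebesgue (\<Union>e. dyadic_cube (orthant_index e N)) f"
    by (intro set_integrable_UN bml_integrable_dyadic) auto
  ultimately show "set_integrable lebesgue (cube a l) f"
    by (rule set_integrable_subset[rotated 2]) simp
qed

text \<open>The average over a cube is at most N |Q|^(-1/t), and the volumes of the ancestors are
  unbounded.\<close>

lemma bml_average_decay:
  assumes "0 < \<epsilon>"
  shows "\<exists>k. cmod (average f (dyadic_cube (ancestor k i))) < \<epsilon>"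
proof -
  obtain N where N: "0 \<le> N" "\<And>i. (\<integral>\<^sup>+x\<in>dyadic_cube i. ennreal (cmod (f x)) \<partial>lebesgue)
    \<le> ennreal (N * measure lebesgue (dyadic_cube i) powr (1 - 1 / t))"
    using bml_dyadic_L1 by blast
  have avg: "cmod (average f (dyadic_cube j)) * measure lebesgue (dyadic_cube j) powr (1 / t) \<le> N" for j
  proof -
    let ?v = "measure lebesgue (dyadic_cube j)"
    have v: "0 < ?v" by (rule measure_dyadic_cube_pos)
    have "ennreal (cmod (average f (dyadic_cube j) - 0)) * emeasure lebesgue (dyadic_cube j) \<le> (\<integral>\<^sup>+x\<in>dyadic_cube j. ennreal (cmod (f x - 0)) \<partial>lebesgue)"
      by (intro average_diff_le bml_integrable_dyadic sets_dyadic_cube emeasure_dyadic_cube_pos emeasure_dyadic_cube_finite)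
    then have "ennreal (cmod (average f (dyadic_cube j)) * ?v) \<le> ennreal (N * ?v powr (1 - 1 / t))"
      using order_trans[OF _ N(2)[of j]] by (simp add: emeasure_dyadic_cube' ennreal_mult)
    then have "cmod (average f (dyadic_cube j)) * ?v \<le> N * ?v powr (1 - 1 / t)"
      using N(1) by (subst (asm) ennreal_le_iff) auto
    then show ?thesis using v by (simp add: powr_diff field_simps)
  qed
  define v0 where "v0 = measure lebesgue (dyadic_cube i)"
  have v0: "0 < v0" by (simp add: v0_def measure_dyadic_cube_pos)
  obtain k where k: "(N / \<epsilon>) powr t / v0 < 2 ^ k" using real_arch_pow[of 2] by auto
  let ?v = "measure lebesgue (dyadic_cube (ancestor k i))"
  have "(2::real) ^ k \<le> 2 ^ (k * CARD('n))" by (intro power_increasing) auto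
  then have "2 ^ k * v0 \<le> ?v" using v0 by (simp add: measure_dyadic_cube_ancestor v0_def)
  moreover have "(N / \<epsilon>) powr t < 2 ^ k * v0" using k v0 by (simp add: field_simps)
  ultimately have "((N / \<epsilon>) powr t) powr (1 / t) < ?v powr (1 / t)"
    using t by (intro powr_less_mono2) auto
  then have "N / \<epsilon> < ?v powr (1 / t)" using t N(1) assms by (simp add: powr_powr)
  then have "N < \<epsilon> * ?v powr (1 / t)" using assms by (simp add: field_simps)
  then have "cmod (average f (dyadic_cube (ancestor k i))) * ?v powr (1 / t) < \<epsilon> * ?v powr (1 / t)"
    using avg[of "ancestor k i"] by linarith
  then have "cmod (average f (dyadic_cube (ancestor k i))) < \<epsilon>"
    by (rule mult_right_less_imp_less) simp
  then show ?thesis by blast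
qed

end

text \<open>Take the l^r norm over all cubes of the bound by ancestors. For r infinite the factors
  2^(-nk/t) sum directly; for r finite each ancestor is counted 2^(nk) times, and the weighted power
  estimate is needed.\<close>

lemma bml_norm_le_sharp:
  assumes p: "1 < p" and q: "1 < q" and t: "0 < t" and r: "ereal t < r"
  obtains C where "0 < C"
    "\<And>f :: real^'n \<Rightarrow> complex. f \<in> bml_space p q t r \<Longrightarrow>
       bml_norm p q t r (modulus f) \<le> ennreal C * bml_norm p q t r (sharp_maximal f)"
proof -
  let ?d = "real CARD('n)"
  have r0: "0 < r" using t by (intro less_trans[OF _ r]) simp
  have pq0: "0 < p" "0 < q" using p q by auto
  obtain K where K: "0 < K" "\<And>(f :: real^'n \<Rightarrow> complex) t i. f \<in> borel_measurable lebesgue \<Longrightarrow> locally_integrable f \<Longrightarrow>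
      (\<And>i \<epsilon>. 0 < \<epsilon> \<Longrightarrow> \<exists>k. cmod (average f (dyadic_cube (ancestor k i))) < \<epsilon>) \<Longrightarrow>
      scaled_norm p q t (modulus f) i
        \<le> ennreal K * (\<Sum>k. ennreal (2 powr (- (?d / t * real k))) * scaled_norm p q t (sharp_maximal f) (ancestor k i))"
    using scaled_norm_le_ancestors[OF pq0] by blast
  have key: "scaled_norm p q t (modulus f) i
        \<le> ennreal K * (\<Sum>k. ennreal (2 powr (- (?d / t * real k))) * scaled_norm p q t (sharp_maximal f) (ancestor k i))"
    if "f \<in> bml_space p q t r" for f :: "real^'n \<Rightarrow> complex" and i
    using bml_measurable[OF p q t r0 that] bml_locally_integrable[OF p q t r0 that] bml_average_decay[OF p q t r0 that]
    by (intro K(2)) auto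
  show thesis
  proof (cases r)
    case PInf
    define W where "W = 1 / (1 - 2 powr (- (?d / t)))"
    have lt1: "(2::real) powr (- (?d / t)) < 1" using t by (auto intro!: powr_less_one)
    have W: "0 < W" using lt1 by (simp add: W_def)
    show thesis
    proof (rule that)
      show "0 < K * W" using K W by simp
      fix f :: "real^'n \<Rightarrow> complex" assume f: "f \<in> bml_space p q t r"
      let ?M = "bml_norm p q t \<infinity> (sharp_maximal f)"
      have "scaled_norm p q t (modulus f) i \<le> ennreal (K * W) * ?M" for i
      proof -
        have "scaled_norm p q t (modulus f) i
          \<le> ennreal K * (\<Sum>k. ennreal (2 powr (- (?d / t * real k))) * scaled_norm p q t (sharp_maximal f) (ancestor k i))"
          using f by (rule key)
        also have "\<dots> \<le> ennreal K * (\<Sum>k. ennreal ((2 powr (- (?d / t))) ^ k) * ?M)"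
        proof (intro mult_left_mono suminf_le mult_mono)
          fix k
          show "ennreal (2 powr (- (?d / t * real k))) \<le> ennreal ((2 powr (- (?d / t))) ^ k)"
            by (subst powr_realpow[symmetric]) (auto simp: powr_powr)
        qed (auto intro: scaled_norm_le_bml_norm)
        also have "\<dots> = ennreal K * ((\<Sum>k. ennreal ((2 powr (- (?d / t))) ^ k)) * ?M)"
          by simp
        also have "(\<Sum>k. ennreal ((2 powr (- (?d / t))) ^ k)) = ennreal W"
          unfolding W_def using lt1 by (intro suminf_ennreal_eq geometric_sums) auto
        finally show ?thesis using K W by (simp add: ennreal_mult mult.assoc)
      qed
      then show "bml_norm p q t r (modulus f) \<le> ennreal (K * W) * bml_norm p q t r (sharp_maximal f)"
        unfolding PInf by (subst bml_norm_infinity) (intro SUP_least)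
    qed
  next
    case (real \<rho>)
    then have \<rho>: "t < \<rho>" "0 < \<rho>" using r t by auto
    \<comment> \<open>Half of the gap n (1/t - 1/\<rho>). The weights contribute 2^(\<beta>\<rho>k),
      the scaling 2^(-n\<rho>k/t) and the multiplicity 2^(nk); their product is
      2^(-\<beta>\<rho>k).\<close>
    define \<beta> where "\<beta> = ?d * (1 / t - 1 / \<rho>) / 2"
    have \<beta>: "0 < \<beta>" using \<rho> t by (simp add: \<beta>_def field_simps)
    define W where "W = 1 / (1 - 2 powr (- \<beta>))"
    define D where "D = 1 / (1 - 2 powr (- (\<beta> * \<rho>)))"
    have lt1: "(2::real) powr (- \<beta>) < 1" "(2::real) powr (- (\<beta> * \<rho>)) < 1" using \<beta> \<rho> by (auto intro!: powr_less_one)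
    have pos: "0 < W" "0 < D" using lt1 by (auto simp: W_def D_def)
    define A where "A = K powr \<rho> * W powr \<rho> * D"
    have A: "0 < A" using K pos by (simp add: A_def)
    show thesis
    proof (rule that)
      show "0 < A powr (1 / \<rho>)" using A by simp
      fix f :: "real^'n \<Rightarrow> complex" assume f: "f \<in> bml_space p q t r"
      let ?s = "scaled_norm p q t (sharp_maximal f)"
      let ?T = "\<integral>\<^sup>+i. ennpowr (?s i) \<rho> \<partial>count_space UNIV"
      have pt: "ennpowr (scaled_norm p q t (modulus f) i) \<rho>
        \<le> ennreal (K powr \<rho> * W powr \<rho>) * (\<Sum>k. ennreal (2 powr (\<rho> * (\<beta> - ?d / t) * real k)) * ennpowr (?s (ancestor k i)) \<rho>)" for i
      proof -
        have "ennpowr (scaled_norm p q t (modulus f) i) \<rho>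
          \<le> ennpowr (ennreal K * (\<Sum>k. ennreal (2 powr (- (?d / t * real k))) * ?s (ancestor k i))) \<rho>"
          using key[OF f] \<rho> by (intro ennpowr_mono) auto
        also have "\<dots> = ennreal (K powr \<rho>) * ennpowr (\<Sum>k. ennreal (2 powr (- (?d / t * real k))) * ?s (ancestor k i)) \<rho>"
          using K by (simp add: ennpowr_mult)
        also have "\<dots> \<le> ennreal (K powr \<rho>) * (ennreal (W powr \<rho>) * (\<Sum>k. ennreal (2 powr (\<beta> * \<rho> * real k)) * ennpowr (ennreal (2 powr (- (?d / t * real k))) * ?s (ancestor k i)) \<rho>))"
          unfolding W_def using \<beta> \<rho> by (intro mult_left_mono ennpowr_suminf_le) auto
        also have "(\<lambda>k. ennreal (2 powr (\<beta> * \<rho> * real k)) * ennpowr (ennreal (2 powr (- (?d / t * real k))) * ?s (ancestor k i)) \<rho>)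
          = (\<lambda>k. ennreal (2 powr (\<rho> * (\<beta> - ?d / t) * real k)) * ennpowr (?s (ancestor k i)) \<rho>)"
        proof
          fix k
          have "\<beta> * \<rho> * real k + - (?d / t * real k) * \<rho> = \<rho> * (\<beta> - ?d / t) * real k"
            by (simp add: algebra_simps)
          then have "2 powr (\<beta> * \<rho> * real k) * (2 powr (- (?d / t * real k))) powr \<rho> = 2 powr (\<rho> * (\<beta> - ?d / t) * real k)"
            by (simp only: powr_powr powr_add[symmetric])
          then have "ennreal (2 powr (\<beta> * \<rho> * real k)) * ennreal ((2 powr (- (?d / t * real k))) powr \<rho>) = ennreal (2 powr (\<rho> * (\<beta> - ?d / t) * real k))"
            by (simp flip: ennreal_mult)
          then show "ennreal (2 powr (\<beta> * \<rho> * real k)) * ennpowr (ennreal (2 powr (- (?d / t * real k))) * ?s (ancestor k i)) \<rho>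
            = ennreal (2 powr (\<rho> * (\<beta> - ?d / t) * real k)) * ennpowr (?s (ancestor k i)) \<rho>"
            by (simp add: ennpowr_mult flip: mult.assoc)
        qed
        finally show ?thesis by (simp add: ennreal_mult mult.assoc)
      qed
      have "(\<integral>\<^sup>+i. ennpowr (scaled_norm p q t (modulus f) i) \<rho> \<partial>count_space UNIV)
        \<le> (\<integral>\<^sup>+i. ennreal (K powr \<rho> * W powr \<rho>) * (\<Sum>k. ennreal (2 powr (\<rho> * (\<beta> - ?d / t) * real k)) * ennpowr (?s (ancestor k i)) \<rho>) \<partial>count_space UNIV)"
        by (intro nn_integral_mono pt)
      also have "\<dots> = ennreal (K powr \<rho> * W powr \<rho>) * (\<Sum>k. ennreal (2 powr (\<rho> * (\<beta> - ?d / t) * real k)) * (\<integral>\<^sup>+i. ennpowr (?s (ancestor k i)) \<rho> \<partial>count_space UNIV))"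
        by (simp add: nn_integral_cmult nn_integral_suminf)
      also have "\<dots> \<le> ennreal (K powr \<rho> * W powr \<rho>) * (\<Sum>k. ennreal ((2 powr (- (\<beta> * \<rho>))) ^ k) * ?T)"
      proof (intro mult_left_mono suminf_le)
        fix k
        have "\<rho> * (\<beta> - ?d / t) * real k + real k * ?d = - (\<beta> * \<rho>) * real k"
          using \<rho> t by (simp add: \<beta>_def field_simps)
        then have "2 powr (\<rho> * (\<beta> - ?d / t) * real k) * 2 powr (real k * ?d) = 2 powr (- (\<beta> * \<rho>) * real k)"
          by (simp only: powr_add[symmetric])
        moreover have "2 powr (real k * ?d) = 2 ^ (k * CARD('n))"
          by (subst powr_realpow[symmetric]) auto
        moreover have "(2 powr (- (\<beta> * \<rho>))) ^ k = 2 powr (- (\<beta> * \<rho>) * real k)"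
          by (subst powr_realpow[symmetric]) (auto simp: powr_powr)
        ultimately have e: "ennreal (2 powr (\<rho> * (\<beta> - ?d / t) * real k)) * ennreal (2 ^ (k * CARD('n))) = ennreal ((2 powr (- (\<beta> * \<rho>))) ^ k)"
          by (simp flip: ennreal_mult)
        have "ennreal (2 powr (\<rho> * (\<beta> - ?d / t) * real k)) * (\<integral>\<^sup>+i. ennpowr (?s (ancestor k i)) \<rho> \<partial>count_space UNIV)
          \<le> ennreal (2 powr (\<rho> * (\<beta> - ?d / t) * real k)) * (ennreal (2 ^ (k * CARD('n))) * ?T)"
          by (intro mult_left_mono nn_integral_ancestor_le) auto
        then show "ennreal (2 powr (\<rho> * (\<beta> - ?d / t) * real k)) * (\<integral>\<^sup>+i. ennpowr (?s (ancestor k i)) \<rho> \<partial>count_space UNIV)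
          \<le> ennreal ((2 powr (- (\<beta> * \<rho>))) ^ k) * ?T"
          by (simp only: e mult.assoc[symmetric])
      qed auto
      also have "\<dots> = ennreal (K powr \<rho> * W powr \<rho>) * ((\<Sum>k. ennreal ((2 powr (- (\<beta> * \<rho>))) ^ k)) * ?T)"
        by simp
      also have "(\<Sum>k. ennreal ((2 powr (- (\<beta> * \<rho>))) ^ k)) = ennreal D"
        unfolding D_def using lt1 by (intro suminf_ennreal_eq geometric_sums) auto
      also have "ennreal (K powr \<rho> * W powr \<rho>) * (ennreal D * ?T) = ennreal A * ?T"
        using pos by (simp add: A_def ennreal_mult mult.assoc)
      finally have "ennpowr (\<integral>\<^sup>+i. ennpowr (scaled_norm p q t (modulus f) i) \<rho> \<partial>count_space UNIV) (1 / \<rho>) \<le> ennpowr (ennreal A * ?T) (1 / \<rho>)"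
        using \<rho> by (intro ennpowr_mono) auto
      then show "bml_norm p q t r (modulus f) \<le> ennreal (A powr (1 / \<rho>)) * bml_norm p q t r (sharp_maximal f)"
        unfolding real bml_norm_finite using A by (simp add: ennpowr_mult)
    qed
  qed (use r0 in auto)
qed

subsection \<open>Integrability of the pairing with block spaces\<close>

text \<open>Local L^1 convergence yields the pointwise domination without passing to a subsequence:
  the truncated difference |g| - H lies below |g - partial sum| for every finite partial sum, so its
  integral over each ball is 0.\<close>

lemma sums_in_L1loc_dominated:
  fixes g :: "real^'n \<Rightarrow> complex" and u :: "int \<times> (int^'n) \<Rightarrow> real^'n \<Rightarrow> complex"
  assumes sums: "sums_in_L1loc u g" and [measurable]: "g \<in> borel_measurable lebesgue" "\<And>i. u i \<in> borel_measurable lebesgue"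
  shows "AE x in lebesgue. ennreal (cmod (g x)) \<le> (\<integral>\<^sup>+i. ennreal (cmod (u i x)) \<partial>count_space UNIV)"
proof -
  define H where "H x = (\<integral>\<^sup>+i. ennreal (cmod (u i x)) \<partial>count_space UNIV)" for x
  have [measurable]: "H \<in> borel_measurable lebesgue"
    unfolding H_def infsum_eq_nn_integral_count_space[symmetric]
    by (subst nonneg_infsum_complete) (auto intro!: borel_measurable_SUP countable_Collect_finite)
  have "AE x in lebesgue. x \<in> cball 0 (real N) \<longrightarrow> ennreal (cmod (g x)) - H x = 0" for N
  proof -
    let ?K = "cball 0 (real N) :: (real^'n) set"
    have [measurable]: "?K \<in> sets lebesgue" by simp
    have le: "(\<integral>\<^sup>+x\<in>?K. (ennreal (cmod (g x)) - H x) \<partial>lebesgue) \<le> (\<integral>\<^sup>+x\<in>?K. ennreal (cmod (g x - (\<Sum>i\<in>I. u i x))) \<partial>lebesgue)"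
      if "finite I" for I
    proof (intro nn_integral_mono mult_right_mono)
      fix x
      have "ennreal (cmod (g x)) \<le> ennreal (cmod (g x - (\<Sum>i\<in>I. u i x))) + ennreal (\<Sum>i\<in>I. cmod (u i x))"
        using norm_triangle_ineq[of "g x - (\<Sum>i\<in>I. u i x)" "\<Sum>i\<in>I. u i x"] norm_sum[of "\<lambda>i. u i x" I]
        by (subst ennreal_plus[symmetric]) (auto intro!: ennreal_leI sum_nonneg)
      also have "ennreal (\<Sum>i\<in>I. cmod (u i x)) = (\<Sum>i\<in>I. ennreal (cmod (u i x)))" by simp
      also have "\<dots> \<le> H x"
        unfolding H_def infsum_eq_nn_integral_count_space[symmetric]
        by (subst nonneg_infsum_complete) (use that in \<open>auto intro!: SUP_upper\<close>)
      finally have "ennreal (cmod (g x)) \<le> H x + ennreal (cmod (g x - (\<Sum>i\<in>I. u i x)))"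
        by (simp add: add_left_mono add.commute)
      then show "ennreal (cmod (g x)) - H x \<le> ennreal (cmod (g x - (\<Sum>i\<in>I. u i x)))"
        by (simp add: ennreal_minus_le_iff)
    qed simp
    have "(\<integral>\<^sup>+x\<in>?K. (ennreal (cmod (g x)) - H x) \<partial>lebesgue) \<le> 0"
    proof (rule tendsto_lowerbound)
      show "((\<lambda>I. \<integral>\<^sup>+x\<in>?K. ennreal (cmod (g x - (\<Sum>i\<in>I. u i x))) \<partial>lebesgue) \<longlongrightarrow> 0) (finite_subsets_at_top UNIV)"
        using sums by (simp add: sums_in_L1loc_def)
      show "\<forall>\<^sub>F I in finite_subsets_at_top UNIV. (\<integral>\<^sup>+x\<in>?K. (ennreal (cmod (g x)) - H x) \<partial>lebesgue)
          \<le> (\<integral>\<^sup>+x\<in>?K. ennreal (cmod (g x - (\<Sum>i\<in>I. u i x))) \<partial>lebesgue)"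
        using le by (auto intro: eventually_finite_subsets_at_top_weakI)
    qed simp
    then have "AE x in lebesgue. (ennreal (cmod (g x)) - H x) * indicator ?K x = 0"
      by (subst (asm) le_zero_eq, subst (asm) nn_integral_0_iff_AE) auto
    then show ?thesis by eventually_elim (auto simp: indicator_def)
  qed
  then have "AE x in lebesgue. \<forall>N. x \<in> cball 0 (real N) \<longrightarrow> ennreal (cmod (g x)) - H x = 0"
    unfolding AE_all_countable by blast
  then show ?thesis
  proof eventually_elim
    case (elim x)
    obtain N where "norm x \<le> real N" using real_arch_simple by blast
    then have "ennreal (cmod (g x)) - H x = 0" using elim by auto
    then show ?case by (simp add: diff_eq_0_iff_ennreal H_def less_imp_le) 
  qed
qed

lemma summable_powr_nn_integral_finite:
  fixes x :: "'a::countable \<Rightarrow> real"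
  assumes "x summable_on UNIV" "\<And>i. 0 \<le> x i"
  shows "(\<integral>\<^sup>+i. ennreal (x i) \<partial>count_space UNIV) < \<infinity>"
proof -
  have "(\<integral>\<^sup>+i. ennreal (x i) \<partial>count_space UNIV) = (SUP F\<in>{F. finite F \<and> F \<subseteq> UNIV}. \<Sum>i\<in>F. ennreal (x i))"
    unfolding infsum_eq_nn_integral_count_space[symmetric] by (rule nonneg_infsum_complete) simp
  also have "\<dots> = ennreal (infsum x UNIV)"
    using assms by (subst infsum_nonneg_is_SUPREMUM_ennreal) (auto simp: sum_ennreal)
  finally show ?thesis by simp
qed

text \<open>By Lorentz-Hoelder, f paired with a block is at most the contribution of the cube of
  that block to the norm of f. Summing against the coefficients is then a pairing of l^r with
  l^r'.\<close>

lemma pairing_bml_block_finite: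
  fixes f g :: "real^'n \<Rightarrow> complex"
  assumes p: "1 < p" and q: "1 < q" and t: "1 < t" and r: "1 < r"
    and f: "f \<in> bml_space p q t r"
    and g: "g \<in> block_space (conj_exp p) (conj_exp q) (conj_exp t) (conj_exp r)"
  shows "(\<integral>\<^sup>+x. ennreal (cmod (f x * g x)) \<partial>lebesgue) < \<infinity>"
proof -
  define p' where "p' = conj_exp (ereal p)"
  define q' where "q' = conj_exp (ereal q)"
  define t' where "t' = conj_exp (ereal t)"
  have p': "1 < p'" "1 / p + 1 / p' = 1" and q': "1 < q'" "1 / q + 1 / q' = 1" and t': "1 < t'" "1 / t + 1 / t' = 1"
    using conj_exp_props p q t by (auto simp: p'_def q'_def t'_def)
  have r0: "0 < r" using r by (rule less_trans[rotated]) simp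
  have [measurable]: "f \<in> borel_measurable lebesgue" "g \<in> borel_measurable lebesgue"
    using f g by (auto simp: bml_space_def block_space_def)
  obtain c b where sum: "(\<lambda>i. cmod (c i) powr conj_exp r) summable_on UNIV"
    and block: "\<And>i. is_block p' q' t' (dyadic_cube i) (b i)"
    and L1: "sums_in_L1loc (\<lambda>i x. c i * b i x) g"
    using g unfolding block_space_def p'_def q'_def t'_def by blast
  have [measurable]: "b i \<in> borel_measurable lebesgue" for i
    using block[of i] by (simp add: is_block_def)
  let ?s = "scaled_norm p q t (modulus f)"
  have single: "(\<integral>\<^sup>+x. ennreal (cmod (f x)) * ennreal (cmod (b i x)) \<partial>lebesgue) \<le> ?s i" for i
  proof -
    let ?Q = "dyadic_cube i"
    have m: "(\<lambda>x. modulus f x * indicator ?Q x) \<in> borel_measurable lebesgue" "modulus (b i) \<in> borel_measurable lebesgue"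
      unfolding modulus_def by measurable
    have "(\<integral>\<^sup>+x. ennreal (cmod (f x)) * ennreal (cmod (b i x)) \<partial>lebesgue) = (\<integral>\<^sup>+x. (modulus f x * indicator ?Q x) * modulus (b i) x \<partial>lebesgue)"
      using block[of i] by (intro nn_integral_cong) (auto simp: modulus_def is_block_def indicator_def)
    also have "\<dots> \<le> lorentz_norm p q (\<lambda>x. modulus f x * indicator ?Q x) * lorentz_norm p' q' (modulus (b i))"
      using p' q' q m by (intro lorentz_Hoelder) auto
    also have "\<dots> \<le> lorentz_norm p q (\<lambda>x. modulus f x * indicator ?Q x) * ennreal (measure lebesgue ?Q powr (1 / p' - 1 / t'))"
      using block[of i] by (intro mult_left_mono) (auto simp: is_block_def)
    \<comment> \<open>The normalisation of blocks is dual to the weights in the norm of f.\<close>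
    also have "1 / p' - 1 / t' = 1 / t - 1 / p" using p' t' by simp
    finally show ?thesis by (simp add: scaled_norm_def lorentz_norm_on_def mult.commute)
  qed
  have "AE x in lebesgue. ennreal (cmod (g x)) \<le> (\<integral>\<^sup>+i. ennreal (cmod (c i * b i x)) \<partial>count_space UNIV)"
    by (intro sums_in_L1loc_dominated[OF L1]) measurable
  then have "AE x in lebesgue. ennreal (cmod (f x * g x))
      \<le> (\<integral>\<^sup>+i. ennreal (cmod (c i)) * (ennreal (cmod (f x)) * ennreal (cmod (b i x))) \<partial>count_space UNIV)"
  proof (rule eventually_mono)
    fix x
    assume "ennreal (cmod (g x)) \<le> (\<integral>\<^sup>+i. ennreal (cmod (c i * b i x)) \<partial>count_space UNIV)"
    then have "ennreal (cmod (f x)) * ennreal (cmod (g x)) \<le> ennreal (cmod (f x)) * (\<integral>\<^sup>+i. ennreal (cmod (c i * b i x)) \<partial>count_space UNIV)"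
      by (rule mult_left_mono) simp
    also have "\<dots> = (\<integral>\<^sup>+i. ennreal (cmod (f x)) * ennreal (cmod (c i * b i x)) \<partial>count_space UNIV)"
      by (simp add: nn_integral_cmult)
    also have "\<dots> = (\<integral>\<^sup>+i. ennreal (cmod (c i)) * (ennreal (cmod (f x)) * ennreal (cmod (b i x))) \<partial>count_space UNIV)"
      by (intro nn_integral_cong) (simp add: norm_mult ennreal_mult ac_simps)
    finally show "ennreal (cmod (f x * g x)) \<le> (\<integral>\<^sup>+i. ennreal (cmod (c i)) * (ennreal (cmod (f x)) * ennreal (cmod (b i x))) \<partial>count_space UNIV)"
      by (simp add: norm_mult ennreal_mult)
  qed
  then have "(\<integral>\<^sup>+x. ennreal (cmod (f x * g x)) \<partial>lebesgue)
      \<le> (\<integral>\<^sup>+x. (\<integral>\<^sup>+i. ennreal (cmod (c i)) * (ennreal (cmod (f x)) * ennreal (cmod (b i x))) \<partial>count_space UNIV) \<partial>lebesgue)"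
    by (rule nn_integral_mono_AE)
  also have "\<dots> = (\<integral>\<^sup>+i. (\<integral>\<^sup>+x. ennreal (cmod (c i)) * (ennreal (cmod (f x)) * ennreal (cmod (b i x))) \<partial>lebesgue) \<partial>count_space UNIV)"
    by (intro nn_integral_count_space_nn_integral) auto
  also have "\<dots> \<le> (\<integral>\<^sup>+i. ennreal (cmod (c i)) * ?s i \<partial>count_space UNIV)"
    by (intro nn_integral_mono) (simp add: nn_integral_cmult mult_left_mono single)
  also have "\<dots> < \<infinity>"
  proof (cases r)
    case PInf
    \<comment> \<open>The conjugate exponent of infinity is 1, so the coefficients are absolutely
      summable.\<close>
    then have "(\<lambda>i. cmod (c i)) summable_on UNIV" using sum by (simp add: conj_exp_def)
    then have fin: "(\<integral>\<^sup>+i. ennreal (cmod (c i)) \<partial>count_space UNIV) < \<infinity>"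
      by (rule summable_powr_nn_integral_finite) simp
    have "(\<integral>\<^sup>+i. ennreal (cmod (c i)) * ?s i \<partial>count_space UNIV) \<le> (\<integral>\<^sup>+i. ennreal (cmod (c i)) * bml_norm p q t r (modulus f) \<partial>count_space UNIV)"
      using scaled_norm_le_bml_norm[OF r0] by (intro nn_integral_mono mult_left_mono) auto
    also have "\<dots> = (\<integral>\<^sup>+i. ennreal (cmod (c i)) \<partial>count_space UNIV) * bml_norm p q t r (modulus f)"
      by (simp add: nn_integral_multc)
    also have "\<dots> < \<infinity>" using fin f by (simp add: bml_space_def ennreal_mult_less_top)
    finally show ?thesis .
  next
    case (real \<rho>)
    then have \<rho>: "1 < \<rho>" using r by simp
    define \<rho>' where "\<rho>' = conj_exp r"
    have \<rho>': "1 < \<rho>'" "1 / \<rho> + 1 / \<rho>' = 1" using conj_exp_props[OF \<rho>] by (auto simp: \<rho>'_def real)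
    have fin: "(\<integral>\<^sup>+i. ennreal (cmod (c i) powr \<rho>') \<partial>count_space UNIV) < \<infinity>"
      using sum unfolding \<rho>'_def by (rule summable_powr_nn_integral_finite) simp
    have "(\<integral>\<^sup>+i. ennreal (cmod (c i)) * ?s i \<partial>count_space UNIV)
      \<le> ennpowr (\<integral>\<^sup>+i. ennpowr (ennreal (cmod (c i))) \<rho>' \<partial>count_space UNIV) (1 / \<rho>') * ennpowr (\<integral>\<^sup>+i. ennpowr (?s i) \<rho> \<partial>count_space UNIV) (1 / \<rho>)"
      using \<rho> \<rho>' by (intro nn_integral_Hoelder) auto
    also have "ennpowr (\<integral>\<^sup>+i. ennpowr (?s i) \<rho> \<partial>count_space UNIV) (1 / \<rho>) = bml_norm p q t r (modulus f)"
      by (simp add: real bml_norm_finite)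
    also have "ennpowr (\<integral>\<^sup>+i. ennpowr (ennreal (cmod (c i))) \<rho>' \<partial>count_space UNIV) (1 / \<rho>') * bml_norm p q t r (modulus f) < \<infinity>"
      using fin f by (simp add: bml_space_def ennreal_mult_eq_top_iff less_top[symmetric])
    finally show ?thesis .
  qed (use r0 in auto)
  finally show ?thesis .
qed

text \<open>The balls are open, so every superlevel set is a union of open balls. Measurability is
  what allows the constant to leave the last integral.\<close>

lemma maximal_measurable: "maximal (g :: real^'n \<Rightarrow> complex) \<in> borel_measurable lebesgue"
proof (rule borel_measurableI_greater)
  fix s
  have "open {x. s < maximal g x}"
  proof (subst open_subopen, clarify)
    fix x assume "s < maximal g x"
    then obtain y \<rho> where B: "0 < \<rho>" "x \<in> ball y \<rho>" "s < mean_abs g (ball y \<rho>)"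
      unfolding maximal_def less_SUP_iff by (auto simp: balls_at_def)
    have "ball y \<rho> \<subseteq> {x. s < maximal g x}"
      unfolding maximal_def less_SUP_iff using B by (auto simp: balls_at_def)
    then show "\<exists>T. open T \<and> x \<in> T \<and> T \<subseteq> {x. s < maximal g x}"
      using B by (intro exI[of _ "ball y \<rho>"]) auto
  qed
  then show "{x \<in> space lebesgue. s < maximal g x} \<in> sets lebesgue"
    by (simp add: borel_open)
qed

theorem theorem4p15:
  fixes p q t :: real and r :: ereal
  assumes "1 < q"
    and "(1 < p \<and> p < t \<and> ereal t < r \<and> r < \<infinity>) \<or> (1 < p \<and> p \<le> t \<and> ereal t < r \<and> r = \<infinity>)"
  shows "\<exists>C1 > 0. \<exists>C2 > 0. \<exists>C3 > 0.
      (\<forall>f \<in> (bml_space p q t r :: (real^'n \<Rightarrow> complex) set).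
       \<forall>g \<in> block_space (conj_exp p) (conj_exp q) (conj_exp t) (conj_exp r).
         integrable lebesgue (\<lambda>x. f x * g x) \<and>
         ennreal (cmod (\<integral>x. f x * g x \<partial>lebesgue))
           \<le> ennreal C1 * (\<integral>\<^sup>+x. sharp_maximal f x * dyadic_maximal g x \<partial>lebesgue) \<and>
         (\<integral>\<^sup>+x. sharp_maximal f x * dyadic_maximal g x \<partial>lebesgue)
           \<le> ennreal C2 * (\<integral>\<^sup>+x. sharp_maximal f x * maximal g x \<partial>lebesgue)) \<and>
      (\<forall>f \<in> (bml_space p q t r :: (real^'n \<Rightarrow> complex) set).
         bml_norm p q t r (modulus f) \<le> ennreal C3 * bml_norm p q t r (sharp_maximal f))"
proof -
  have p: "1 < p" and t: "1 < t" "0 < t" and r: "ereal t < r" using assms(2) by auto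
  have r1: "1 < r" using t by (intro less_trans[OF _ r]) simp
  have r0: "0 < r" using t by (intro less_trans[OF _ r]) simp
  obtain C3 where C3: "0 < C3" "\<And>f :: real^'n \<Rightarrow> complex. f \<in> bml_space p q t r \<Longrightarrow>
       bml_norm p q t r (modulus f) \<le> ennreal C3 * bml_norm p q t r (sharp_maximal f)"
    using bml_norm_le_sharp[OF p assms(1) t(2) r] by blast
  \<comment> \<open>\<open>C1\<close> is the number of orthants times the constant for a single
    cube; \<open>C2\<close> is the volume ratio between enclosing ball and cube.\<close>
  define C1 :: real where "C1 = 2 ^ CARD('n) * 2 ^ (CARD('n) + 3)"
  define C2 :: real where "C2 = (2 * real CARD('n)) ^ CARD('n)"
  have C12: "0 < C1" "0 < C2" by (simp_all add: C1_def C2_def)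
  have main: "integrable lebesgue (\<lambda>x. f x * g x) \<and>
         ennreal (cmod (\<integral>x. f x * g x \<partial>lebesgue))
           \<le> ennreal C1 * (\<integral>\<^sup>+x. sharp_maximal f x * dyadic_maximal g x \<partial>lebesgue) \<and>
         (\<integral>\<^sup>+x. sharp_maximal f x * dyadic_maximal g x \<partial>lebesgue)
           \<le> ennreal C2 * (\<integral>\<^sup>+x. sharp_maximal f x * maximal g x \<partial>lebesgue)"
    if f: "f \<in> bml_space p q t r" and g: "g \<in> block_space (conj_exp p) (conj_exp q) (conj_exp t) (conj_exp r)"
    for f g :: "real^'n \<Rightarrow> complex"
  proof (intro conjI)
    have [measurable]: "f \<in> borel_measurable lebesgue" "g \<in> borel_measurable lebesgue"
      using f g by (auto simp: bml_space_def block_space_def)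
    have loc: "locally_integrable f" by (rule bml_locally_integrable[OF p assms(1) t(2) r0 f])
    note [measurable] = sharp_maximal_measurable[OF loc] maximal_measurable
    show int: "integrable lebesgue (\<lambda>x. f x * g x)"
      using pairing_bml_block_finite[OF p assms(1) t(1) r1 f g] by (intro integrableI_bounded) auto
    have "ennreal (cmod (\<integral>x. f x * g x \<partial>lebesgue)) \<le> (\<integral>\<^sup>+x. ennreal (cmod (f x * g x)) \<partial>lebesgue)"
      using int by (rule integral_norm_bound_ennreal)
    also have "\<dots> \<le> ennreal C1 * (\<integral>\<^sup>+x. sharp_maximal f x * dyadic_maximal g x \<partial>lebesgue)"
      unfolding C1_def using loc bml_average_decay[OF p assms(1) t(2) r0 f]
      by (intro pairing_le_sharp_dyadic) auto
    finally show "ennreal (cmod (\<integral>x. f x * g x \<partial>lebesgue)) \<le> \<dots>" .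
    have "(\<integral>\<^sup>+x. sharp_maximal f x * dyadic_maximal g x \<partial>lebesgue)
        \<le> (\<integral>\<^sup>+x. ennreal C2 * (sharp_maximal f x * maximal g x) \<partial>lebesgue)"
    proof (rule nn_integral_mono)
      fix x
      have "sharp_maximal f x * dyadic_maximal g x \<le> sharp_maximal f x * (ennreal C2 * maximal g x)"
        unfolding C2_def by (intro mult_left_mono dyadic_maximal_le_maximal) simp
      then show "sharp_maximal f x * dyadic_maximal g x \<le> ennreal C2 * (sharp_maximal f x * maximal g x)"
        by (simp add: mult.left_commute)
    qed
    also have "\<dots> = ennreal C2 * (\<integral>\<^sup>+x. sharp_maximal f x * maximal g x \<partial>lebesgue)"
      by (intro nn_integral_cmult) measurable
    finally show "(\<integral>\<^sup>+x. sharp_maximal f x * dyadic_maximal g x \<partial>lebesgue) \<le> \<dots>" .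
  qed
  show ?thesis
    using C12 C3 main by (intro exI[of _ C1] conjI exI[of _ C2] exI[of _ C3] ballI) auto
qed

end
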